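(* Let $\mathcal{F}=\{f_j\}_{j=1}^n$ be a frame for $\mathbb{C}^d$ and set $m=2d-n$. Let $\varepsilon>0$ and $t>\operatorname{tr}(S_{\mathcal{F}^\#})$ be such that $t-\operatorname{tr}(S_{\mathcal{F}^\#})\le \min\{d-m,\,d\}\cdot\varepsilon^2$. Let $\lambda=\lambda(S_{\mathcal{F}^\#})$ and let $\rho=\rho_{(t,\varepsilon^2)}(\lambda,m)$ be the $\prec_w$-minimizer of $\Lambda_{(t,\varepsilon^2)}(\lambda,m)$ described in the context. Then: 1. There exists $\mathcal{G}_0\in\mathcal{D}_{(t,\varepsilon)}(\mathcal{F})$ such that $\lambda(S_{\mathcal{G}_0})=\rho^\downarrow$. 2. For any $\mathcal{G}\in\mathcal{D}_{(t,\varepsilon)}(\mathcal{F})$: $\lambda(S_{\mathcal{G}})\prec_w\lambda(S_{\mathcal{G}'})$ for every $\mathcal{G}'\in\mathcal{D}_{(t,\varepsilon)}(\mathcal{F})$ if and only if $\lambda(S_{\mathcal{G}})=\rho^\downarrow$. 3. Given $\mathcal{G}\in\mathcal{D}_{(t,\varepsilon)}(\mathcal{F})$, one has $\lambda(S_{\mathcal{G}})=\rho^\downarrow$ if and only if $\mathcal{G}=\{f_i^\#+k_i\}_{i=1}^n$ for some $\mathcal{K}=\{k_i\}_{i=1}^n$ such that $T_{\mathcal{F}}^*T_{\mathcal{K}}=0$ and such that there exists an orthonormal basis $\{v_j\}_{j=1}^d$ of $\mathbb{C}^d$ with $$S_{\mathcal{F}^\#}=\sum_{j=1}^d\lambda_j\,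 v_j\otimes v_j\quad\text{and}\quad S_{\mathcal{K}}=\sum_{j=1}^d(\rho-\lambda)_j\, v_j\otimes v_j .$$ In this case $S_{\mathcal{G}}=S_{\mathcal{F}^\#}+S_{\mathcal{K}}$; in particular, $S_{\mathcal{F}^\#}$ and $S_{\mathcal{G}}$ commute.
   Context: For a finite sequence $\mathcal{F}=\{f_i\}_{i=1}^n$ in $\mathbb{C}^d$, the analysis operator $T_{\mathcal{F}}:\mathbb{C}^d\to\mathbb{C}^n$ is $T_{\mathcal{F}}x=(\langle x,f_i\rangle)_{i=1}^n$, and the frame operator is $S_{\mathcal{F}}=T_{\mathcal{F}}^*T_{\mathcal{F}}=\sum_{i=1}^n f_i\otimes f_i$, where $(x\otimes y)(z)=\langle z,y\rangle x$. $\mathcal{F}$ is a frame for $\mathbb{C}^d$ iff it spans $\mathbb{C}^d$ (equivalently, $S_{\mathcal{F}}$ is invertible). A dual frame of $\mathcal{F}$ is a sequence $\mathcal{G}=\{g_i\}_{i=1}^n$ in $\mathbb{C}^d$ with $T_{\mathcal{F}}^*T_{\mathcal{G}}=I$; $\mathcal{D}(\mathcal{F})$ is the set of dual frames. The canonical dual is $\mathcal{F}^\#=\{f_i^\#\}_{i=1}^n$ with $f_i^\#=S_{\mathcal{F}}^{-1}f_i$. Define $$\mathcal{D}_{(t,\varepsilon)}(\mathcal{F})=\Big\{\mathcal{G}=\{g_j\}_{j=1}^n\in\mathcal{D}(\mathcal{F}):\ \sum_{j=1}^n\|g_j\|^2\ge t,\ \|T_{\mathcal{G}}-T_{\mathcal{F}^\#}\|\le\varepsilon\Big\}$$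 with $\|\cdot\|$ on operators the spectral norm. For a positive semidefinite $d\times d$ matrix $S$, $\lambda(S)=(\lambda_i(S))_{i=1}^d$ is the vector of eigenvalues counted with multiplicity in non-increasing order. For $x\in\mathbb{R}^d$, $x^\downarrow$ (resp. $x^\uparrow$) is its rearrangement in non-increasing (resp. non-decreasing) order and $\operatorname{tr}x=\sum_i x_i$. Submajorization: $x\prec_w y$ means $\sum_{i=1}^k x_i^\downarrow\le\sum_{i=1}^k y_i^\downarrow$ for all $1\le k\le d$. For $\lambda\in\mathbb{R}^d$ with $\lambda=\lambda^\downarrow$, $\eta>0$, an integer $m\le d-1$, and $t\ge\operatorname{tr}\lambda$ with $t-\operatorname{tr}\lambda\le\min\{d-m,d\}\cdot\eta$, let $$\Lambda_{(t,\eta)}(\lambda,m)=\{\lambda+\mu:\ \mu\in\mathbb{R}^d,\ 0\le\mu_i\le\eta\ \forall i,\ \operatorname{tr}\mu\ge t-\operatorname{tr}\lambda,\ \#\{j:\mu_j\ne0\}\le d-m\}.$$ The vector $\rho_{(t,\eta)}(\lambda,m)$ denotes the unique $\rho\in\Lambda_{(t,\eta)}(\lambda,m)$ such that $\operatorname{tr}\rho=t$, $\rho\prec_w\gamma$ for every $\gamma\in\Lambda_{(t,\eta)}(\lambda,m)$, and $\rho-\lambda=(\rho-\lambda)^\uparrow$ (such a $\rho$ exists and is unique). *)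

theory Defs
  imports
    "HOL-Analysis.L2_Norm"
    "Jordan_Normal_Form.Char_Poly"
    "Jordan_Normal_Form.Schur_Decomposition"
    "Jordan_Normal_Form.VS_Connect"
begin

text \<open>
  A finite sequence in \<open>\<complex>\<^sup>d\<close> is a list of vectors in \<open>carrier_vec d\<close>; indices run over
  \<open>0,\<dots>,n-1\<close>. A vector in \<open>\<real>\<^sup>d\<close> (eigenvalue lists, \<open>\<lambda>\<close>, \<open>\<mu>\<close>, \<open>\<rho>\<close>) is a \<open>real list\<close> of
  length \<open>d\<close>. The inner product \<open>x \<bullet>c y\<close> is conjugate-linear in \<open>y\<close>.
\<close>

subsection \<open>Norms and matrices\<close>

definition vnorm :: "complex vec \<Rightarrow> real" where
  "vnorm x = L2_set (\<lambda>i. cmod (x $ i)) {..<dim_vec x}"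

definition spectral_norm :: "complex mat \<Rightarrow> real" where
  "spectral_norm A =
     (SUP x \<in> {x \<in> carrier_vec (dim_col A). vnorm x \<le> 1}. vnorm (A *\<^sub>v x))"

definition mat_trace :: "complex mat \<Rightarrow> complex" where
  "mat_trace A = (\<Sum>i<dim_row A. A $$ (i, i))"

definition outer :: "complex vec \<Rightarrow> complex vec \<Rightarrow> complex mat" where
  "outer x y = mat (dim_vec x) (dim_vec y) (\<lambda>(i, j). x $ i * cnj (y $ j))"

lemma outer_apply:
  assumes "dim_vec z = dim_vec y"
  shows "outer x y *\<^sub>v z = (z \<bullet>c y) \<cdot>\<^sub>v x"
  using assms
  by (intro eq_vecI)
     (auto simp: outer_def scalar_prod_def sum_distrib_right intro!: sum.cong)

definition outer_sum :: "nat \<Rightarrow> real list \<Rightarrow> complex vec list \<Rightarrow> complex mat" where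
  "outer_sum d c v =
     mat d d (\<lambda>(i, j). \<Sum>k<d. complex_of_real (c ! k) * outer (v ! k) (v ! k) $$ (i, j))"

definition spans :: "nat \<Rightarrow> complex vec list \<Rightarrow> bool" where
  "spans d v \<longleftrightarrow>
     LinearCombinations.module.span class_ring (module_vec TYPE(complex) d) (set v)
       = carrier_vec d"

definition orthonormal_basis :: "nat \<Rightarrow> complex vec list \<Rightarrow> bool" where
  "orthonormal_basis d v \<longleftrightarrow>
     length v = d \<and> set v \<subseteq> carrier_vec d \<and> spans d v \<and>
     (\<forall>i<d. \<forall>j<d. (v ! i) \<bullet>c (v ! j) = (if i = j then 1 else 0))"

text \<open>
  Intended for positive semidefinite \<open>S\<close>: its characteristic roots are real, so
  taking real parts only changes the type.
\<close>
definition eigenvalues_decr :: "complex mat \<Rightarrow> real list" where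
  "eigenvalues_decr S = rev (sorted_list_of_multiset (image_mset Re (proots (char_poly S))))"

subsection \<open>Frames and dual frames\<close>

definition is_frame :: "nat \<Rightarrow> complex vec list \<Rightarrow> bool" where
  "is_frame d F \<longleftrightarrow> set F \<subseteq> carrier_vec d \<and> spans d F"

definition analysis :: "nat \<Rightarrow> complex vec list \<Rightarrow> complex mat" where
  "analysis d F = mat_of_rows d (map conjugate F)"

lemma analysis_apply:
  assumes "set F \<subseteq> carrier_vec d" "x \<in> carrier_vec d"
  shows "analysis d F *\<^sub>v x = vec (length F) (\<lambda>i. x \<bullet>c (F ! i))"
proof (rule eq_vecI)
  fix i assume "i < dim_vec (vec (length F) (\<lambda>i. x \<bullet>c (F ! i)))"
  then have i: "i < length F" by simp
  then have "F ! i \<in> carrier_vec d" using assms(1) nth_mem by blast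
  then show "(analysis d F *\<^sub>v x) $ i = vec (length F) (\<lambda>i. x \<bullet>c (F ! i)) $ i"
    using i assms(2) by (simp add: analysis_def comm_scalar_prod[of _ d])
qed (simp add: analysis_def)

definition frame_op :: "nat \<Rightarrow> complex vec list \<Rightarrow> complex mat" where
  "frame_op d F = mat_adjoint (analysis d F) * analysis d F"

definition dual_frames :: "nat \<Rightarrow> complex vec list \<Rightarrow> complex vec list set" where
  "dual_frames d F =
     {G. length G = length F \<and> set G \<subseteq> carrier_vec d \<and>
         mat_adjoint (analysis d F) * analysis d G = 1\<^sub>m d}"

definition canonical_dual :: "nat \<Rightarrow> complex vec list \<Rightarrow> complex vec list" where
  "canonical_dual d F = map (\<lambda>f. the (mat_inverse (frame_op d F)) *\<^sub>v f) F"

definition restricted_duals ::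
    "nat \<Rightarrow> real \<Rightarrow> real \<Rightarrow> complex vec list \<Rightarrow> complex vec list set" where
  "restricted_duals d t \<epsilon> F =
     {G \<in> dual_frames d F.
        (\<Sum>j<length G. (vnorm (G ! j))\<^sup>2) \<ge> t \<and>
        spectral_norm (analysis d G - analysis d (canonical_dual d F)) \<le> \<epsilon>}"

subsection \<open>Submajorization and the minimizer\<close>

definition decr :: "real list \<Rightarrow> real list" where
  "decr x = rev (sort x)"

definition submajorized :: "real list \<Rightarrow> real list \<Rightarrow> bool" (infix \<open>\<prec>\<^sub>w\<close> 50) where
  "x \<prec>\<^sub>w y \<longleftrightarrow>
     length x = length y \<and>
     (\<forall>k\<in>{1..length x}. sum_list (take k (decr x)) \<le> sum_list (take k (decr y)))"

text \<open>
  The parameter \<open>m\<close> is an integer since \<open>m = 2d - n\<close> may be negative.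
\<close>
definition perturbed_set :: "real \<Rightarrow> real \<Rightarrow> real list \<Rightarrow> int \<Rightarrow> real list set" where
  "perturbed_set t \<eta> lam m =
     {map2 (+) lam \<mu> | \<mu>.
        length \<mu> = length lam \<and> (\<forall>x\<in>set \<mu>. 0 \<le> x \<and> x \<le> \<eta>) \<and>
        sum_list \<mu> \<ge> t - sum_list lam \<and>
        int (card {j. j < length \<mu> \<and> \<mu> ! j \<noteq> 0}) \<le> int (length lam) - m}"

definition rho_min :: "real \<Rightarrow> real \<Rightarrow> real list \<Rightarrow> int \<Rightarrow> real list" where
  "rho_min t \<eta> lam m =
     (THE \<rho>. \<rho> \<in> perturbed_set t \<eta> lam m \<and> sum_list \<rho> = t \<and>
            (\<forall>\<gamma>\<in>perturbed_set t \<eta> lam m. \<rho> \<prec>\<^sub>w \<gamma>) \<and>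
            map2 (-) \<rho> lam = sort (map2 (-) \<rho> lam))"

subsection \<open>Shifts of the canonical dual\<close>

text \<open>
  \<open>G\<close> is the canonical dual shifted by \<open>K\<close>, where \<open>T\<^sub>F\<^sup>* T\<^sub>K = 0\<close> and one orthonormal basis
  diagonalizes both frame operators, with eigenvalues \<open>\<lambda>\<close> and \<open>\<rho> - \<lambda>\<close> paired by index.
\<close>
definition diagonal_shift ::
    "nat \<Rightarrow> complex vec list \<Rightarrow> real list \<Rightarrow> real list \<Rightarrow>
     complex vec list \<Rightarrow> complex vec list \<Rightarrow> bool" where
  "diagonal_shift d F lam \<rho> G K \<longleftrightarrow>
     length K = length F \<and> set K \<subseteq> carrier_vec d \<and>
     G = map2 (+) (canonical_dual d F) K \<and>
     mat_adjoint (analysis d F) * analysis d K = 0\<^sub>m d d \<and>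
     (\<exists>v. orthonormal_basis d v \<and>
          frame_op d (canonical_dual d F) = outer_sum d lam v \<and>
          frame_op d K = outer_sum d (map2 (-) \<rho> lam) v)"

end

theory Submission
  imports Defs
begin

text \<open>
  Let \<open>A\<close> be the frame operator of the canonical dual and \<open>\<lambda>\<close> its decreasing eigenvalue list. Every
  dual of \<open>F\<close> is the canonical dual shifted by some \<open>K\<close> with \<open>T\<^sub>F\<^sup>* T\<^sub>K = 0\<close>. The range of the
  canonical analysis operator is that of \<open>T\<^sub>F\<close>, so the cross terms vanish and \<open>S\<^sub>G = A + S\<^sub>K\<close>
  (\<open>frame_op_shift\<close>). The constraints on \<open>G\<close> thereby become constraints on the eigenvalues
  of \<open>S\<^sub>K\<close> alone: they lie in \<open>[0, \<epsilon>\<^sup>2]\<close> because of the spectral norm, they sum to at least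
  \<open>t - tr \<lambda>\<close>, and at most \<open>n - d\<close> of them are nonzero because \<open>T\<^sub>K\<close> maps into the orthogonal
  complement of the \<open>d\<close>-dimensional range of \<open>T\<^sub>F\<close> (\<open>rank_bound\<close>). If \<open>\<kappa>\<close> is the increasing
  eigenvalue list of \<open>S\<^sub>K\<close>, then \<open>\<lambda> + \<kappa>\<close> competes with \<open>\<rho>\<close>, and Lidskii's inequality gives
  \<open>\<rho> \<prec>\<^sub>w \<lambda> + \<kappa> \<prec>\<^sub>w \<lambda>(S\<^sub>G)\<close>. Conversely \<open>\<rho> - \<lambda>\<close> can be placed on any eigenbasis of \<open>A\<close>
  (\<open>gram_realize\<close>), so the bound \<open>\<rho>\<close> is attained.

  Submajorization is handled through the function \<open>q \<mapsto> \<Sum>\<^sub>i max 0 (x\<^sub>i - q)\<close>, called the excess: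
  a pointwise inequality between excess functions implies submajorization (\<open>submajorizedI\<close>).
  In this form Lidskii's inequality is a trace computation on top of Weyl's monotonicity
  principle, following Li and Mathias (\<open>lidskii\<close>). It also makes \<open>\<rho>\<close> transparent: \<open>\<rho>\<close> is
  obtained by water filling, that is, by raising the last entries of \<open>\<lambda>\<close> towards a common level
  by at most \<open>\<epsilon>\<^sup>2\<close> each, and against a sorted competitor its optimality can be read off entry by
  entry, above and below the level.

  For the equality case, suppose that \<open>\<lambda>(S\<^sub>G)\<close> is a rearrangement of \<open>\<rho>\<close>. The chain above collapses,
  so \<open>\<lambda> + \<kappa>\<close> has the excess function and the sum of \<open>\<rho>\<close>, and \<open>\<kappa> = \<rho> - \<lambda>\<close> because the water
  filling minimizer is unique (\<open>minimizer_unique\<close>). Now the spectrum of \<open>A + S\<^sub>K\<close> consists of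
  the numbers \<open>\<lambda>\<^sub>i + \<kappa>\<^sub>i\<close>. At an index where this sum is smallest, the test vector of Weyl's
  argument has to be a common eigenvector; splitting it off and arguing by induction on the dimension
  gives the common eigenbasis with the required pairing (\<open>joint_eigenbasis\<close>).
\<close>

section \<open>Orthonormal systems\<close>

lemma cinner_sum:
  fixes x y :: "complex vec"
  assumes "y \<in> carrier_vec n"
  shows "x \<bullet>c y = (\<Sum>i<n. x $ i * cnj (y $ i))"
  using assms by (simp add: scalar_prod_def atLeast0LessThan)

lemma mult_mat_vec_sum:
  assumes "A \<in> carrier_mat n d" "x \<in> carrier_vec d" "i < n"
  shows "(A *\<^sub>v x) $ i = (\<Sum>j<d. A $$ (i, j) * x $ j)"
  using assms by (simp add: scalar_prod_def atLeast0LessThan)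

lemma cinner_commute:
  fixes x y :: "complex vec"
  assumes "x \<in> carrier_vec n" "y \<in> carrier_vec n"
  shows "x \<bullet>c y = cnj (y \<bullet>c x)"
  using assms by (simp add: cinner_sum[of _ n] mult.commute)

lemma vnorm_sq: "x \<in> carrier_vec n \<Longrightarrow> (vnorm x)\<^sup>2 = (\<Sum>i<n. (cmod (x $ i))\<^sup>2)"
  by (simp add: vnorm_def L2_set_def sum_nonneg)

lemma vnorm_nonneg: "0 \<le> vnorm x"
  by (simp add: vnorm_def L2_set_nonneg)

lemma cinner_self: 
  assumes "x \<in> carrier_vec n"
  shows "x \<bullet>c x = complex_of_real ((vnorm x)\<^sup>2)"
proof -
  have "z * cnj z = complex_of_real ((cmod z)\<^sup>2)" for z
    by (metis complex_norm_square)
  then show ?thesis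
    using assms by (simp add: cinner_sum[of _ n] vnorm_sq del: of_real_power)
qed

lemma cinner_smult_left:
  fixes x y :: "complex vec"
  assumes "x \<in> carrier_vec n" "y \<in> carrier_vec n"
  shows "(a \<cdot>\<^sub>v x) \<bullet>c y = a * (x \<bullet>c y)"
  using assms by (simp add: cinner_sum[of _ n] sum_distrib_left mult.assoc)

lemma cinner_smult_right:
  fixes x y :: "complex vec"
  assumes "x \<in> carrier_vec n" "y \<in> carrier_vec n"
  shows "x \<bullet>c (a \<cdot>\<^sub>v y) = cnj a * (x \<bullet>c y)"
  using assms by (simp add: cinner_sum[of _ n] sum_distrib_left mult.assoc mult.left_commute)

lemma cinner_add_left:
  fixes x y z :: "complex vec"
  assumes "x \<in> carrier_vec n" "y \<in> carrier_vec n" "z \<in> carrier_vec n"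
  shows "(x + y) \<bullet>c z = x \<bullet>c z + y \<bullet>c z"
  using assms by (simp add: cinner_sum[of _ n] distrib_right sum.distrib)

lemma cinner_minus_left:
  fixes x y z :: "complex vec"
  assumes "x \<in> carrier_vec n" "y \<in> carrier_vec n" "z \<in> carrier_vec n"
  shows "(x - y) \<bullet>c z = x \<bullet>c z - y \<bullet>c z"
  using assms by (simp add: cinner_sum[of _ n] left_diff_distrib sum_subtractf)

lemma normalized_vector:
  fixes x :: "complex vec"
  assumes x: "x \<in> carrier_vec n" "x \<noteq> 0\<^sub>v n"
  obtains a :: complex where "a \<noteq> 0" "(a \<cdot>\<^sub>v x) \<bullet>c (a \<cdot>\<^sub>v x) = 1"
proof -
  have "x \<bullet>c x \<noteq> 0"
    using x by simp
  then have nz: "vnorm x \<noteq> 0"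
    using cinner_self[OF x(1)] by auto
  define a where "a = complex_of_real (1 / vnorm x)"
  have "(a \<cdot>\<^sub>v x) \<bullet>c (a \<cdot>\<^sub>v x) = a * (cnj a * (x \<bullet>c x))"
    using x by (simp add: cinner_smult_left[of _ n] cinner_smult_right[of _ n])
  also have "\<dots> = 1"
    using nz by (simp add: a_def cinner_self[OF x(1)] power2_eq_square)
  finally show ?thesis using that[of a] nz by (simp add: a_def)
qed

definition orthonormal :: "nat \<Rightarrow> complex vec list \<Rightarrow> bool" where
  "orthonormal n vs \<longleftrightarrow> set vs \<subseteq> carrier_vec n \<and>
     (\<forall>i<length vs. \<forall>j<length vs. vs ! i \<bullet>c vs ! j = (if i = j then 1 else 0))"

lemma orthonormal_carrier: "orthonormal n vs \<Longrightarrow> i < length vs \<Longrightarrow> vs ! i \<in> carrier_vec n"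
  by (auto simp: orthonormal_def)

lemma orthonormal_Cons:
  "orthonormal n (x # ws) \<longleftrightarrow>
     x \<in> carrier_vec n \<and> x \<bullet>c x = 1 \<and> (\<forall>w\<in>set ws. w \<bullet>c x = 0) \<and> orthonormal n ws" (is "?l = ?r")
proof
  assume l: ?l
  have "w \<bullet>c x = 0" if w: "w \<in> set ws" for w
  proof -
    obtain i where i: "i < length ws" "w = ws ! i" using w by (auto simp: in_set_conv_nth)
    then have "(x # ws) ! Suc i \<bullet>c (x # ws) ! 0 = 0"
      using l unfolding orthonormal_def by (metis Suc_less_eq length_Cons nat.distinct(1) zero_less_Suc)
    then show ?thesis using i by simp
  qed
  moreover have "(x # ws) ! 0 \<bullet>c (x # ws) ! 0 = 1"
    using l unfolding orthonormal_def by (metis length_Cons zero_less_Suc)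
  moreover have "ws ! i \<bullet>c ws ! j = (if i = j then 1 else 0)" if "i < length ws" "j < length ws" for i j
  proof -
    have "(x # ws) ! Suc i \<bullet>c (x # ws) ! Suc j = (if Suc i = Suc j then 1 else 0)"
      using l that unfolding orthonormal_def by (metis Suc_less_eq length_Cons)
    then show ?thesis by simp
  qed
  ultimately show ?r using l by (auto simp: orthonormal_def)
next
  assume r: ?r
  have "(x # ws) ! i \<bullet>c (x # ws) ! j = (if i = j then 1 else 0)"
    if ij: "i < length (x # ws)" "j < length (x # ws)" for i j
  proof (cases i)
    case 0
    show ?thesis
    proof (cases j)
      case 0 then show ?thesis using r \<open>i = 0\<close> by simp
    next
      case (Suc k)
      then have k: "ws ! k \<in> set ws" using ij by simp
      then have "ws ! k \<in> carrier_vec n" using r by (auto simp: orthonormal_def)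
      then have "x \<bullet>c ws ! k = 0" using r k cinner_commute[of x n "ws ! k"] by simp
      then show ?thesis using Suc 0 by simp
    qed
  next
    case (Suc l)
    show ?thesis
      using r ij Suc by (cases j) (auto simp: orthonormal_def)
  qed
  then show ?l using r by (auto simp: orthonormal_def)
qed

lemma orthonormal_Nil: "orthonormal n []"
  by (simp add: orthonormal_def)

text \<open>
  Fewer than \<open>n\<close> homogeneous linear conditions on \<open>\<complex>\<^sup>n\<close> have a nonzero common solution: padded with
  zero rows, the system has a square matrix of determinant zero. This one dimension count serves both
  to complete orthonormal systems and to intersect spectral subspaces in Weyl's argument.
\<close>

lemma orthogonal_unit_vector:
  fixes vs :: "complex vec list"
  assumes vs: "set vs \<subseteq> carrier_vec n" and len: "length vs < n"
  obtains x where "x \<in> carrier_vec n" "x \<bullet>c x = 1" "\<And>v. v \<in> set vs \<Longrightarrow> x \<bullet>c v = 0"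
proof -
  define M where "M = mat n n (\<lambda>(i, j). if i < length vs then cnj (vs ! i $ j) else 0)"
  have M: "M \<in> carrier_mat n n" by (simp add: M_def)
  let ?e = "unit_vec n (length vs) :: complex vec"
  have "M\<^sup>T *\<^sub>v ?e = 0\<^sub>v n"
  proof (rule eq_vecI)
    fix i assume "i < dim_vec (0\<^sub>v n :: complex vec)"
    then have i: "i < n" by simp
    show "(M\<^sup>T *\<^sub>v ?e) $ i = 0\<^sub>v n $ i"
      using i len by (simp add: M_def row_def)
  qed (simp add: M_def)
  moreover have "?e \<noteq> 0\<^sub>v n" using len by simp
  ultimately have "det M\<^sup>T = 0"
    using M det_0_iff_vec_prod_zero[of "M\<^sup>T" n] unit_vec_carrier[of n "length vs"] by (metis transpose_carrier_mat)
  then have "det M = 0" using det_transpose[OF M] by simp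
  then obtain y where y: "y \<in> carrier_vec n" "y \<noteq> 0\<^sub>v n" "M *\<^sub>v y = 0\<^sub>v n"
    using det_0_iff_vec_prod_zero[OF M] by blast
  have yv: "y \<bullet>c v = 0" if v: "v \<in> set vs" for v
  proof -
    obtain i where i: "i < length vs" "v = vs ! i" using v by (auto simp: in_set_conv_nth)
    have "0 = (M *\<^sub>v y) $ i" unfolding y(3) using i(1) len by simp
    also have "\<dots> = (\<Sum>j<n. M $$ (i, j) * y $ j)"
      using i(1) len by (intro mult_mat_vec_sum[OF M y(1)]) simp
    also have "\<dots> = (\<Sum>j<n. y $ j * cnj (v $ j))"
      using i len by (intro sum.cong refl) (simp add: M_def)
    also have "\<dots> = y \<bullet>c v"
      using vs v cinner_sum[of v n y] by auto
    finally show ?thesis by simp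
  qed
  obtain a where a: "a \<noteq> 0" "(a \<cdot>\<^sub>v y) \<bullet>c (a \<cdot>\<^sub>v y) = 1" using normalized_vector[OF y(1,2)] .
  show ?thesis
  proof (rule that[of "a \<cdot>\<^sub>v y"])
    fix v assume "v \<in> set vs"
    then show "(a \<cdot>\<^sub>v y) \<bullet>c v = 0"
      using yv y vs cinner_smult_left[of y n v a] by auto
  qed (use y a in auto)
qed

lemma orthonormal_in_complement:
  fixes vs :: "complex vec list"
  assumes vs: "set vs \<subseteq> carrier_vec n"
  shows "length vs + k \<le> n \<Longrightarrow>
    \<exists>ws. orthonormal n ws \<and> length ws = k \<and> (\<forall>w\<in>set ws. \<forall>v\<in>set vs. w \<bullet>c v = 0)"
proof (induction k)
  case 0
  then show ?case by (intro exI[of _ "[]"]) (simp add: orthonormal_Nil)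
next
  case (Suc k)
  then obtain ws where ws: "orthonormal n ws" "length ws = k" "\<forall>w\<in>set ws. \<forall>v\<in>set vs. w \<bullet>c v = 0"
    by auto
  have wsc: "set ws \<subseteq> carrier_vec n" using ws by (simp add: orthonormal_def)
  obtain x where x: "x \<in> carrier_vec n" "x \<bullet>c x = 1" "\<And>v. v \<in> set (vs @ ws) \<Longrightarrow> x \<bullet>c v = 0"
    using orthogonal_unit_vector[of "vs @ ws" n] vs wsc ws Suc.prems by auto
  have "w \<bullet>c x = 0" if "w \<in> set ws" for w
    using x that cinner_commute[of w n x] wsc by auto
  then show ?case
    using ws x by (intro exI[of _ "x # ws"]) (auto simp: orthonormal_Cons)
qed

text \<open>
  Orthonormality says \<open>V\<^sup>* V = 1\<close> for the square matrix \<open>V\<close> with these columns; one-sided inverses of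
  square matrices are two-sided, and \<open>V V\<^sup>* = 1\<close> is the claim.
\<close>

lemma orthonormal_basis_complete:
  assumes "orthonormal n vs" "length vs = n" "i < n" "j < n"
  shows "(\<Sum>k<n. vs ! k $ i * cnj (vs ! k $ j)) = (if i = j then 1 else 0)"
proof -
  define V where "V = mat n n (\<lambda>(i, k). vs ! k $ i)"
  define W where "W = mat n n (\<lambda>(k, i). cnj (vs ! k $ i))"
  have V: "V \<in> carrier_mat n n" and W: "W \<in> carrier_mat n n" by (auto simp: V_def W_def)
  have "W * V = 1\<^sub>m n"
  proof (rule eq_matI)
    fix k l assume "k < dim_row (1\<^sub>m n :: complex mat)" "l < dim_col (1\<^sub>m n :: complex mat)"
    then have kl: "k < n" "l < n" by auto
    have "(W * V) $$ (k, l) = (\<Sum>i<n. vs ! l $ i * cnj (vs ! k $ i))"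
      using kl by (simp add: V_def W_def scalar_prod_def atLeast0LessThan mult.commute)
    also have "\<dots> = vs ! l \<bullet>c vs ! k"
      using assms kl orthonormal_carrier[OF assms(1)] by (subst cinner_sum[of _ n]) auto
    also have "\<dots> = 1\<^sub>m n $$ (k, l)"
      using assms kl by (auto simp: orthonormal_def)
    finally show "(W * V) $$ (k, l) = 1\<^sub>m n $$ (k, l)" .
  qed (auto simp: V_def W_def)
  then have "V * W = 1\<^sub>m n" using mat_mult_left_right_inverse[OF W V] by simp
  then have "(V * W) $$ (i, j) = 1\<^sub>m n $$ (i, j)" by simp
  then show ?thesis
    using assms by (simp add: V_def W_def scalar_prod_def atLeast0LessThan)
qed

lemma parseval:
  assumes vs: "orthonormal n vs" "length vs = n" and x: "x \<in> carrier_vec n" and y: "y \<in> carrier_vec n"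
  shows "x \<bullet>c y = (\<Sum>k<n. (x \<bullet>c vs ! k) * cnj (y \<bullet>c vs ! k))"
proof -
  have c: "z \<bullet>c vs ! k = (\<Sum>i<n. z $ i * cnj (vs ! k $ i))" if "k < n" for z k
    using that vs orthonormal_carrier[OF vs(1)] by (subst cinner_sum[of _ n]) auto
  have "(\<Sum>k<n. (x \<bullet>c vs ! k) * cnj (y \<bullet>c vs ! k)) =
      (\<Sum>k<n. \<Sum>i<n. \<Sum>j<n. (x $ i * cnj (y $ j)) * (vs ! k $ j * cnj (vs ! k $ i)))"
    by (intro sum.cong refl) (simp add: c sum_product algebra_simps)
  also have "\<dots> = (\<Sum>i<n. \<Sum>k<n. \<Sum>j<n. (x $ i * cnj (y $ j)) * (vs ! k $ j * cnj (vs ! k $ i)))"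
    by (rule sum.swap)
  also have "\<dots> = (\<Sum>i<n. \<Sum>j<n. \<Sum>k<n. (x $ i * cnj (y $ j)) * (vs ! k $ j * cnj (vs ! k $ i)))"
    by (intro sum.cong refl sum.swap)
  also have "\<dots> = (\<Sum>i<n. \<Sum>j<n. (x $ i * cnj (y $ j)) * (if j = i then 1 else 0))"
    by (intro sum.cong refl) (simp add: sum_distrib_left[symmetric] orthonormal_basis_complete[OF vs])
  also have "\<dots> = (\<Sum>i<n. x $ i * cnj (y $ i))"
    by (simp add: if_distrib[of "\<lambda>z. _ * z"] sum.delta cong: if_cong)
  finally show ?thesis using y by (simp add: cinner_sum[of _ n])
qed

lemma orthonormal_basis_eqI:
  assumes vs: "orthonormal n vs" "length vs = n" and x: "x \<in> carrier_vec n" and y: "y \<in> carrier_vec n"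
    and eq: "\<And>k. k < n \<Longrightarrow> x \<bullet>c vs ! k = y \<bullet>c vs ! k"
  shows "x = y"
proof -
  have "(x - y) \<bullet>c vs ! k = 0" if "k < n" for k
    using that x y vs eq orthonormal_carrier[OF vs(1)] by (subst cinner_minus_left[of _ n]) auto
  then have "(x - y) \<bullet>c (x - y) = 0"
    using x y by (subst parseval[OF vs]) auto
  then have "x - y = 0\<^sub>v n" using x y by (metis conjugate_square_eq_0_vec minus_carrier_vec)
  then have "(x - y) $ i = 0" if "i < n" for i using that by simp
  then show ?thesis using x y by (intro eq_vecI) (auto)
qed

text \<open>
  The first \<open>n\<close> vectors form a basis already, so a further one, being orthogonal to all of them, would
  vanish by Parseval's identity.
\<close>

lemma orthonormal_length_le:
  assumes "orthonormal n vs"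
  shows "length vs \<le> n"
proof (rule ccontr)
  assume "\<not> length vs \<le> n"
  then have n: "n < length vs" by simp
  have t: "orthonormal n (take n vs)" "length (take n vs) = n"
    using assms n by (auto simp: orthonormal_def dest: in_set_takeD)
  have c: "vs ! n \<in> carrier_vec n" using orthonormal_carrier[OF assms n] .
  have "vs ! n \<bullet>c take n vs ! k = 0" if "k < n" for k
    using assms n that by (auto simp: orthonormal_def)
  then have "vs ! n \<bullet>c vs ! n = 0"
    using parseval[OF t c c] by simp
  then show False using assms n by (auto simp: orthonormal_def)
qed


section \<open>Orthonormal eigenbases of Hermitian matrices\<close>

lemma mult_cnj_cmod: "z * cnj z = complex_of_real ((cmod z)\<^sup>2)"
  by (metis complex_norm_square)

lemma mult_mat_sum:
  assumes "X \<in> carrier_mat n m" "Y \<in> carrier_mat m p" "i < n" "j < p"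
  shows "(X * Y) $$ (i, j) = (\<Sum>k<m. X $$ (i, k) * Y $$ (k, j))"
  using assms by (simp add: scalar_prod_def atLeast0LessThan)

definition hermitian_mat :: "nat \<Rightarrow> complex mat \<Rightarrow> bool" where
  "hermitian_mat d A \<longleftrightarrow>
     A \<in> carrier_mat d d \<and> (\<forall>i<d. \<forall>j<d. A $$ (i, j) = cnj (A $$ (j, i)))"

lemma hermitian_cinner:
  assumes A: "hermitian_mat d A" and x: "x \<in> carrier_vec d" and y: "y \<in> carrier_vec d"
  shows "(A *\<^sub>v x) \<bullet>c y = x \<bullet>c (A *\<^sub>v y)"
proof -
  have h: "A $$ (i, j) = cnj (A $$ (j, i))" if "i < d" "j < d" for i j
    using A that unfolding hermitian_mat_def by blast
  have Ac: "A \<in> carrier_mat d d" using A by (simp add: hermitian_mat_def)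
  have "(A *\<^sub>v x) \<bullet>c y = (\<Sum>i<d. \<Sum>j<d. A $$ (i, j) * x $ j * cnj (y $ i))"
    using x y Ac by (simp add: cinner_sum[of _ d] mult_mat_vec_sum[of _ d d] sum_distrib_right del: index_mult_mat_vec)
  also have "\<dots> = (\<Sum>j<d. \<Sum>i<d. A $$ (i, j) * x $ j * cnj (y $ i))"
    by (rule sum.swap)
  also have "\<dots> = (\<Sum>j<d. \<Sum>i<d. x $ j * cnj (A $$ (j, i) * y $ i))"
  proof (intro sum.cong refl)
    fix i j assume "i \<in> {..<d}" "j \<in> {..<d}"
    then have "A $$ (i, j) = cnj (A $$ (j, i))" by (intro h) auto
    then show "A $$ (i, j) * x $ j * cnj (y $ i) = x $ j * cnj (A $$ (j, i) * y $ i)" by simp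
  qed
  also have "\<dots> = x \<bullet>c (A *\<^sub>v y)"
    using x y Ac mult_mat_vec_carrier[OF Ac y]
    by (simp add: cinner_sum[of _ d] mult_mat_vec_sum[of _ d d] sum_distrib_left del: index_mult_mat_vec)
  finally show ?thesis .
qed

text \<open>
  An orthonormal eigenbasis with its eigenvalues, paired by index. It carries the same information as
  the equation \<open>A = outer_sum d c v\<close>, but is the convenient form for computing with vectors.
\<close>

definition eigsys :: "nat \<Rightarrow> complex mat \<Rightarrow> complex vec list \<Rightarrow> real list \<Rightarrow> bool" where
  "eigsys d A v c \<longleftrightarrow> A \<in> carrier_mat d d \<and> orthonormal d v \<and> length v = d \<and> length c = d \<and>
     (\<forall>k<d. A *\<^sub>v v ! k = complex_of_real (c ! k) \<cdot>\<^sub>v v ! k)"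

lemma outer_sum_index:
  assumes "orthonormal d v" "length v = d" "i < d" "j < d"
  shows "outer_sum d c v $$ (i, j) = (\<Sum>k<d. complex_of_real (c ! k) * (v ! k $ i * cnj (v ! k $ j)))"
proof -
  have "dim_vec (v ! k) = d" if "k < d" for k
    using that assms orthonormal_carrier[OF assms(1), of k] by auto
  then show ?thesis using assms by (simp add: outer_sum_def outer_def)
qed

lemma eigsys_outer_sum:
  assumes v: "orthonormal d v" "length v = d" and c: "length c = d"
  shows "eigsys d (outer_sum d c v) v c"
proof -
  have S: "outer_sum d c v \<in> carrier_mat d d" by (simp add: outer_sum_def)
  have "outer_sum d c v *\<^sub>v v ! k = complex_of_real (c ! k) \<cdot>\<^sub>v v ! k" if k: "k < d" for k
  proof (rule eq_vecI)
    have vk: "v ! k \<in> carrier_vec d" using k v orthonormal_carrier by auto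
    fix i assume "i < dim_vec (complex_of_real (c ! k) \<cdot>\<^sub>v v ! k)"
    then have i: "i < d" using vk by simp
    have "(outer_sum d c v *\<^sub>v v ! k) $ i =
        (\<Sum>j<d. \<Sum>l<d. complex_of_real (c ! l) * (v ! l $ i * cnj (v ! l $ j)) * v ! k $ j)"
      using i v vk by (subst mult_mat_vec_sum[OF S vk i]) (simp add: outer_sum_index sum_distrib_right)
    also have "\<dots> = (\<Sum>l<d. \<Sum>j<d. complex_of_real (c ! l) * (v ! l $ i * cnj (v ! l $ j)) * v ! k $ j)"
      by (rule sum.swap)
    also have "\<dots> = (\<Sum>l<d. complex_of_real (c ! l) * v ! l $ i * (v ! k \<bullet>c v ! l))"
      using v orthonormal_carrier[OF v(1)]
      by (intro sum.cong refl) (simp add: cinner_sum[of _ d] sum_distrib_left algebra_simps)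
    also have "\<dots> = (\<Sum>l<d. if l = k then complex_of_real (c ! k) * v ! k $ i else 0)"
      using v k by (intro sum.cong refl) (auto simp: orthonormal_def)
    also have "\<dots> = complex_of_real (c ! k) * v ! k $ i"
      using k by simp
    finally show "(outer_sum d c v *\<^sub>v v ! k) $ i = (complex_of_real (c ! k) \<cdot>\<^sub>v v ! k) $ i"
      using i vk by simp
  next
    have "v ! k \<in> carrier_vec d" using k v orthonormal_carrier by auto
    then show "dim_vec (outer_sum d c v *\<^sub>v v ! k) = dim_vec (complex_of_real (c ! k) \<cdot>\<^sub>v v ! k)"
      using S by simp
  qed
  then show ?thesis using assms S by (simp add: eigsys_def)
qed

lemma mat_eq_on_orthonormal_basis:
  assumes A: "A \<in> carrier_mat d d" and B: "B \<in> carrier_mat d d"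
    and v: "orthonormal d v" "length v = d"
    and eq: "\<And>k. k < d \<Longrightarrow> A *\<^sub>v v ! k = B *\<^sub>v v ! k"
  shows "A = B"
proof (rule eq_matI)
  fix i j assume "i < dim_row B" "j < dim_col B"
  then have ij: "i < d" "j < d" using B by auto
  have *: "C $$ (i, j) = (\<Sum>k<d. (C *\<^sub>v v ! k) $ i * cnj (v ! k $ j))" if C: "C \<in> carrier_mat d d" for C
  proof -
    have "(\<Sum>k<d. (C *\<^sub>v v ! k) $ i * cnj (v ! k $ j)) =
        (\<Sum>k<d. \<Sum>l<d. C $$ (i, l) * (v ! k $ l * cnj (v ! k $ j)))"
      using ij C v orthonormal_carrier[OF v(1)]
      by (intro sum.cong refl)
         (simp add: mult_mat_vec_sum[of _ d d] sum_distrib_right mult.assoc del: index_mult_mat_vec)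
    also have "\<dots> = (\<Sum>l<d. \<Sum>k<d. C $$ (i, l) * (v ! k $ l * cnj (v ! k $ j)))"
      by (rule sum.swap)
    also have "\<dots> = (\<Sum>l<d. C $$ (i, l) * (if l = j then 1 else 0))"
      using ij by (intro sum.cong refl)
        (simp add: sum_distrib_left[symmetric] orthonormal_basis_complete[OF v])
    also have "\<dots> = C $$ (i, j)"
      using ij by (simp add: if_distrib[of "\<lambda>z. _ * z"] sum.delta cong: if_cong)
    finally show ?thesis by simp
  qed
  show "A $$ (i, j) = B $$ (i, j)"
    using *[OF A] *[OF B] eq by simp
qed (use A B in auto)

lemma eigsys_eq_outer_sum:
  assumes "eigsys d A v c"
  shows "A = outer_sum d c v"
proof (rule mat_eq_on_orthonormal_basis[of _ d _ v])
  fix k assume "k < d"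
  then show "A *\<^sub>v v ! k = outer_sum d c v *\<^sub>v v ! k"
    using assms eigsys_outer_sum[of d v c] by (simp add: eigsys_def)
qed (use assms in \<open>auto simp: eigsys_def outer_sum_def\<close>)

lemma eigsys_index:
  assumes "eigsys d A v c" "i < d" "j < d"
  shows "A $$ (i, j) = (\<Sum>k<d. complex_of_real (c ! k) * (v ! k $ i * cnj (v ! k $ j)))"
  using assms outer_sum_index[of d v i j c] eigsys_eq_outer_sum[OF assms(1)]
  by (simp add: eigsys_def)

lemma eigsys_hermitian:
  assumes "eigsys d A v c"
  shows "hermitian_mat d A"
  using assms eigsys_index[OF assms]
  by (auto simp: hermitian_mat_def eigsys_def mult.commute intro!: sum.cong)

lemma eigsys_trace:
  assumes "eigsys d A v c"
  shows "mat_trace A = complex_of_real (sum_list c)"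
proof -
  have v: "orthonormal d v" "length v = d" "length c = d" "dim_row A = d"
    using assms by (auto simp: eigsys_def)
  have "mat_trace A = (\<Sum>i<d. \<Sum>k<d. complex_of_real (c ! k) * (v ! k $ i * cnj (v ! k $ i)))"
    using v eigsys_index[OF assms] by (simp add: mat_trace_def)
  also have "\<dots> = (\<Sum>k<d. \<Sum>i<d. complex_of_real (c ! k) * (v ! k $ i * cnj (v ! k $ i)))"
    by (rule sum.swap)
  also have "\<dots> = (\<Sum>k<d. complex_of_real (c ! k) * (v ! k \<bullet>c v ! k))"
    using v orthonormal_carrier[OF v(1)]
    by (intro sum.cong refl) (simp add: cinner_sum[of _ d] sum_distrib_left)
  also have "\<dots> = (\<Sum>k<d. complex_of_real (c ! k))"
    using v by (intro sum.cong refl) (auto simp: orthonormal_def)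
  also have "\<dots> = complex_of_real (sum_list c)"
    using v by (simp add: sum_list_sum_nth atLeast0LessThan)
  finally show ?thesis .
qed

text \<open>
  The eigenbasis makes \<open>A\<close> unitarily similar to the diagonal matrix of \<open>c\<close>, so the characteristic roots
  are the entries of \<open>c\<close> with multiplicity.
\<close>

lemma eigsys_eigenvalues:
  assumes "eigsys d A v c"
  shows "eigenvalues_decr A = decr c"
proof -
  have v: "orthonormal d v" "length v = d" "length c = d" "A \<in> carrier_mat d d"
    using assms by (auto simp: eigsys_def)
  define V where "V = mat d d (\<lambda>(i, k). v ! k $ i)"
  define W where "W = mat d d (\<lambda>(k, i). cnj (v ! k $ i))"
  define D where "D = mat d d (\<lambda>(i, j). if i = j then complex_of_real (c ! i) else 0)"
  have VW: "V \<in> carrier_mat d d" "W \<in> carrier_mat d d" "D \<in> carrier_mat d d"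
    by (auto simp: V_def W_def D_def)
  have 1: "V * W = 1\<^sub>m d"
    using orthonormal_basis_complete[OF v(1,2)]
    by (intro eq_matI) (auto simp: V_def W_def scalar_prod_def atLeast0LessThan)
  have 2: "W * V = 1\<^sub>m d" using mat_mult_left_right_inverse[OF VW(1,2) 1] .
  have 3: "A = V * D * W"
  proof (rule eq_matI)
    fix i j assume "i < dim_row (V * D * W)" "j < dim_col (V * D * W)"
    then have ij: "i < d" "j < d" by (auto simp: V_def W_def)
    have vd: "(V * D) $$ (i, k) = v ! k $ i * complex_of_real (c ! k)" if "k < d" for k
      using that ij by (simp add: V_def D_def scalar_prod_def atLeast0LessThan
          if_distrib[of "\<lambda>z. _ * z"] sum.delta cong: if_cong)
    have "(V * D * W) $$ (i, j) = (\<Sum>k<d. (V * D) $$ (i, k) * W $$ (k, j))"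
      by (rule mult_mat_sum[OF mult_carrier_mat[OF VW(1,3)] VW(2) ij])
    also have "\<dots> = (\<Sum>k<d. complex_of_real (c ! k) * (v ! k $ i * cnj (v ! k $ j)))"
      using ij by (intro sum.cong refl) (simp only: vd lessThan_iff, simp add: W_def)
    also have "\<dots> = A $$ (i, j)"
      using eigsys_index[OF assms ij] by simp
    finally show "A $$ (i, j) = (V * D * W) $$ (i, j)" by simp
  qed (use v VW in auto)
  have "similar_mat A D"
    unfolding similar_mat_def similar_mat_wit_def Let_def
    using 1 2 3 v VW by (intro exI[of _ V] exI[of _ W]) auto
  then have "char_poly A = char_poly D" by (rule char_poly_similar)
  also have "\<dots> = (\<Prod>a\<leftarrow>diag_mat D. [:- a, 1:])"
    by (rule char_poly_upper_triangular[OF VW(3)]) (auto simp: upper_triangular_def D_def)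
  also have "diag_mat D = map complex_of_real c"
    using v by (intro nth_equalityI) (auto simp: diag_mat_def D_def)
  finally have cp: "char_poly A = prod_list (map (\<lambda>x. [:- complex_of_real x, 1:]) c)"
    by (simp add: o_def)
  define g where "g = (\<lambda>x. [:- complex_of_real x, 1:])"
  have "0 \<notin> set (map g c)" by (auto simp: g_def)
  then have "proots (prod_list (map g c)) = sum_list (map proots (map g c))"
    using proots_prod_list[of "map g c"] by simp
  also have "map proots (map g c) = map (\<lambda>x. {#complex_of_real x#}) c"
    by (simp add: g_def)
  also have "sum_list (map (\<lambda>x. {#complex_of_real x#}) c) = image_mset complex_of_real (mset c)"
    by (induction c) auto
  finally have "proots (char_poly A) = image_mset complex_of_real (mset c)"
    unfolding cp g_def .
  then have "image_mset Re (proots (char_poly A)) = image_mset Re (image_mset complex_of_real (mset c))"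
    by (rule arg_cong)
  also have "\<dots> = mset c"
    by (simp add: multiset.map_comp o_def)
  finally have "image_mset Re (proots (char_poly A)) = mset c" .
  then show ?thesis
    by (simp add: eigenvalues_decr_def decr_def)
qed

lemma eigsys_cinner:
  assumes A: "eigsys d A v c" and x: "x \<in> carrier_vec d" and k: "k < d"
  shows "(A *\<^sub>v x) \<bullet>c v ! k = complex_of_real (c ! k) * (x \<bullet>c v ! k)"
proof -
  have vk: "v ! k \<in> carrier_vec d" using A k orthonormal_carrier by (auto simp: eigsys_def)
  have "(A *\<^sub>v x) \<bullet>c v ! k = x \<bullet>c (A *\<^sub>v v ! k)"
    by (rule hermitian_cinner[OF eigsys_hermitian[OF A] x vk])
  also have "\<dots> = complex_of_real (c ! k) * (x \<bullet>c v ! k)"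
    using A k x vk by (simp add: eigsys_def cinner_smult_right[of _ d])
  finally show ?thesis .
qed

lemma eigsys_quadratic:
  assumes A: "eigsys d A v c" and x: "x \<in> carrier_vec d"
  shows "(A *\<^sub>v x) \<bullet>c x = complex_of_real (\<Sum>k<d. c ! k * (cmod (x \<bullet>c v ! k))\<^sup>2)"
proof -
  have v: "orthonormal d v" "length v = d" "A \<in> carrier_mat d d"
    using A by (auto simp: eigsys_def)
  have "(A *\<^sub>v x) \<bullet>c x = (\<Sum>k<d. complex_of_real (c ! k) * (x \<bullet>c v ! k) * cnj (x \<bullet>c v ! k))"
  proof -
    have "(A *\<^sub>v x) \<bullet>c x = (\<Sum>k<d. ((A *\<^sub>v x) \<bullet>c v ! k) * cnj (x \<bullet>c v ! k))"
      by (rule parseval[OF v(1,2) mult_mat_vec_carrier[OF v(3) x] x])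
    also have "\<dots> = (\<Sum>k<d. complex_of_real (c ! k) * (x \<bullet>c v ! k) * cnj (x \<bullet>c v ! k))"
      by (intro sum.cong refl) (simp only: eigsys_cinner[OF A x] lessThan_iff)
    finally show ?thesis .
  qed
  also have "\<dots> = complex_of_real (\<Sum>k<d. c ! k * (cmod (x \<bullet>c v ! k))\<^sup>2)"
    by (simp only: mult.assoc mult_cnj_cmod of_real_mult of_real_sum)
  finally show ?thesis .
qed

lemma orthonormal_unit_sum:
  assumes v: "orthonormal d v" "length v = d" and x: "x \<in> carrier_vec d" "x \<bullet>c x = 1"
  shows "(\<Sum>k<d. (cmod (x \<bullet>c v ! k))\<^sup>2) = 1"
proof -
  have "x \<bullet>c x = complex_of_real (\<Sum>k<d. (cmod (x \<bullet>c v ! k))\<^sup>2)"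
    using parseval[OF v x(1) x(1)] by (simp only: mult_cnj_cmod of_real_sum)
  then show ?thesis using x by (metis of_real_eq_1_iff)
qed

lemma eigsys_eigenvectorI:
  assumes A: "eigsys d A v c" and x: "x \<in> carrier_vec d"
    and eq: "\<And>k. k < d \<Longrightarrow> x \<bullet>c v ! k \<noteq> 0 \<Longrightarrow> c ! k = a"
  shows "A *\<^sub>v x = complex_of_real a \<cdot>\<^sub>v x"
proof (rule orthonormal_basis_eqI[of d v])
  fix k assume k: "k < d"
  have vk: "v ! k \<in> carrier_vec d" using A k orthonormal_carrier by (auto simp: eigsys_def)
  show "(A *\<^sub>v x) \<bullet>c v ! k = (complex_of_real a \<cdot>\<^sub>v x) \<bullet>c v ! k"
    using eigsys_cinner[OF A x k] eq[OF k] x vk by (cases "x \<bullet>c v ! k = 0") (auto simp: cinner_smult_left[of _ d])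
qed (use A x in \<open>auto simp: eigsys_def\<close>)

text \<open>
  On unit vectors the quadratic form is an average of those eigenvalues whose eigenvectors \<open>x\<close> is not
  orthogonal to. An average meets an upper bound of its terms only if every term of positive weight
  equals the bound, and then \<open>x\<close> is an eigenvector; this rigidity drives the equality case of
  Lidskii's inequality.
\<close>

lemma eigsys_quadratic_le:
  assumes A: "eigsys d A v c" and x: "x \<in> carrier_vec d" "x \<bullet>c x = 1"
    and le: "\<And>k. k < d \<Longrightarrow> x \<bullet>c v ! k \<noteq> 0 \<Longrightarrow> c ! k \<le> a"
  shows "Re ((A *\<^sub>v x) \<bullet>c x) \<le> a"
    and "Re ((A *\<^sub>v x) \<bullet>c x) = a \<Longrightarrow> A *\<^sub>v x = complex_of_real a \<cdot>\<^sub>v x"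
proof -
  have v: "orthonormal d v" "length v = d" using A by (auto simp: eigsys_def)
  have eq: "a - Re ((A *\<^sub>v x) \<bullet>c x) = (\<Sum>k<d. (a - c ! k) * (cmod (x \<bullet>c v ! k))\<^sup>2)"
    using orthonormal_unit_sum[OF v x]
    by (simp add: eigsys_quadratic[OF A x(1)] left_diff_distrib sum_subtractf sum_distrib_left[symmetric])
  have nn: "0 \<le> (a - c ! k) * (cmod (x \<bullet>c v ! k))\<^sup>2" if "k < d" for k
    using le[OF that] by (cases "x \<bullet>c v ! k = 0") auto
  then have "0 \<le> (\<Sum>k<d. (a - c ! k) * (cmod (x \<bullet>c v ! k))\<^sup>2)" by (intro sum_nonneg) auto
  then show "Re ((A *\<^sub>v x) \<bullet>c x) \<le> a" using eq by simp
  assume "Re ((A *\<^sub>v x) \<bullet>c x) = a"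
  then have "(\<Sum>k<d. (a - c ! k) * (cmod (x \<bullet>c v ! k))\<^sup>2) = 0" using eq by simp
  then have "(a - c ! k) * (cmod (x \<bullet>c v ! k))\<^sup>2 = 0" if "k < d" for k
    using nn that by (subst (asm) sum_nonneg_eq_0_iff) auto
  then show "A *\<^sub>v x = complex_of_real a \<cdot>\<^sub>v x"
    by (intro eigsys_eigenvectorI[OF A x(1)]) fastforce
qed

lemma eigsys_add:
  assumes A: "eigsys d A v a" and B: "eigsys d B v b"
  shows "eigsys d (A + B) v (map2 (+) a b)"
proof -
  have c: "A \<in> carrier_mat d d" "B \<in> carrier_mat d d" and v: "orthonormal d v" "length v = d"
    and l: "length a = d" "length b = d"
    using A B by (auto simp: eigsys_def)
  have "(A + B) *\<^sub>v v ! k = complex_of_real (map2 (+) a b ! k) \<cdot>\<^sub>v v ! k" if k: "k < d" for k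
  proof -
    have vk: "v ! k \<in> carrier_vec d" using orthonormal_carrier[OF v(1)] v k by simp
    have "(A + B) *\<^sub>v v ! k = complex_of_real (a ! k) \<cdot>\<^sub>v v ! k + complex_of_real (b ! k) \<cdot>\<^sub>v v ! k"
      using A B k by (simp add: add_mult_distrib_mat_vec[OF c vk] eigsys_def)
    then show ?thesis using k l by (simp add: add_smult_distrib_vec)
  qed
  then show ?thesis using c v l by (simp add: eigsys_def)
qed

lemma eigsys_commute:
  assumes A: "eigsys d A v a" and B: "eigsys d B v b"
  shows "A * B = B * A"
proof -
  have c: "A \<in> carrier_mat d d" "B \<in> carrier_mat d d" and v: "orthonormal d v" "length v = d"
    using A B by (auto simp: eigsys_def)
  show ?thesis
  proof (rule mat_eq_on_orthonormal_basis[OF _ _ v])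
    fix k assume k: "k < d"
    have vk: "v ! k \<in> carrier_vec d" using orthonormal_carrier[OF v(1)] v k by simp
    have "(A * B) *\<^sub>v v ! k = A *\<^sub>v (complex_of_real (b ! k) \<cdot>\<^sub>v v ! k)"
      using assoc_mult_mat_vec[OF c vk] B k by (simp add: eigsys_def)
    also have "\<dots> = complex_of_real (b ! k) \<cdot>\<^sub>v (complex_of_real (a ! k) \<cdot>\<^sub>v v ! k)"
      using mult_mat_vec[OF c(1) vk] A k by (simp add: eigsys_def)
    also have "\<dots> = complex_of_real (a ! k) \<cdot>\<^sub>v (complex_of_real (b ! k) \<cdot>\<^sub>v v ! k)"
      by (simp add: smult_smult_assoc mult.commute)
    also have "\<dots> = B *\<^sub>v (complex_of_real (a ! k) \<cdot>\<^sub>v v ! k)"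
      using mult_mat_vec[OF c(2) vk] B k by (simp add: eigsys_def)
    also have "\<dots> = (B * A) *\<^sub>v v ! k"
      using assoc_mult_mat_vec[OF c(2,1) vk] A k by (simp add: eigsys_def)
    finally show "(A * B) *\<^sub>v v ! k = (B * A) *\<^sub>v v ! k" .
  qed (use c in auto)
qed

lemma eigsys_uminus:
  assumes A: "eigsys d A v c"
  shows "eigsys d (- A) v (map uminus c)"
  using assms orthonormal_carrier[of d v]
  by (auto simp: eigsys_def uminus_mult_mat_vec intro!: eq_vecI)

lemma eigsys_quadratic_ge:
  assumes A: "eigsys d A v c" and x: "x \<in> carrier_vec d" "x \<bullet>c x = 1"
    and le: "\<And>k. k < d \<Longrightarrow> x \<bullet>c v ! k \<noteq> 0 \<Longrightarrow> a \<le> c ! k"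
  shows "a \<le> Re ((A *\<^sub>v x) \<bullet>c x)"
proof -
  have d: "length c = d" "A \<in> carrier_mat d d" using A by (auto simp: eigsys_def)
  have "Re ((- A *\<^sub>v x) \<bullet>c x) \<le> - a"
    using le d by (intro eigsys_quadratic_le(1)[OF eigsys_uminus[OF A] x]) auto
  moreover have "(- A *\<^sub>v x) \<bullet>c x = - ((A *\<^sub>v x) \<bullet>c x)"
    using d x by (auto simp: uminus_mult_mat_vec cinner_sum[of _ d] sum_negf[symmetric] simp del: index_mult_mat_vec intro!: sum.cong)
  ultimately show ?thesis by simp
qed

lemma eigsys_permute:
  assumes A: "eigsys d A v c" and c': "mset c' = mset c"
  obtains v' where "eigsys d A v' c'"
proof -
  have v: "orthonormal d v" "length v = d" "length c = d" using A by (auto simp: eigsys_def)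
  obtain p where p: "p permutes {..<length c}" "permute_list p c = c'"
    using mset_eq_permutation[OF c'] by blast
  then have p': "p permutes {..<d}" "p permutes {..<length v}" using v by auto
  have pk: "p k < d" if "k < d" for k
    using p' that by (metis lessThan_iff permutes_in_image)
  have inj: "p i = p j \<longleftrightarrow> i = j" for i j
    using p' by (meson permutes_inj injD)
  have "eigsys d A (permute_list p v) c'"
    using A pk p p' inj v
    by (auto simp: eigsys_def permute_list_nth orthonormal_def)
  then show ?thesis by (rule that)
qed


section \<open>The spectral theorem by deflation\<close>

text \<open>
  For orthonormal \<open>ws\<close> this is the isometric embedding \<open>W\<close> of coordinate space onto the span of \<open>ws\<close>,
  and the compression defined next is \<open>W\<^sup>* A W\<close>.
\<close>

definition synthesis :: "nat \<Rightarrow> complex vec list \<Rightarrow> complex vec \<Rightarrow> complex vec" where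
  "synthesis n ws y = vec n (\<lambda>i. \<Sum>k<length ws. y $ k * ws ! k $ i)"

definition compress :: "complex vec list \<Rightarrow> complex mat \<Rightarrow> complex mat" where
  "compress ws A = mat (length ws) (length ws) (\<lambda>(j, k). (A *\<^sub>v ws ! k) \<bullet>c ws ! j)"

lemma synthesis_carrier [simp]: "synthesis n ws y \<in> carrier_vec n"
  by (simp add: synthesis_def)

lemma synthesis_cinner:
  assumes ws: "set ws \<subseteq> carrier_vec n" and z: "z \<in> carrier_vec n"
  shows "synthesis n ws y \<bullet>c z = (\<Sum>k<length ws. y $ k * (ws ! k \<bullet>c z))"
proof -
  have "synthesis n ws y \<bullet>c z = (\<Sum>i<n. \<Sum>k<length ws. y $ k * (ws ! k $ i * cnj (z $ i)))"
    using z by (simp add: cinner_sum[of _ n] synthesis_def sum_distrib_right mult.assoc)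
  also have "\<dots> = (\<Sum>k<length ws. \<Sum>i<n. y $ k * (ws ! k $ i * cnj (z $ i)))"
    by (rule sum.swap)
  also have "\<dots> = (\<Sum>k<length ws. y $ k * (ws ! k \<bullet>c z))"
    using z by (simp add: cinner_sum[of _ n] sum_distrib_left)
  finally show ?thesis .
qed

lemma compress_hermitian:
  assumes A: "hermitian_mat n A" and ws: "set ws \<subseteq> carrier_vec n"
  shows "hermitian_mat (length ws) (compress ws A)"
proof -
  have Ac: "A \<in> carrier_mat n n" using A by (simp add: hermitian_mat_def)
  have H: "(A *\<^sub>v ws ! j) \<bullet>c ws ! i = cnj ((A *\<^sub>v ws ! i) \<bullet>c ws ! j)" if "i < length ws" "j < length ws" for i j
  proof -
    have c: "ws ! i \<in> carrier_vec n" "ws ! j \<in> carrier_vec n" using ws that by auto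
    have "(A *\<^sub>v ws ! j) \<bullet>c ws ! i = ws ! j \<bullet>c (A *\<^sub>v ws ! i)"
      by (rule hermitian_cinner[OF A c(2,1)])
    also have "\<dots> = cnj ((A *\<^sub>v ws ! i) \<bullet>c ws ! j)"
      by (rule cinner_commute[OF c(2) mult_mat_vec_carrier[OF Ac c(1)]])
    finally show ?thesis .
  qed
  show ?thesis by (auto simp: hermitian_mat_def compress_def intro: H)
qed

lemma compress_add:
  assumes A: "A \<in> carrier_mat n n" and B: "B \<in> carrier_mat n n" and ws: "set ws \<subseteq> carrier_vec n"
  shows "compress ws (A + B) = compress ws A + compress ws B"
proof (rule eq_matI)
  fix j k assume "j < dim_row (compress ws A + compress ws B)" "k < dim_col (compress ws A + compress ws B)"
  then have jk: "j < length ws" "k < length ws" by (auto simp: compress_def)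
  then have c: "ws ! j \<in> carrier_vec n" "ws ! k \<in> carrier_vec n" using ws by auto
  have "((A + B) *\<^sub>v ws ! k) \<bullet>c ws ! j = (A *\<^sub>v ws ! k) \<bullet>c ws ! j + (B *\<^sub>v ws ! k) \<bullet>c ws ! j"
    using c by (simp only: add_mult_distrib_mat_vec[OF A B c(2)]
        cinner_add_left[OF mult_mat_vec_carrier[OF A c(2)] mult_mat_vec_carrier[OF B c(2)] c(1)])
  then show "compress ws (A + B) $$ (j, k) = (compress ws A + compress ws B) $$ (j, k)"
    using jk by (simp add: compress_def)
qed (auto simp: compress_def)

text \<open>
  The orthogonal complement of an eigenvector of a Hermitian matrix is invariant, so \<open>W\<close> carries
  eigenvectors of the compression to eigenvectors of \<open>A\<close>.
\<close>

lemma eigsys_deflate: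
  assumes A: "hermitian_mat (Suc d) A" and xws: "orthonormal (Suc d) (x # ws)" and len: "length ws = d"
    and Ax: "A *\<^sub>v x = complex_of_real a \<cdot>\<^sub>v x" and v: "eigsys d (compress ws A) v c"
  shows "eigsys (Suc d) A (x # map (synthesis (Suc d) ws) v) (a # c)"
proof -
  let ?n = "Suc d" and ?J = "synthesis (Suc d) ws"
  have Ac: "A \<in> carrier_mat ?n ?n" using A by (simp add: hermitian_mat_def)
  have x: "x \<in> carrier_vec ?n" "x \<bullet>c x = 1" and wx: "\<And>w. w \<in> set ws \<Longrightarrow> w \<bullet>c x = 0"
    and ws: "orthonormal ?n ws"
    using xws by (auto simp: orthonormal_Cons)
  have wsc: "set ws \<subseteq> carrier_vec ?n" using ws by (simp add: orthonormal_def)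
  have wc: "ws ! l \<in> carrier_vec ?n" if "l < d" for l using wsc that len by auto
  have vo: "orthonormal d v" "length v = d" "length c = d"
    and ev: "\<And>k. k < d \<Longrightarrow> compress ws A *\<^sub>v v ! k = complex_of_real (c ! k) \<cdot>\<^sub>v v ! k"
    using v by (auto simp: eigsys_def)
  have vc: "v ! k \<in> carrier_vec d" if "k < d" for k using orthonormal_carrier[OF vo(1)] vo that by simp
  have Jl: "?J y \<bullet>c ws ! l = y $ l" if l: "l < d" for y l
  proof -
    have "?J y \<bullet>c ws ! l = (\<Sum>k<d. y $ k * (ws ! k \<bullet>c ws ! l))"
      using synthesis_cinner[OF wsc wc[OF l]] len by simp
    also have "\<dots> = (\<Sum>k<d. if k = l then y $ l else 0)"
      using ws l len by (intro sum.cong refl) (auto simp: orthonormal_def)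
    finally show ?thesis using l by simp
  qed
  have Jx: "?J y \<bullet>c x = 0" for y
    using synthesis_cinner[OF wsc x(1)] wx len by simp
  have JJ: "?J y \<bullet>c ?J z = y \<bullet>c z" if y: "y \<in> carrier_vec d" and z: "z \<in> carrier_vec d" for y z
  proof -
    have "?J y \<bullet>c ?J z = (\<Sum>k<d. y $ k * (ws ! k \<bullet>c ?J z))"
      using synthesis_cinner[OF wsc, of "?J z"] len by simp
    also have "\<dots> = (\<Sum>k<d. y $ k * cnj (z $ k))"
    proof (intro sum.cong refl)
      fix k assume "k \<in> {..<d}"
      then show "y $ k * (ws ! k \<bullet>c ?J z) = y $ k * cnj (z $ k)"
        using cinner_commute[OF wc synthesis_carrier, of k ws z] Jl[of k z] by simp
    qed
    finally show ?thesis using z by (simp add: cinner_sum[of _ d])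
  qed
  have AJ: "A *\<^sub>v ?J y = complex_of_real e \<cdot>\<^sub>v ?J y"
    if y: "y \<in> carrier_vec d" and e: "compress ws A *\<^sub>v y = complex_of_real e \<cdot>\<^sub>v y" for y e
  proof (rule orthonormal_basis_eqI[OF xws])
    fix k assume k: "k < ?n"
    have s: "(complex_of_real e \<cdot>\<^sub>v ?J y) \<bullet>c z = complex_of_real e * (?J y \<bullet>c z)" if "z \<in> carrier_vec ?n" for z
      by (rule cinner_smult_left[OF synthesis_carrier that])
    show "(A *\<^sub>v ?J y) \<bullet>c (x # ws) ! k = (complex_of_real e \<cdot>\<^sub>v ?J y) \<bullet>c (x # ws) ! k"
    proof (cases k)
      case 0
      have "(A *\<^sub>v ?J y) \<bullet>c x = ?J y \<bullet>c (A *\<^sub>v x)"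
        by (rule hermitian_cinner[OF A synthesis_carrier x(1)])
      also have "\<dots> = 0" using Jx x by (simp add: Ax cinner_smult_right[of _ ?n])
      finally show ?thesis using 0 s[OF x(1)] Jx by simp
    next
      case (Suc l)
      then have l: "l < d" using k by simp
      have "(A *\<^sub>v ?J y) \<bullet>c ws ! l = ?J y \<bullet>c (A *\<^sub>v ws ! l)"
        by (rule hermitian_cinner[OF A synthesis_carrier wc[OF l]])
      also have "\<dots> = (\<Sum>k<d. y $ k * (ws ! k \<bullet>c (A *\<^sub>v ws ! l)))"
        using synthesis_cinner[OF wsc mult_mat_vec_carrier[OF Ac wc[OF l]]] len by simp
      also have "\<dots> = (\<Sum>k<d. compress ws A $$ (l, k) * y $ k)"
        using l len by (intro sum.cong refl)
          (simp add: compress_def hermitian_cinner[OF A wc wc])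
      also have "\<dots> = (compress ws A *\<^sub>v y) $ l"
        by (rule mult_mat_vec_sum[symmetric, OF _ y l]) (use len in \<open>simp add: compress_def\<close>)
      also have "\<dots> = complex_of_real e * y $ l" using e y l by simp
      finally show ?thesis using Suc s[OF wc[OF l]] Jl[OF l] by simp
    qed
  qed (use len Ac in auto)
  have "orthonormal ?n (map ?J v)"
    using vo JJ vc by (auto simp: orthonormal_def)
  then have "orthonormal ?n (x # map ?J v)"
    using x Jx by (auto simp: orthonormal_Cons)
  moreover have "A *\<^sub>v (x # map ?J v) ! k = complex_of_real ((a # c) ! k) \<cdot>\<^sub>v (x # map ?J v) ! k"
    if "k < ?n" for k
    using that Ax AJ[OF vc ev] vo by (cases k) auto
  ultimately show ?thesis using Ac vo by (simp add: eigsys_def)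
qed

lemma hermitian_eigenvector:
  assumes A: "hermitian_mat (Suc d) A"
  obtains x a where "x \<in> carrier_vec (Suc d)" "x \<bullet>c x = 1" "A *\<^sub>v x = complex_of_real a \<cdot>\<^sub>v x"
proof -
  let ?n = "Suc d"
  have Ac: "A \<in> carrier_mat ?n ?n" using A by (simp add: hermitian_mat_def)
  obtain as where as: "char_poly A = (\<Prod>a\<leftarrow>as. [:- a, 1:])" "length as = ?n"
    using char_poly_factorized[OF Ac] by blast
  then obtain e es where "as = e # es" by (cases as) auto
  then have "poly (char_poly A) e = 0" using as by simp
  then have "eigenvalue A e" using eigenvalue_root_char_poly[OF Ac] by simp
  then obtain y where y: "y \<in> carrier_vec ?n" "y \<noteq> 0\<^sub>v ?n" "A *\<^sub>v y = e \<cdot>\<^sub>v y"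
    using Ac by (auto simp: eigenvalue_def eigenvector_def)
  obtain b where b: "b \<noteq> 0" "(b \<cdot>\<^sub>v y) \<bullet>c (b \<cdot>\<^sub>v y) = 1" using normalized_vector[OF y(1,2)] .
  define x where "x = b \<cdot>\<^sub>v y"
  have x: "x \<in> carrier_vec ?n" "x \<bullet>c x = 1" using y b by (auto simp: x_def)
  have Ax: "A *\<^sub>v x = e \<cdot>\<^sub>v x"
    using y by (simp add: x_def mult_mat_vec[OF Ac] smult_smult_assoc mult.commute)
  have "e = (A *\<^sub>v x) \<bullet>c x" using x by (simp add: Ax cinner_smult_left[of _ ?n])
  also have "\<dots> = x \<bullet>c (A *\<^sub>v x)" by (rule hermitian_cinner[OF A x(1) x(1)])
  also have "\<dots> = cnj e" using x by (simp add: Ax cinner_smult_right[of _ ?n])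
  finally have "e = complex_of_real (Re e)" by (metis Reals_cnj_iff of_real_Re)
  then show ?thesis using that[OF x, of "Re e"] Ax by simp
qed

theorem spectral_theorem:
  "hermitian_mat d A \<Longrightarrow> \<exists>v c. eigsys d A v c"
proof (induction d arbitrary: A)
  case 0
  then show ?case
    by (intro exI[of _ "[]"]) (simp add: eigsys_def orthonormal_Nil hermitian_mat_def)
next
  case (Suc d)
  obtain x a where x: "x \<in> carrier_vec (Suc d)" "x \<bullet>c x = 1" "A *\<^sub>v x = complex_of_real a \<cdot>\<^sub>v x"
    using hermitian_eigenvector[OF Suc.prems] .
  obtain ws where ws: "orthonormal (Suc d) ws" "length ws = d" "\<forall>w\<in>set ws. \<forall>v\<in>set [x]. w \<bullet>c v = 0"
    using orthonormal_in_complement[of "[x]" "Suc d" d] x by auto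
  have xws: "orthonormal (Suc d) (x # ws)" using ws x by (simp add: orthonormal_Cons)
  have "hermitian_mat d (compress ws A)"
    using compress_hermitian[OF Suc.prems, of ws] ws by (simp add: orthonormal_def)
  then obtain v c where "eigsys d (compress ws A) v c" using Suc.IH by blast
  then show ?case using eigsys_deflate[OF Suc.prems xws ws(2) x(3)] by blast
qed

lemma eigsys_eigenvalues_decr:
  assumes "hermitian_mat d M"
  obtains v where "eigsys d M v (eigenvalues_decr M)"
proof -
  obtain v c where v: "eigsys d M v c" using spectral_theorem[OF assms] by blast
  have "eigenvalues_decr M = decr c" by (rule eigsys_eigenvalues[OF v])
  then have "mset (eigenvalues_decr M) = mset c" by (simp add: decr_def)
  then show ?thesis using eigsys_permute[OF v] that by blast
qed

lemma sorted_eigenvalues_decr: "sorted_wrt (\<ge>) (eigenvalues_decr M)"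
  by (simp add: eigenvalues_decr_def sorted_wrt_rev)

lemma sum_eigenvalues_decr:
  assumes "hermitian_mat d M"
  shows "sum_list (eigenvalues_decr M) = Re (mat_trace M)"
proof -
  obtain v where "eigsys d M v (eigenvalues_decr M)" using eigsys_eigenvalues_decr[OF assms] .
  then show ?thesis by (simp add: eigsys_trace)
qed

lemma length_eigenvalues_decr:
  assumes "hermitian_mat d M"
  shows "length (eigenvalues_decr M) = d"
proof -
  obtain v where "eigsys d M v (eigenvalues_decr M)" using eigsys_eigenvalues_decr[OF assms] .
  then show ?thesis by (simp add: eigsys_def)
qed

lemma eigsys_unique:
  assumes "eigsys d A v c" "eigsys d A v' c'"
  shows "mset c = mset c'"
proof -
  have "decr c = decr c'" using assms eigsys_eigenvalues by metis
  then have "mset (decr c) = mset (decr c')" by simp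
  then show ?thesis by (simp add: decr_def)
qed

section \<open>Weyl's inequality\<close>

text \<open>
  The spans of \<open>u\<^sub>i, \<dots>, u\<^sub>d\<^sub>-\<^sub>1\<close> and of \<open>w\<^sub>0, \<dots>, w\<^sub>i\<close> have dimensions adding up to \<open>d + 1\<close>, so they
  meet. In terms of orthogonality this imposes only \<open>i + (d - 1 - i)\<close> conditions.
\<close>

lemma weyl_vector:
  assumes u: "orthonormal d u" "length u = d" and w: "orthonormal d w" "length w = d" and i: "i < d"
  obtains x where "x \<in> carrier_vec d" "x \<bullet>c x = 1"
    "\<And>k. k < i \<Longrightarrow> x \<bullet>c u ! k = 0" "\<And>k. i < k \<Longrightarrow> k < d \<Longrightarrow> x \<bullet>c w ! k = 0"
proof -
  have "set (take i u @ drop (Suc i) w) \<subseteq> carrier_vec d"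
    using u w by (auto simp: orthonormal_def dest: in_set_takeD in_set_dropD)
  moreover have "length (take i u @ drop (Suc i) w) < d" using u w i by simp
  ultimately obtain x where x: "x \<in> carrier_vec d" "x \<bullet>c x = 1"
    "\<And>v. v \<in> set (take i u @ drop (Suc i) w) \<Longrightarrow> x \<bullet>c v = 0"
    using orthogonal_unit_vector by blast
  show ?thesis
  proof (rule that[OF x(1,2)])
    fix k assume "k < i"
    then have "u ! k \<in> set (take i u)" using u i by (auto simp: in_set_conv_nth)
    then show "x \<bullet>c u ! k = 0" using x(3) by simp
  next
    fix k assume k: "i < k" "k < d"
    then have "w ! k = drop (Suc i) w ! (k - Suc i)" "k - Suc i < length (drop (Suc i) w)" using w by auto
    then have "w ! k \<in> set (drop (Suc i) w)" by (metis nth_mem)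
    then show "x \<bullet>c w ! k = 0" using x(3) by simp
  qed
qed

text \<open>
  Test both quadratic forms on a unit vector that lies in the span of the first \<open>i + 1\<close> eigenvectors of
  \<open>X\<close> and in the span of the last \<open>d - i\<close> eigenvectors of \<open>Y\<close>. The number \<open>s\<close> plays the role of adding
  a multiple of the identity to \<open>Y\<close>.
\<close>

lemma weyl_monotone:
  assumes X: "eigsys d X u a" and a: "sorted_wrt (\<ge>) a" and Y: "eigsys d Y w b" and b: "sorted_wrt (\<ge>) b"
    and le: "\<And>x. x \<in> carrier_vec d \<Longrightarrow> x \<bullet>c x = 1 \<Longrightarrow> Re ((X *\<^sub>v x) \<bullet>c x) \<le> Re ((Y *\<^sub>v x) \<bullet>c x) + s"
    and i: "i < d"
  shows "a ! i \<le> b ! i + s"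
proof -
  have u: "orthonormal d u" "length u = d" "length a = d" using X by (auto simp: eigsys_def)
  have w: "orthonormal d w" "length w = d" "length b = d" using Y by (auto simp: eigsys_def)
  obtain x where x: "x \<in> carrier_vec d" "x \<bullet>c x = 1"
    and xw: "\<And>k. k < i \<Longrightarrow> x \<bullet>c w ! k = 0" and xu: "\<And>k. i < k \<Longrightarrow> k < d \<Longrightarrow> x \<bullet>c u ! k = 0"
    using weyl_vector[OF w(1,2) u(1,2) i] by blast
  have mono: "e ! l \<le> e ! k" if "sorted_wrt (\<ge>) e" "k \<le> l" "l < length e" for e :: "real list" and k l
    using sorted_wrt_nth_less[of "(\<ge>)" e k l] that by (cases "k = l") auto
  have "a ! i \<le> Re ((X *\<^sub>v x) \<bullet>c x)"
  proof (rule eigsys_quadratic_ge[OF X x])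
    fix k assume "k < d" "x \<bullet>c u ! k \<noteq> 0"
    then have "k \<le> i" using xu by (meson not_le)
    then show "a ! i \<le> a ! k" using mono[OF a] i u by simp
  qed
  also have "\<dots> \<le> Re ((Y *\<^sub>v x) \<bullet>c x) + s" by (rule le[OF x])
  also have "Re ((Y *\<^sub>v x) \<bullet>c x) \<le> b ! i"
  proof (rule eigsys_quadratic_le(1)[OF Y x])
    fix k assume "k < d" "x \<bullet>c w ! k \<noteq> 0"
    then have "i \<le> k" "k < d" using xw by (meson not_le)+
    then show "b ! k \<le> b ! i" using mono[OF b] w by simp
  qed
  finally show ?thesis by simp
qed


section \<open>Lidskii's inequality and its equality case\<close>

definition excess :: "real \<Rightarrow> real list \<Rightarrow> real" where
  "excess r xs = (\<Sum>x\<leftarrow>xs. max 0 (x - r))"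

lemma sorted_desc_nth_mono:
  fixes e :: "real list"
  assumes "sorted_wrt (\<ge>) e" "k \<le> l" "l < length e"
  shows "e ! l \<le> e ! k"
  using sorted_wrt_nth_less[of "(\<ge>)" e k l] assms by (cases "k = l") auto

lemma sorted_wrt_decr: "sorted_wrt (\<ge>) (decr x)"
  by (simp add: decr_def sorted_wrt_rev)

lemma mset_decr [simp]: "mset (decr x) = mset x"
  by (simp add: decr_def)

lemma length_decr [simp]: "length (decr x) = length x"
  by (simp add: decr_def)

lemma cinner_add_mat:
  fixes A B :: "complex mat"
  assumes A: "A \<in> carrier_mat d d" and B: "B \<in> carrier_mat d d" and x: "x \<in> carrier_vec d"
  shows "((A + B) *\<^sub>v x) \<bullet>c x = (A *\<^sub>v x) \<bullet>c x + (B *\<^sub>v x) \<bullet>c x"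
  by (simp only: add_mult_distrib_mat_vec[OF A B x]
      cinner_add_left[OF mult_mat_vec_carrier[OF A x] mult_mat_vec_carrier[OF B x] x])

lemma mat_trace_add:
  assumes "A \<in> carrier_mat d d" "B \<in> carrier_mat d d"
  shows "mat_trace (A + B) = mat_trace A + mat_trace B"
  using assms by (simp add: mat_trace_def sum.distrib)

lemma hermitian_add:
  assumes A: "hermitian_mat d A" and B: "hermitian_mat d B"
  shows "hermitian_mat d (A + B)"
proof -
  have c: "A \<in> carrier_mat d d" "B \<in> carrier_mat d d" using A B by (auto simp: hermitian_mat_def)
  have "A $$ (i, j) + B $$ (i, j) = cnj (A $$ (j, i)) + cnj (B $$ (j, i))" if "i < d" "j < d" for i j
    using A B that unfolding hermitian_mat_def by metis
  then show ?thesis using c by (auto simp: hermitian_mat_def)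
qed

text \<open>
  Put \<open>C = A + B\<close> and let \<open>P\<close> be the positive part of \<open>C - r\<close>. Since \<open>C - r \<le> P\<close> and \<open>0 \<le> P\<close>, both
  \<open>A - r\<close> and \<open>- B\<close> lie below \<open>P - B\<close>. By Weyl's inequality the \<open>i\<close>-th largest eigenvalue \<open>y\<^sub>i\<close> of
  \<open>P - B\<close> is at least \<open>\<lambda>\<^sub>i - r\<close> and at least \<open>- \<mu>\<^sub>i\<close>, which says that
  \<open>max 0 (\<lambda>\<^sub>i + \<mu>\<^sub>i - r) \<le> y\<^sub>i + \<mu>\<^sub>i\<close>. The right-hand sides sum to the trace of \<open>P\<close>, which is the
  excess of \<open>C\<close>.
\<close>

lemma lidskii:
  assumes A: "eigsys d A u lam" "sorted_wrt (\<ge>) lam"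
    and B: "eigsys d B w \<mu>" "sorted \<mu>"
    and C: "eigsys d (A + B) z \<nu>"
  shows "excess r (map2 (+) lam \<mu>) \<le> excess r \<nu>"
proof -
  have zo: "orthonormal d z" "length z = d" "length \<nu> = d" using C by (auto simp: eigsys_def)
  have len: "length lam = d" "length \<mu> = d" using A B by (auto simp: eigsys_def)
  have Ac: "A \<in> carrier_mat d d" and Bc: "B \<in> carrier_mat d d" using A B by (auto simp: eigsys_def)
  define p where "p = map (\<lambda>x. max 0 (x - r)) \<nu>"
  define P where "P = outer_sum d p z"
  have P: "eigsys d P z p" using eigsys_outer_sum[OF zo(1,2)] zo(3) by (simp add: P_def p_def)
  then have Pc: "P \<in> carrier_mat d d" by (simp add: eigsys_def)
  have nB: "eigsys d (- B) w (map uminus \<mu>)" using eigsys_uminus[OF B(1)] .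
  then have nBc: "- B \<in> carrier_mat d d" by (simp add: eigsys_def)
  have "hermitian_mat d (P + - B)"
    by (rule hermitian_add[OF eigsys_hermitian[OF P] eigsys_hermitian[OF nB]])
  then obtain h where h: "eigsys d (P + - B) h (eigenvalues_decr (P + - B))"
    by (rule eigsys_eigenvalues_decr)
  define y where "y = eigenvalues_decr (P + - B)"
  have H: "eigsys d (P + - B) h y" and y: "sorted_wrt (\<ge>) y"
    using h sorted_eigenvalues_decr by (simp_all add: y_def)
  have ly: "length y = d" using H by (simp add: eigsys_def)
  have quad: "Re (((P + - B) *\<^sub>v x) \<bullet>c x) = Re ((P *\<^sub>v x) \<bullet>c x) + Re ((- B *\<^sub>v x) \<bullet>c x)"
    if "x \<in> carrier_vec d" for x
    using cinner_add_mat[OF Pc nBc that] by simp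
  have quadC: "Re (((A + B) *\<^sub>v x) \<bullet>c x) = Re ((A *\<^sub>v x) \<bullet>c x) - Re ((- B *\<^sub>v x) \<bullet>c x)"
    if x: "x \<in> carrier_vec d" for x
  proof -
    have "Re ((- B *\<^sub>v x) \<bullet>c x) = - Re ((B *\<^sub>v x) \<bullet>c x)"
      unfolding eigsys_quadratic[OF nB x] eigsys_quadratic[OF B(1) x]
      using len by (simp add: sum_negf)
    then show ?thesis using cinner_add_mat[OF Ac Bc x] by simp
  qed
  have up: "lam ! i - r \<le> y ! i" if i: "i < d" for i
  proof -
    have "lam ! i \<le> y ! i + r"
    proof (rule weyl_monotone[OF A H y _ i])
      fix x :: "complex vec" assume x: "x \<in> carrier_vec d" "x \<bullet>c x = 1"
      have "Re (((A + B) *\<^sub>v x) \<bullet>c x) = (\<Sum>k<d. \<nu> ! k * (cmod (x \<bullet>c z ! k))\<^sup>2)"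
        using eigsys_quadratic[OF C x(1)] by simp
      also have "\<dots> \<le> (\<Sum>k<d. p ! k * (cmod (x \<bullet>c z ! k))\<^sup>2 + r * (cmod (x \<bullet>c z ! k))\<^sup>2)"
      proof (intro sum_mono)
        fix k assume "k \<in> {..<d}"
        then have "\<nu> ! k \<le> p ! k + r" using zo by (simp add: p_def)
        then have "\<nu> ! k * (cmod (x \<bullet>c z ! k))\<^sup>2 \<le> (p ! k + r) * (cmod (x \<bullet>c z ! k))\<^sup>2"
          by (intro mult_right_mono) auto
        then show "\<nu> ! k * (cmod (x \<bullet>c z ! k))\<^sup>2 \<le> p ! k * (cmod (x \<bullet>c z ! k))\<^sup>2 + r * (cmod (x \<bullet>c z ! k))\<^sup>2"
          by (simp add: distrib_right)
      qed
      also have "\<dots> = Re ((P *\<^sub>v x) \<bullet>c x) + r"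
        using eigsys_quadratic[OF P x(1)] orthonormal_unit_sum[OF zo(1,2) x]
        by (simp add: sum.distrib sum_distrib_left[symmetric])
      finally show "Re ((A *\<^sub>v x) \<bullet>c x) \<le> Re (((P + - B) *\<^sub>v x) \<bullet>c x) + r"
        using quad[OF x(1)] quadC[OF x(1)] by simp
    qed
    then show ?thesis by simp
  qed
  have low: "- (\<mu> ! i) \<le> y ! i" if i: "i < d" for i
  proof -
    have s: "sorted_wrt (\<ge>) (map uminus \<mu>)" using B(2) by (simp add: sorted_wrt_map)
    have "map uminus \<mu> ! i \<le> y ! i + 0"
    proof (rule weyl_monotone[OF nB s H y _ i])
      fix x :: "complex vec" assume x: "x \<in> carrier_vec d" "x \<bullet>c x = 1"
      have "0 \<le> Re ((P *\<^sub>v x) \<bullet>c x)"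
        unfolding eigsys_quadratic[OF P x(1)] using zo by (auto simp: p_def intro!: sum_nonneg)
      then show "Re ((- B *\<^sub>v x) \<bullet>c x) \<le> Re (((P + - B) *\<^sub>v x) \<bullet>c x) + 0"
        using quad[OF x(1)] by simp
    qed
    then show ?thesis using i len by simp
  qed
  have "complex_of_real (sum_list y) = complex_of_real (sum_list p) + complex_of_real (sum_list (map uminus \<mu>))"
    using mat_trace_add[OF Pc nBc] eigsys_trace[OF H] eigsys_trace[OF P] eigsys_trace[OF nB] by simp
  then have tr: "sum_list y = sum_list p + sum_list (map uminus \<mu>)"
    by (simp only: of_real_add[symmetric] of_real_eq_iff)
  have tr': "(\<Sum>i<d. y ! i + \<mu> ! i) = sum_list p"
    using tr ly len by (simp add: sum_list_sum_nth atLeast0LessThan sum.distrib sum_negf)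
  have "excess r (map2 (+) lam \<mu>) = (\<Sum>i<d. max 0 (lam ! i + \<mu> ! i - r))"
    using len by (simp add: excess_def sum_list_sum_nth atLeast0LessThan)
  also have "\<dots> \<le> (\<Sum>i<d. y ! i + \<mu> ! i)"
    using up low by (intro sum_mono) force
  also have "\<dots> = excess r \<nu>" using tr' by (simp add: p_def excess_def)
  finally show ?thesis .
qed

text \<open>
  Splitting off a common eigenvector removes the same position from both eigenvalue lists, which
  keeps the two orderings and the pairing intact.
\<close>

definition delete_nth :: "nat \<Rightarrow> 'a list \<Rightarrow> 'a list" where
  "delete_nth i xs = take i xs @ drop (Suc i) xs"

lemma mset_delete_nth:
  assumes "i < length xs"
  shows "mset xs = add_mset (xs ! i) (mset (delete_nth i xs))"
proof -
  have "mset xs = mset (take i xs @ xs ! i # drop (Suc i) xs)" using id_take_nth_drop[OF assms] by simp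
  then show ?thesis by (simp add: delete_nth_def)
qed

lemma sorted_wrt_delete_nth:
  assumes "sorted_wrt P xs" shows "sorted_wrt P (delete_nth i xs)"
proof (cases "i < length xs")
  case True
  have "sorted_wrt P (take i xs @ xs ! i # drop (Suc i) xs)" using assms id_take_nth_drop[OF True] by simp
  then show ?thesis by (simp add: delete_nth_def sorted_wrt_append)
next
  case False then show ?thesis using assms by (simp add: delete_nth_def)
qed

lemma map2_delete_nth:
  assumes "length xs = length ys"
  shows "map2 f (delete_nth i xs) (delete_nth i ys) = delete_nth i (map2 f xs ys)"
  using assms by (simp add: delete_nth_def take_map drop_map take_zip drop_zip)

lemma insert_delete_nth:
  assumes "i < length xs"
  shows "take i (delete_nth i xs) @ xs ! i # drop i (delete_nth i xs) = xs"
  using assms id_take_nth_drop[OF assms] by (simp add: delete_nth_def)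

lemma eigsys_insert_at:
  assumes E: "eigsys (Suc d) A (x # v) (a # c)" and i: "i \<le> d"
  shows "eigsys (Suc d) A (take i v @ x # drop i v) (take i c @ a # drop i c)"
proof -
  have o: "orthonormal (Suc d) (x # v)" and len: "length v = d" "length c = d"
    and ev: "\<And>k. k < Suc d \<Longrightarrow> A *\<^sub>v (x # v) ! k = complex_of_real ((a # c) ! k) \<cdot>\<^sub>v (x # v) ! k"
    using E by (auto simp: eigsys_def)
  \<comment> \<open>The position in the list with the eigenvector in front of the k-th entry of the list with it inserted at i.\<close>
  define s where "s k = (if k < i then Suc k else if k = i then 0 else k)" for k
  have s: "s k < Suc d" if "k < Suc d" for k using that i by (auto simp: s_def)
  have sinj: "s k = s l \<longleftrightarrow> k = l" for k l by (auto simp: s_def)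
  have n: "(take i ys @ y # drop i ys) ! k = (y # ys) ! s k" if "k < Suc d" "length ys = d" for k y and ys :: "'b list"
  proof -
    consider "k < i" | "k = i" | "i < k" by linarith
    then show ?thesis
    proof cases
      case 3
      then obtain l where "k = Suc (i + l)" using less_imp_Suc_add by blast
      then show ?thesis using that i by (simp add: nth_append s_def min_def)
    qed (use that i in \<open>auto simp: nth_append s_def min_def\<close>)
  qed
  have "orthonormal (Suc d) (take i v @ x # drop i v)"
    using o n[OF _ len(1)] s sinj len i
    by (auto simp: orthonormal_def nth_append dest: in_set_takeD in_set_dropD simp del: nth_Cons)
  then show ?thesis
    using E ev n[OF _ len(1), of _ x] n[OF _ len(2), of _ a] s len i by (simp add: eigsys_def del: nth_Cons)
qed

text \<open>
  The equality case. Let \<open>\<lambda>\<^sub>i + \<mu>\<^sub>i\<close> be smallest among these sums; by assumption it is the smallest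
  eigenvalue of \<open>A + B\<close>. Weyl's argument supplies a unit vector on which the form of \<open>A\<close> is at most
  \<open>\<lambda>\<^sub>i\<close> and that of \<open>B\<close> at most \<open>\<mu>\<^sub>i\<close>, while the form of the sum is at least \<open>\<lambda>\<^sub>i + \<mu>\<^sub>i\<close>. Both bounds
  are therefore attained, and the vector is a common eigenvector. On its orthogonal complement the
  spectra of \<open>A\<close>, \<open>B\<close> and \<open>A + B\<close> lose \<open>\<lambda>\<^sub>i\<close>, \<open>\<mu>\<^sub>i\<close> and \<open>\<lambda>\<^sub>i + \<mu>\<^sub>i\<close>, so the hypotheses persist.
\<close>

theorem joint_eigenbasis:
  assumes "eigsys d A u lam" "sorted_wrt (\<ge>) lam"
    and "eigsys d B w \<mu>" "sorted \<mu>"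
    and "eigsys d (A + B) z \<nu>" "mset \<nu> = mset (map2 (+) lam \<mu>)"
  shows "\<exists>v. eigsys d A v lam \<and> eigsys d B v \<mu>"
  using assms
proof (induction d arbitrary: A B u w z lam \<mu> \<nu>)
  case 0
  then show ?case by (intro exI[of _ u]) (simp add: eigsys_def orthonormal_Nil)
next
  case (Suc d)
  note A = Suc.prems(1,2) and B = Suc.prems(3,4) and C = Suc.prems(5,6)
  let ?n = "Suc d"
  have len: "length lam = ?n" "length \<mu> = ?n" "length \<nu> = ?n"
    and u: "orthonormal ?n u" "length u = ?n" and w: "orthonormal ?n w" "length w = ?n"
    and Ac: "A \<in> carrier_mat ?n ?n" and Bc: "B \<in> carrier_mat ?n ?n"
    using A(1) B(1) C(1) by (auto simp: eigsys_def)
  \<comment> \<open>The index i realizing the smallest sum is the one whose eigenvector is split off.\<close>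
  define f where "f k = lam ! k + \<mu> ! k" for k
  have "Min (f ` {..<?n}) \<in> f ` {..<?n}" by (intro Min_in) auto
  then obtain i where i: "i < ?n" "Min (f ` {..<?n}) = f i" by auto
  have fi: "f i \<le> f k" if "k < ?n" for k
    using Min_le[of "f ` {..<?n}" "f k"] that i by auto
  have nu: "f i \<le> \<nu> ! k" if "k < ?n" for k
  proof -
    have "\<nu> ! k \<in> set (map2 (+) lam \<mu>)" using that len C(2) by (metis mset_eq_setD nth_mem)
    then obtain l where "l < ?n" "\<nu> ! k = f l" using len by (auto simp: in_set_conv_nth f_def)
    then show ?thesis using fi by simp
  qed
  obtain x where x: "x \<in> carrier_vec ?n" "x \<bullet>c x = 1"
    and xu: "\<And>k. k < i \<Longrightarrow> x \<bullet>c u ! k = 0" and xw: "\<And>k. i < k \<Longrightarrow> k < ?n \<Longrightarrow> x \<bullet>c w ! k = 0"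
    using weyl_vector[OF u w i(1)] by blast
  have leA: "lam ! k \<le> lam ! i" if "k < ?n" "x \<bullet>c u ! k \<noteq> 0" for k
    using that xu[of k] sorted_desc_nth_mono[OF A(2), of i k] len by force
  have leB: "\<mu> ! k \<le> \<mu> ! i" if "k < ?n" "x \<bullet>c w ! k \<noteq> 0" for k
    using that xw[of k] sorted_nth_mono[OF B(2), of k i] len i by force
  have qA: "Re ((A *\<^sub>v x) \<bullet>c x) \<le> lam ! i" by (rule eigsys_quadratic_le(1)[OF A(1) x leA])
  have qB: "Re ((B *\<^sub>v x) \<bullet>c x) \<le> \<mu> ! i" by (rule eigsys_quadratic_le(1)[OF B(1) x leB])
  have "f i \<le> Re (((A + B) *\<^sub>v x) \<bullet>c x)" by (rule eigsys_quadratic_ge[OF C(1) x nu])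
  then have qC: "f i \<le> Re ((A *\<^sub>v x) \<bullet>c x) + Re ((B *\<^sub>v x) \<bullet>c x)"
    using cinner_add_mat[OF Ac Bc x(1)] by simp
  have Ax: "A *\<^sub>v x = complex_of_real (lam ! i) \<cdot>\<^sub>v x"
    by (rule eigsys_quadratic_le(2)[OF A(1) x leA]) (use qA qB qC in \<open>auto simp: f_def\<close>)
  have Bx: "B *\<^sub>v x = complex_of_real (\<mu> ! i) \<cdot>\<^sub>v x"
    by (rule eigsys_quadratic_le(2)[OF B(1) x leB]) (use qA qB qC in \<open>auto simp: f_def\<close>)
  have Cx: "(A + B) *\<^sub>v x = complex_of_real (f i) \<cdot>\<^sub>v x"
    using x Ax Bx by (simp add: add_mult_distrib_mat_vec[OF Ac Bc x(1)] f_def add_smult_distrib_vec)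
  obtain ws where ws: "orthonormal ?n ws" "length ws = d" "\<forall>w\<in>set ws. \<forall>v\<in>set [x]. w \<bullet>c v = 0"
    using orthonormal_in_complement[of "[x]" ?n d] x by auto
  have xws: "orthonormal ?n (x # ws)" using ws x by (simp add: orthonormal_Cons)
  have wsc: "set ws \<subseteq> carrier_vec ?n" using ws by (simp add: orthonormal_def)
  have deflated: "\<exists>v. eigsys d (compress ws M) v (delete_nth i c)"
    if M: "eigsys ?n M v0 c0" and c: "mset c0 = mset c" "length c = ?n"
      and Mx: "M *\<^sub>v x = complex_of_real (c ! i) \<cdot>\<^sub>v x" for M v0 c0 c
  proof -
    have Mh: "hermitian_mat ?n M" using eigsys_hermitian[OF M] .
    have "hermitian_mat d (compress ws M)" using compress_hermitian[OF Mh wsc] ws by simp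
    then obtain v' c' where v': "eigsys d (compress ws M) v' c'" using spectral_theorem by blast
    have "mset (c ! i # c') = mset c"
      using eigsys_unique[OF eigsys_deflate[OF Mh xws ws(2) Mx v'] M] c by simp
    then have "mset (delete_nth i c) = mset c'" using mset_delete_nth[of i c] i c by simp
    then show ?thesis using eigsys_permute[OF v'] by metis
  qed
  obtain uA where uA: "eigsys d (compress ws A) uA (delete_nth i lam)"
    using deflated[OF A(1) refl len(1) Ax] by blast
  obtain uB where uB: "eigsys d (compress ws B) uB (delete_nth i \<mu>)"
    using deflated[OF B(1) refl len(2) Bx] by blast
  have l2: "length (map2 (+) lam \<mu>) = ?n" "map2 (+) lam \<mu> ! i = f i"
    using len i by (auto simp: f_def)
  obtain uC where "eigsys d (compress ws (A + B)) uC (delete_nth i (map2 (+) lam \<mu>))"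
    using deflated[OF C(1,2) l2(1)] Cx l2(2) by auto
  then have uC: "eigsys d (compress ws A + compress ws B) uC (map2 (+) (delete_nth i lam) (delete_nth i \<mu>))"
    using compress_add[OF Ac Bc wsc] map2_delete_nth[of lam \<mu> "(+)" i] len by simp
  obtain v where v: "eigsys d (compress ws A) v (delete_nth i lam)" "eigsys d (compress ws B) v (delete_nth i \<mu>)"
    using Suc.IH[OF uA sorted_wrt_delete_nth[OF A(2)] uB sorted_wrt_delete_nth[OF B(2)] uC refl] by blast
  let ?v = "map (synthesis ?n ws) v"
  have i': "i \<le> d" using i by simp
  have "eigsys ?n A (take i ?v @ x # drop i ?v) lam"
    using eigsys_insert_at[OF eigsys_deflate[OF eigsys_hermitian[OF A(1)] xws ws(2) Ax v(1)] i']
      insert_delete_nth[of i lam] i len by simp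
  moreover have "eigsys ?n B (take i ?v @ x # drop i ?v) \<mu>"
    using eigsys_insert_at[OF eigsys_deflate[OF eigsys_hermitian[OF B(1)] xws ws(2) Bx v(2)] i']
      insert_delete_nth[of i \<mu>] i len by simp
  ultimately show ?case by blast
qed


section \<open>Submajorization\<close>

lemma excess_nth: "excess r xs = (\<Sum>i<length xs. max 0 (xs ! i - r))"
  by (simp add: excess_def sum_list_sum_nth atLeast0LessThan)

lemma excess_mset:
  assumes "mset xs = mset ys" shows "excess r xs = excess r ys"
proof -
  have "sum_mset (image_mset (\<lambda>x. max 0 (x - r)) (mset xs)) = sum_mset (image_mset (\<lambda>x. max 0 (x - r)) (mset ys))"
    using assms by simp
  then show ?thesis by (simp only: excess_def mset_map[symmetric] sum_mset_sum_list)
qed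

lemma excess_decr [simp]: "excess r (decr x) = excess r x"
  by (rule excess_mset) simp

text \<open>
  The sum of the \<open>k\<close> largest entries is the minimum of \<open>k r + excess r xs\<close> over all levels \<open>r\<close>, attained
  when \<open>r\<close> is the \<open>k\<close>-th largest entry. These two lemmas are the bound and its attainment; together
  they turn inequalities between excess functions into submajorization.
\<close>

lemma sum_list_take_le_excess:
  assumes "k \<le> length xs"
  shows "sum_list (take k xs) \<le> real k * r + excess r xs"
proof -
  have "sum_list (take k xs) = (\<Sum>i<k. xs ! i)"
    using assms by (simp add: sum_list_sum_nth atLeast0LessThan)
  also have "\<dots> \<le> (\<Sum>i<k. r + max 0 (xs ! i - r))" by (intro sum_mono) auto
  also have "\<dots> = real k * r + (\<Sum>i<k. max 0 (xs ! i - r))" by (simp add: sum.distrib)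
  also have "(\<Sum>i<k. max 0 (xs ! i - r)) \<le> excess r xs"
    unfolding excess_nth using assms by (intro sum_mono2) auto
  finally show ?thesis by simp
qed

lemma sum_list_take_eq_excess:
  assumes s: "sorted_wrt (\<ge>) xs" and k: "k < length xs"
  shows "sum_list (take (Suc k) xs) = real (Suc k) * xs ! k + excess (xs ! k) xs"
proof -
  let ?r = "xs ! k"
  have "excess ?r xs = (\<Sum>i<length xs. max 0 (xs ! i - ?r))" by (rule excess_nth)
  also have "\<dots> = (\<Sum>i<Suc k. max 0 (xs ! i - ?r))"
    using k sorted_desc_nth_mono[OF s] by (intro sum.mono_neutral_right) (auto simp: not_less_eq)
  also have "\<dots> = (\<Sum>i<Suc k. xs ! i - ?r)"
    using k sorted_desc_nth_mono[OF s] by (intro sum.cong refl) (auto simp: less_Suc_eq_le)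
  also have "\<dots> = sum_list (take (Suc k) xs) - real (Suc k) * ?r"
    using k by (simp add: sum_list_sum_nth atLeast0LessThan sum_subtractf del: sum.lessThan_Suc)
  finally show ?thesis by simp
qed

lemma submajorizedI:
  assumes len: "length x = length y" and le: "\<And>r. excess r x \<le> excess r y"
  shows "x \<prec>\<^sub>w y"
  unfolding submajorized_def
proof (intro conjI ballI)
  fix k assume k: "k \<in> {1..length x}"
  then obtain l where l: "k = Suc l" by (cases k) auto
  let ?r = "decr y ! l"
  have "sum_list (take k (decr x)) \<le> real k * ?r + excess ?r (decr x)"
    using k by (intro sum_list_take_le_excess) simp
  also have "\<dots> \<le> real k * ?r + excess ?r (decr y)" using le by simp
  also have "\<dots> = sum_list (take k (decr y))"
    using sum_list_take_eq_excess[OF sorted_wrt_decr, of l y] l k len by simp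
  finally show "sum_list (take k (decr x)) \<le> sum_list (take k (decr y))" .
qed (rule len)

lemma submajorized_antisym:
  assumes "x \<prec>\<^sub>w y" "y \<prec>\<^sub>w x"
  shows "mset x = mset y"
proof -
  have len: "length x = length y" using assms by (simp add: submajorized_def)
  have eq: "sum_list (take k (decr x)) = sum_list (take k (decr y))" if "k \<le> length x" for k
  proof (cases "k = 0")
    case False
    then have "k \<in> {1..length x}" "k \<in> {1..length y}" using that len by auto
    then show ?thesis using assms by (auto simp: submajorized_def intro: antisym)
  qed simp
  have "decr x ! k = decr y ! k" if "k < length x" for k
  proof -
    have "sum_list (take (Suc k) (decr x)) = sum_list (take (Suc k) (decr y))"
      "sum_list (take k (decr x)) = sum_list (take k (decr y))" using eq that by auto
    then show ?thesis using that len by (simp add: take_Suc_conv_app_nth)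
  qed
  then have "decr x = decr y" using len by (intro nth_equalityI) auto
  then have "mset (decr x) = mset (decr y)" by simp
  then show ?thesis by simp
qed

lemma decr_cong_mset: "mset x = mset y \<Longrightarrow> decr x = decr y"
  unfolding decr_def by (metis properties_for_sort sorted_sort mset_sort)

lemma submajorized_mset_left: "mset x = mset x' \<Longrightarrow> x \<prec>\<^sub>w y \<longleftrightarrow> x' \<prec>\<^sub>w y"
  using decr_cong_mset[of x x'] mset_eq_length[of x x'] by (simp add: submajorized_def)

lemma orthonormal_unit_vecs: "orthonormal d (unit_vecs d)"
proof -
  have "unit_vec d i \<bullet>c unit_vec d j = (if i = j then 1 else 0 :: complex)" if "i < d" "j < d" for i j
    using that by (subst cinner_sum[of _ d]) (auto simp: if_distrib[of "\<lambda>z. z * _"] sum.delta unit_vec_def cong: if_cong)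
  then show ?thesis by (auto simp: orthonormal_def unit_vecs_def)
qed

text \<open>
  Adding increments in the order opposite to that of \<open>\<lambda>\<close> is the most balanced choice. This is Lidskii's
  inequality for diagonal matrices, whose sum has the spectrum \<open>\<lambda> + \<mu>\<close>.
\<close>

lemma excess_sort_le:
  assumes lam: "sorted_wrt (\<ge>) lam" and len: "length \<mu> = length lam"
  shows "excess r (map2 (+) lam (sort \<mu>)) \<le> excess r (map2 (+) lam \<mu>)"
proof -
  let ?d = "length lam"
  let ?e = "unit_vecs ?d :: complex vec list"
  have e: "orthonormal ?d ?e" "length ?e = ?d" by (rule orthonormal_unit_vecs) (simp add: unit_vecs_def)
  have A: "eigsys ?d (outer_sum ?d lam ?e) ?e lam" by (rule eigsys_outer_sum[OF e refl])
  have B: "eigsys ?d (outer_sum ?d \<mu> ?e) ?e \<mu>" by (rule eigsys_outer_sum[OF e len])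
  have "eigsys ?d (outer_sum ?d (map2 (+) lam \<mu>) ?e) ?e (map2 (+) lam \<mu>)"
    using len by (intro eigsys_outer_sum[OF e]) simp
  also have "outer_sum ?d (map2 (+) lam \<mu>) ?e = outer_sum ?d lam ?e + outer_sum ?d \<mu> ?e"
    using len by (intro eq_matI) (simp_all add: outer_sum_def distrib_right sum.distrib)
  finally have C: "eigsys ?d (outer_sum ?d lam ?e + outer_sum ?d \<mu> ?e) ?e (map2 (+) lam \<mu>)" .
  obtain w where "eigsys ?d (outer_sum ?d \<mu> ?e) w (sort \<mu>)"
    using eigsys_permute[OF B, of "sort \<mu>"] by auto
  then show ?thesis by (rule lidskii[OF A lam _ sorted_sort C])
qed

section \<open>The minimizer by water filling\<close>

lemma sum_list_map2_add:
  fixes x y :: "real list"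
  assumes "length x = length y"
  shows "sum_list (map2 (+) x y) = sum_list x + sum_list y"
  using assms by (induction x y rule: list_induct2) auto

lemma map2_minus_add:
  fixes x y :: "real list"
  assumes "length x = length y"
  shows "map2 (-) (map2 (+) x y) x = y"
  using assms by (induction x y rule: list_induct2) auto

lemma card_nonzero_mset: "card {j. j < length xs \<and> xs ! j \<noteq> 0} = size (filter_mset (\<lambda>x. x \<noteq> 0) (mset xs))"
proof -
  have "size (filter_mset (\<lambda>x. x \<noteq> 0) (mset xs)) = length (filter (\<lambda>x. x \<noteq> 0) xs)"
    by (simp only: mset_filter[symmetric] size_mset)
  then show ?thesis by (simp add: length_filter_conv_card)
qed

lemma excess_deficit: "excess q xs = sum_list xs - real (length xs) * q + (\<Sum>i<length xs. max 0 (q - xs ! i))"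
proof -
  have "(\<Sum>i<length xs. max 0 (xs ! i - q)) = (\<Sum>i<length xs. (xs ! i - q) + max 0 (q - xs ! i))"
    by (intro sum.cong refl) (auto simp: max_def)
  then show ?thesis
    by (simp add: excess_nth sum.distrib sum_subtractf sum_list_sum_nth atLeast0LessThan)
qed

definition clamp :: "real \<Rightarrow> real \<Rightarrow> real" where
  "clamp \<eta> x = max 0 (min \<eta> x)"

text \<open>
  The increments that raise the entries of \<open>lam\<close> from index \<open>k\<close> on to the level \<open>c\<close>, each by at most \<open>\<eta>\<close>.
\<close>

definition filling :: "real \<Rightarrow> nat \<Rightarrow> real \<Rightarrow> real list \<Rightarrow> real list" where
  "filling \<eta> k c lam = map (\<lambda>i. if i < k then 0 else clamp \<eta> (c - lam ! i)) [0..<length lam]"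

locale water_filling =
  fixes lam :: "real list" and t \<eta> :: real and m :: int
  assumes lam: "sorted_wrt (\<ge>) lam" and eta: "0 < \<eta>" and m_le: "m \<le> int (length lam)"
    and t_ge: "sum_list lam \<le> t"
    and t_le: "t - sum_list lam \<le> real_of_int (min (int (length lam) - m) (int (length lam))) * \<eta>"
begin

text \<open>
  The number of leading entries that must stay unraised; a negative \<open>m\<close> allows every entry to be raised.
\<close>

definition head_length where "head_length = nat m"

lemma head_length_le: "head_length \<le> length lam"
  using m_le by (simp add: head_length_def)

lemma filling_nth: "i < length lam \<Longrightarrow> filling \<eta> head_length c lam ! i = (if i < head_length then 0 else clamp \<eta> (c - lam ! i))"
  by (simp add: filling_def)

lemma length_filling [simp]: "length (filling \<eta> head_length c lam) = length lam"
  by (simp add: filling_def)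

text \<open>
  The total increment is continuous in the level, vanishes at low levels and equals \<open>\<eta>\<close> times the number
  of entries that may be raised at high ones; the hypothesis on \<open>t\<close> places the required amount in
  between.
\<close>

lemma level_exists: "\<exists>c. sum_list (filling \<eta> head_length c lam) = t - sum_list lam"
proof -
  let ?d = "length lam"
  define g where "g c = (\<Sum>i\<in>{head_length..<?d}. clamp \<eta> (c - lam ! i))" for c
  have g: "sum_list (filling \<eta> head_length c lam) = g c" for c
  proof -
    have "sum_list (filling \<eta> head_length c lam) = (\<Sum>i\<in>{0..<?d}. if i < head_length then 0 else clamp \<eta> (c - lam ! i))"
      by (simp add: sum_list_sum_nth filling_nth)
    also have "\<dots> = g c" unfolding g_def
      by (rule sum.mono_neutral_cong_right) auto
    finally show ?thesis .
  qed
  \<comment> \<open>A level so low that nothing is raised, and one so high that every increment is capped.\<close>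
  define lo where "lo = - (\<Sum>i<?d. \<bar>lam ! i\<bar>)"
  define hi where "hi = \<eta> + (\<Sum>i<?d. \<bar>lam ! i\<bar>)"
  have bnd: "\<bar>lam ! i\<bar> \<le> (\<Sum>i<?d. \<bar>lam ! i\<bar>)" if "i < ?d" for i
    using that by (intro member_le_sum) auto
  have "clamp \<eta> (lo - lam ! i) = 0" if "i < ?d" for i
    using bnd[OF that] eta by (simp add: clamp_def lo_def)
  then have glo: "g lo = 0" by (simp add: g_def)
  have "clamp \<eta> (hi - lam ! i) = \<eta>" if "i < ?d" for i
    using bnd[OF that] eta by (simp add: clamp_def hi_def)
  then have "g hi = real (?d - head_length) * \<eta>" by (simp add: g_def)
  also have "real (?d - head_length) = real_of_int (min (int ?d - m) (int ?d))"
    using m_le by (simp add: head_length_def of_nat_diff min_def)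
  finally have ghi: "t - sum_list lam \<le> g hi" using t_le by simp
  have "lo \<le> hi" using eta sum_nonneg[of "{..<?d}" "\<lambda>i. \<bar>lam ! i\<bar>"] by (simp add: lo_def hi_def)
  moreover have "continuous_on {lo..hi} g"
    unfolding g_def clamp_def by (intro continuous_intros)
  ultimately obtain c where "g c = t - sum_list lam"
    using IVT'[of g lo "t - sum_list lam" hi] glo ghi t_ge by auto
  then show ?thesis using g by auto
qed

definition level where "level = (SOME z. sum_list (filling \<eta> head_length z lam) = t - sum_list lam)"

definition increment where "increment = filling \<eta> head_length level lam"

definition optimum where "optimum = map2 (+) lam increment"

lemma sum_increment: "sum_list increment = t - sum_list lam"
  using someI_ex[OF level_exists] by (simp add: increment_def level_def)

lemma length_increment [simp]: "length increment = length lam"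
  by (simp add: increment_def)

lemma length_optimum [simp]: "length optimum = length lam"
  by (simp add: optimum_def)

lemma sum_optimum: "sum_list optimum = t"
  using sum_increment by (simp add: optimum_def sum_list_map2_add)

lemma sorted_increment: "sorted increment"
proof -
  have "increment ! i \<le> increment ! j" if "i \<le> j" "j < length lam" for i j
    using that sorted_desc_nth_mono[OF lam that] eta by (auto simp: increment_def filling_nth clamp_def)
  then show ?thesis by (simp add: sorted_iff_nth_mono)
qed

definition feasible :: "real list \<Rightarrow> bool" where
  "feasible \<mu> \<longleftrightarrow> length \<mu> = length lam \<and> (\<forall>x\<in>set \<mu>. 0 \<le> x \<and> x \<le> \<eta>) \<and>
     sum_list \<mu> \<ge> t - sum_list lam \<and>
     int (card {j. j < length \<mu> \<and> \<mu> ! j \<noteq> 0}) \<le> int (length lam) - m"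

lemma perturbed_set_iff: "\<gamma> \<in> perturbed_set t \<eta> lam m \<longleftrightarrow> (\<exists>\<mu>. \<gamma> = map2 (+) lam \<mu> \<and> feasible \<mu>)"
  by (auto simp: perturbed_set_def feasible_def)

lemma feasible_increment: "feasible increment"
proof -
  have "{j. j < length lam \<and> increment ! j \<noteq> 0} \<subseteq> {head_length..<length lam}"
    by (auto simp: increment_def filling_nth split: if_splits)
  then have "card {j. j < length lam \<and> increment ! j \<noteq> 0} \<le> card {head_length..<length lam}"
    by (intro card_mono) auto
  then have "int (card {j. j < length lam \<and> increment ! j \<noteq> 0}) \<le> int (length lam) - m"
    using head_length_le by (simp add: head_length_def)
  moreover have "0 \<le> x \<and> x \<le> \<eta>" if "x \<in> set increment" for x
    using that eta by (auto simp: increment_def filling_def clamp_def)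
  ultimately show ?thesis using sum_increment by (simp add: feasible_def)
qed

lemma feasible_sort:
  assumes "feasible \<mu>" shows "feasible (sort \<mu>)"
proof -
  have "card {j. j < length (sort \<mu>) \<and> sort \<mu> ! j \<noteq> 0} = card {j. j < length \<mu> \<and> \<mu> ! j \<noteq> 0}"
    unfolding card_nonzero_mset by simp
  moreover have "sum_list (sort \<mu>) = sum_list \<mu>"
    by (metis mset_sort sum_mset_sum_list)
  ultimately show ?thesis using assms unfolding feasible_def by auto
qed

text \<open>
  A sorted nonnegative list has its nonzero entries at the end, and there are too few of them to reach
  into the first \<open>m\<close> positions.
\<close>

lemma feasible_sorted_zero:
  assumes f: "feasible \<mu>" and s: "sorted \<mu>" and i: "i < head_length"
  shows "\<mu> ! i = 0"
proof (rule ccontr)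
  assume nz: "\<mu> ! i \<noteq> 0"
  have il: "i < length lam" using i head_length_le by simp
  have len: "length \<mu> = length lam" and pos: "\<And>j. j < length lam \<Longrightarrow> 0 \<le> \<mu> ! j"
    using f by (auto simp: feasible_def)
  have "\<mu> ! j \<noteq> 0" if "i \<le> j" "j < length lam" for j
    using sorted_nth_mono[OF s that(1)] that len pos[OF il] nz by simp
  then have "{i..<length lam} \<subseteq> {j. j < length \<mu> \<and> \<mu> ! j \<noteq> 0}" using len by auto
  then have "card {i..<length lam} \<le> card {j. j < length \<mu> \<and> \<mu> ! j \<noteq> 0}" by (intro card_mono) auto
  then have "int (length lam) - int i \<le> int (length lam) - m" using f il by (auto simp: feasible_def)
  then show False using i by (simp add: head_length_def)
qed

text \<open>
  If an entry of the optimum exceeds some \<open>q\<close> at or above the water level, it has not been raised at all,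
  so a competitor cannot be lower there. If it falls short of some \<open>q\<close> at or below the water level, it has
  been raised by the full amount \<open>\<eta>\<close> or lies among the first entries, which no sorted competitor
  raises; so a competitor cannot be higher there.
\<close>

lemma feasible_pointwise:
  assumes f: "feasible \<mu>" and s: "sorted \<mu>" and i: "i < length lam"
  shows "level \<le> q \<Longrightarrow> max 0 (optimum ! i - q) \<le> max 0 (lam ! i + \<mu> ! i - q)"
    and "q \<le> level \<Longrightarrow> max 0 (q - optimum ! i) \<le> max 0 (q - (lam ! i + \<mu> ! i))"
proof -
  have len: "length \<mu> = length lam" and b: "0 \<le> \<mu> ! i" "\<mu> ! i \<le> \<eta>"
    using f i by (auto simp: feasible_def)
  have ri: "optimum ! i = lam ! i + (if i < head_length then 0 else clamp \<eta> (level - lam ! i))"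
    using i by (simp add: optimum_def increment_def filling_nth)
  have z: "\<mu> ! i = 0" if "i < head_length" using feasible_sorted_zero[OF f s that] .
  show "level \<le> q \<Longrightarrow> max 0 (optimum ! i - q) \<le> max 0 (lam ! i + \<mu> ! i - q)"
    using ri z b by (auto simp: clamp_def max_def min_def split: if_splits)
  show "q \<le> level \<Longrightarrow> max 0 (q - optimum ! i) \<le> max 0 (q - (lam ! i + \<mu> ! i))"
    using ri z b by (auto simp: clamp_def max_def min_def split: if_splits)
qed

text \<open>
  At or above the water level the excess is compared entry by entry. Below it the deficits are
  compared instead, and the remaining difference between excess and deficit is governed by the total
  sum, which is smallest for the optimum.
\<close>

lemma excess_minimal_sorted:
  assumes f: "feasible \<mu>" and s: "sorted \<mu>"
  shows "excess q optimum \<le> excess q (map2 (+) lam \<mu>)"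
proof (cases "level \<le> q")
  case True
  have len: "length \<mu> = length lam" using f by (simp add: feasible_def)
  show ?thesis unfolding excess_nth using len feasible_pointwise(1)[OF f s _ True] by (auto intro!: sum_mono)
next
  case False
  have len: "length \<mu> = length lam" using f by (simp add: feasible_def)
  have "sum_list optimum \<le> sum_list (map2 (+) lam \<mu>)"
    using f by (simp add: sum_optimum sum_list_map2_add feasible_def)
  moreover have "(\<Sum>i<length lam. max 0 (q - optimum ! i)) \<le> (\<Sum>i<length lam. max 0 (q - map2 (+) lam \<mu> ! i))"
    using len feasible_pointwise(2)[OF f s, of _ q] False by (intro sum_mono) simp
  ultimately show ?thesis unfolding excess_deficit using len by simp
qed

lemma excess_minimal:
  assumes f: "feasible \<mu>"
  shows "excess q optimum \<le> excess q (map2 (+) lam \<mu>)"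
proof -
  have "excess q optimum \<le> excess q (map2 (+) lam (sort \<mu>))"
    by (rule excess_minimal_sorted[OF feasible_sort[OF f] sorted_sort])
  also have "\<dots> \<le> excess q (map2 (+) lam \<mu>)"
    using f by (intro excess_sort_le[OF lam]) (simp add: feasible_def)
  finally show ?thesis .
qed

text \<open>
  At the water level itself both entrywise comparisons apply. Equal excess and equal sums force equal
  deficits, so all entrywise inequalities are equalities, and an entry is determined by its excess and
  its deficit.
\<close>

lemma minimizer_unique:
  assumes f: "feasible \<mu>" and s: "sorted \<mu>" and sum: "sum_list (map2 (+) lam \<mu>) = t"
    and ex: "excess level (map2 (+) lam \<mu>) = excess level optimum"
  shows "map2 (+) lam \<mu> = optimum"
proof (rule nth_equalityI)
  have len: "length \<mu> = length lam" using f by (simp add: feasible_def)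
  then show "length (map2 (+) lam \<mu>) = length optimum" by simp
  let ?x = "map2 (+) lam \<mu>"
  have lx: "length ?x = length lam" using len by simp
  have xi: "?x ! i = lam ! i + \<mu> ! i" if "i < length lam" for i using that len by simp
  have p1: "max 0 (optimum ! i - level) \<le> max 0 (?x ! i - level)" if "i < length lam" for i
    using feasible_pointwise(1)[OF f s that order_refl] xi[OF that] by simp
  have p2: "max 0 (level - optimum ! i) \<le> max 0 (level - ?x ! i)" if "i < length lam" for i
    using feasible_pointwise(2)[OF f s that order_refl] xi[OF that] by simp
  have sum_eqD: "f i = g i" if "\<And>i. i < n \<Longrightarrow> f i \<le> g i" "(\<Sum>i<n. f i) = (\<Sum>i<n. g i)" "i < n"
    for f g :: "nat \<Rightarrow> real" and n i
  proof -
    have "(\<Sum>i<n. g i - f i) = 0" using that by (simp add: sum_subtractf)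
    then have "g i - f i = 0" using that by (subst (asm) sum_nonneg_eq_0_iff) auto
    then show ?thesis by simp
  qed
  fix i assume "i < length ?x"
  then have i: "i < length lam" using lx by simp
  have e1: "max 0 (optimum ! i - level) = max 0 (?x ! i - level)"
    by (rule sum_eqD[OF p1 _ i]) (use ex lx in \<open>auto simp: excess_nth\<close>)
  have S: "(\<Sum>i<length lam. max 0 (level - optimum ! i)) = (\<Sum>i<length lam. max 0 (level - ?x ! i))"
    using ex sum sum_optimum lx unfolding excess_deficit by simp
  have e2: "max 0 (level - optimum ! i) = max 0 (level - ?x ! i)"
    by (rule sum_eqD[OF p2 S i])
  show "?x ! i = optimum ! i" using e1 e2 by (auto simp: max_def split: if_splits)
qed

lemma rho_min_eq: "rho_min t \<eta> lam m = optimum"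
  unfolding rho_min_def
proof (rule the_equality)
  have "optimum \<prec>\<^sub>w \<gamma>" if g: "\<gamma> \<in> perturbed_set t \<eta> lam m" for \<gamma>
  proof -
    obtain \<mu> where "\<gamma> = map2 (+) lam \<mu>" "feasible \<mu>" using g perturbed_set_iff by auto
    then show ?thesis using excess_minimal by (intro submajorizedI) (auto simp: feasible_def)
  qed
  moreover have "map2 (-) optimum lam = sort (map2 (-) optimum lam)"
    using sorted_increment by (simp add: optimum_def map2_minus_add sorted_sort_id)
  ultimately show "optimum \<in> perturbed_set t \<eta> lam m \<and> sum_list optimum = t \<and>
      (\<forall>\<gamma>\<in>perturbed_set t \<eta> lam m. optimum \<prec>\<^sub>w \<gamma>) \<and> map2 (-) optimum lam = sort (map2 (-) optimum lam)"
    using feasible_increment sum_optimum perturbed_set_iff optimum_def by auto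
next
  fix \<rho> assume rho: "\<rho> \<in> perturbed_set t \<eta> lam m \<and> sum_list \<rho> = t \<and>
      (\<forall>\<gamma>\<in>perturbed_set t \<eta> lam m. \<rho> \<prec>\<^sub>w \<gamma>) \<and> map2 (-) \<rho> lam = sort (map2 (-) \<rho> lam)"
  then obtain \<mu> where mu: "\<rho> = map2 (+) lam \<mu>" "feasible \<mu>" using perturbed_set_iff by auto
  then have len: "length lam = length \<mu>" by (simp add: feasible_def)
  have s: "sorted \<mu>" using rho sorted_sort[of \<mu>] unfolding mu(1) map2_minus_add[OF len] by simp
  have "\<rho> \<prec>\<^sub>w optimum" using rho perturbed_set_iff feasible_increment optimum_def by blast
  moreover have "optimum \<prec>\<^sub>w \<rho>" using excess_minimal[OF mu(2)] mu len by (intro submajorizedI) auto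
  ultimately have "mset \<rho> = mset optimum" by (rule submajorized_antisym)
  then have "excess level \<rho> = excess level optimum" by (rule excess_mset)
  then show "\<rho> = optimum" using minimizer_unique[OF mu(2) s] rho mu(1) by simp
qed

end


section \<open>Adjoints, spans and frame operators\<close>

lemma dim_mat_adjoint [simp]:
  "dim_row (mat_adjoint A) = dim_col A" "dim_col (mat_adjoint A) = dim_row A"
  by (auto simp: mat_adjoint_def)

lemma mat_adjoint_carrier [simp]: "A \<in> carrier_mat n m \<Longrightarrow> mat_adjoint A \<in> carrier_mat m n"
  by auto

lemma mat_adjoint_index:
  fixes A :: "complex mat"
  assumes "i < dim_col A" "j < dim_row A"
  shows "mat_adjoint A $$ (i, j) = cnj (A $$ (j, i))"
  using assms by (simp add: mat_adjoint_def mat_of_rows_index)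

lemma mat_adjoint_adjoint:
  fixes A :: "complex mat"
  shows "mat_adjoint (mat_adjoint A) = A"
  by (intro eq_matI) (auto simp: mat_adjoint_index)

lemma mat_adjoint_add:
  fixes A :: "complex mat"
  assumes "A \<in> carrier_mat n m" "B \<in> carrier_mat n m"
  shows "mat_adjoint (A + B) = mat_adjoint A + mat_adjoint B"
  using assms by (intro eq_matI) (auto simp: mat_adjoint_index)

lemma mat_adjoint_mult:
  fixes A :: "complex mat"
  assumes A: "A \<in> carrier_mat n m" and B: "B \<in> carrier_mat m p"
  shows "mat_adjoint (A * B) = mat_adjoint B * mat_adjoint A"
proof (rule eq_matI)
  fix i j assume "i < dim_row (mat_adjoint B * mat_adjoint A)" "j < dim_col (mat_adjoint B * mat_adjoint A)"
  then have ij: "i < p" "j < n" using A B by auto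
  have "mat_adjoint (A * B) $$ (i, j) = cnj ((A * B) $$ (j, i))"
    using ij A B by (intro mat_adjoint_index) auto
  also have "\<dots> = (\<Sum>k<m. cnj (A $$ (j, k)) * cnj (B $$ (k, i)))"
    by (simp only: mult_mat_sum[OF A B ij(2,1)] cnj_sum complex_cnj_mult)
  also have "\<dots> = (\<Sum>k<m. mat_adjoint B $$ (i, k) * mat_adjoint A $$ (k, j))"
    using ij A B by (intro sum.cong refl) (simp add: mat_adjoint_index)
  also have "\<dots> = (mat_adjoint B * mat_adjoint A) $$ (i, j)"
    using mult_mat_sum[OF mat_adjoint_carrier[OF B] mat_adjoint_carrier[OF A] ij] by simp
  finally show "mat_adjoint (A * B) $$ (i, j) = (mat_adjoint B * mat_adjoint A) $$ (i, j)" .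
qed (use A B in auto)

lemma mat_adjoint_one: "mat_adjoint (1\<^sub>m d) = (1\<^sub>m d :: complex mat)"
  by (intro eq_matI) (auto simp: mat_adjoint_index)

lemma mat_adjoint_zero: "mat_adjoint (0\<^sub>m n m) = (0\<^sub>m m n :: complex mat)"
  by (intro eq_matI) (auto simp: mat_adjoint_index)

lemma cinner_adjoint:
  fixes A :: "complex mat"
  assumes A: "A \<in> carrier_mat n m" and x: "x \<in> carrier_vec m" and y: "y \<in> carrier_vec n"
  shows "(A *\<^sub>v x) \<bullet>c y = x \<bullet>c (mat_adjoint A *\<^sub>v y)"
proof -
  have "(A *\<^sub>v x) \<bullet>c y = (\<Sum>i<n. \<Sum>j<m. x $ j * (A $$ (i, j) * cnj (y $ i)))"
    using cinner_sum[OF y] by (simp add: mult_mat_vec_sum[OF A x] sum_distrib_right mult.assoc mult.left_commute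
      del: index_mult_mat_vec)
  also have "\<dots> = (\<Sum>j<m. \<Sum>i<n. x $ j * (A $$ (i, j) * cnj (y $ i)))"
    by (rule sum.swap)
  also have "\<dots> = (\<Sum>j<m. x $ j * cnj ((mat_adjoint A *\<^sub>v y) $ j))"
  proof (intro sum.cong refl)
    fix j assume "j \<in> {..<m}"
    then have j: "j < m" by simp
    have "cnj ((mat_adjoint A *\<^sub>v y) $ j) = (\<Sum>i<n. A $$ (i, j) * cnj (y $ i))"
      unfolding mult_mat_vec_sum[OF mat_adjoint_carrier[OF A] y j]
      using j A by (simp add: mat_adjoint_index)
    then show "(\<Sum>i<n. x $ j * (A $$ (i, j) * cnj (y $ i))) = x $ j * cnj ((mat_adjoint A *\<^sub>v y) $ j)"
      by (simp add: sum_distrib_left)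
  qed
  also have "\<dots> = x \<bullet>c (mat_adjoint A *\<^sub>v y)"
    by (rule cinner_sum[symmetric, OF mult_mat_vec_carrier[OF mat_adjoint_carrier[OF A] y]])
  finally show ?thesis .
qed

text \<open>
  Conjugation turns orthogonality into annihilation under the bilinear product, for which the
  annihilator of a set and that of its span agree.
\<close>

lemma spans_orthogonal_zero:
  assumes F: "set F \<subseteq> carrier_vec d" "spans d F" and x: "x \<in> carrier_vec d"
    and orth: "\<And>f. f \<in> set F \<Longrightarrow> x \<bullet>c f = 0"
  shows "x = 0\<^sub>v d"
proof -
  interpret V: vec_space "TYPE(complex)" d .
  have xc: "conjugate x \<in> carrier_vec d" using x by simp
  have "conjugate x \<bullet> f = 0" if f: "f \<in> set F" for f
  proof -
    have fc: "f \<in> carrier_vec d" using F f by auto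
    have "f \<bullet>c x = 0" using cinner_commute[OF fc x] orth[OF f] by simp
    then show ?thesis using comm_scalar_prod[OF fc xc] by simp
  qed
  then have "conjugate x \<in> V.orthogonal_complement (set F)"
    using xc by (simp add: V.orthogonal_complement_def)
  then have "conjugate x \<in> V.orthogonal_complement (V.span (set F))"
    using V.in_orthogonal_complement_span[OF F(1)] by simp
  then have "conjugate x \<bullet> x = 0"
    using F(2) x by (simp add: V.orthogonal_complement_def spans_def)
  then have "x \<bullet>c x = 0" using comm_scalar_prod[OF xc x] by simp
  then show ?thesis using x by simp
qed

lemma orthonormal_spans:
  assumes v: "orthonormal d v" "length v = d"
  shows "spans d v"
proof -
  interpret V: vec_space "TYPE(complex)" d .
  have vc: "set v \<subseteq> carrier_vec d" using v by (simp add: orthonormal_def)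
  have "x \<in> V.span (set v)" if x: "x \<in> carrier_vec d" for x
  proof -
    define a where "a k = x \<bullet>c v ! k" for k
    have "V.lincomb_list a v = mat_of_cols d v *\<^sub>v vec (length v) a"
      by (rule V.lincomb_list_as_mat_mult) (use vc in auto)
    also have "\<dots> = x"
    proof (rule orthonormal_basis_eqI[OF v _ x])
      show "mat_of_cols d v *\<^sub>v vec (length v) a \<in> carrier_vec d" by (rule carrier_vecI) simp
      fix k assume k: "k < d"
      have vk: "v ! k \<in> carrier_vec d" using k v vc by auto
      have M: "mat_of_cols d v \<in> carrier_mat d d" using v by auto
      have a: "vec (length v) a \<in> carrier_vec d" using v by auto
      have "(mat_of_cols d v *\<^sub>v vec (length v) a) \<bullet>c v ! k
          = vec (length v) a \<bullet>c (mat_adjoint (mat_of_cols d v) *\<^sub>v v ! k)"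
        by (rule cinner_adjoint[OF M a vk])
      also have "mat_adjoint (mat_of_cols d v) *\<^sub>v v ! k = unit_vec d k"
      proof (rule eq_vecI)
        fix i assume "i < dim_vec (unit_vec d k :: complex vec)"
        then have i: "i < d" by simp
        have "(mat_adjoint (mat_of_cols d v) *\<^sub>v v ! k) $ i = (\<Sum>j<d. mat_adjoint (mat_of_cols d v) $$ (i, j) * v ! k $ j)"
          by (rule mult_mat_vec_sum[OF mat_adjoint_carrier[OF M] vk i])
        also have "\<dots> = (\<Sum>j<d. v ! k $ j * cnj (v ! i $ j))"
          using i v by (intro sum.cong refl) (simp add: mat_adjoint_index mat_of_cols_index)
        also have "\<dots> = v ! k \<bullet>c v ! i"
          by (rule cinner_sum[symmetric]) (use i v vc in auto)
        also have "\<dots> = unit_vec d k $ i" using i k v by (auto simp: orthonormal_def)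
        finally show "(mat_adjoint (mat_of_cols d v) *\<^sub>v v ! k) $ i = unit_vec d k $ i" .
      qed (use v in auto)
      also have "vec (length v) a \<bullet>c unit_vec d k = a k"
        using k v by (subst cinner_sum[of _ d])
          (auto simp: unit_vec_def if_distrib[of "\<lambda>z. _ * z"] if_distrib[of cnj] sum.delta cong: if_cong)
      also have "a k = x \<bullet>c v ! k" by (simp only: a_def)
      finally show "(mat_of_cols d v *\<^sub>v vec (length v) a) \<bullet>c v ! k = x \<bullet>c v ! k" .
    qed
    finally have "x \<in> V.span_list v" by (auto simp: V.span_list_def)
    then show ?thesis using V.span_list_as_span[OF vc] by simp
  qed
  moreover have "V.span (set v) \<subseteq> carrier_vec d" using V.span_is_subset2[OF vc] by simp
  ultimately show ?thesis by (auto simp: spans_def)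
qed

lemma orthonormal_basis_iff: "orthonormal_basis d v \<longleftrightarrow> orthonormal d v \<and> length v = d"
  using orthonormal_spans[of d v] by (auto simp: orthonormal_basis_def orthonormal_def)

lemma orthonormal_append:
  assumes "orthonormal n ys"
  shows "orthonormal n xs \<Longrightarrow> (\<And>x y. x \<in> set xs \<Longrightarrow> y \<in> set ys \<Longrightarrow> y \<bullet>c x = 0) \<Longrightarrow> orthonormal n (xs @ ys)"
  using assms by (induction xs) (auto simp: orthonormal_Cons)

lemma dim_analysis [simp]:
  "dim_row (analysis d G) = length G" "dim_col (analysis d G) = d"
  by (simp_all add: analysis_def)

lemma analysis_carrier [simp]: "analysis d G \<in> carrier_mat (length G) d"
  by (rule carrier_matI) simp_all

lemma analysis_index:
  assumes "set G \<subseteq> carrier_vec d" "i < length G" "j < d"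
  shows "analysis d G $$ (i, j) = cnj (G ! i $ j)"
proof -
  have "G ! i \<in> carrier_vec d" using assms by auto
  then show ?thesis using assms by (simp add: analysis_def mat_of_rows_index)
qed

lemma analysis_add:
  assumes "length K = length C" "set C \<subseteq> carrier_vec d" "set K \<subseteq> carrier_vec d"
  shows "analysis d (map2 (+) C K) = analysis d C + analysis d K"
proof (rule eq_matI)
  have s: "set (map2 (+) C K) \<subseteq> carrier_vec d"
  proof
    fix w assume "w \<in> set (map2 (+) C K)"
    then obtain i where "i < length C" "w = C ! i + K ! i" using assms(1) by (auto simp: in_set_conv_nth)
    then show "w \<in> carrier_vec d" using assms by (metis add_carrier_vec nth_mem subsetD)
  qed
  fix i j assume "i < dim_row (analysis d C + analysis d K)" "j < dim_col (analysis d C + analysis d K)"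
  then have ij: "i < length C" "i < length K" "j < d" using assms by (auto simp: analysis_def)
  then have "K ! i \<in> carrier_vec d" using assms by auto
  then show "analysis d (map2 (+) C K) $$ (i, j) = (analysis d C + analysis d K) $$ (i, j)"
    using ij s assms by (simp add: analysis_index)
qed (use assms in auto)

lemma analysis_surj:
  assumes T: "T \<in> carrier_mat n d"
  obtains K where "length K = n" "set K \<subseteq> carrier_vec d" "analysis d K = T"
proof -
  define K where "K = map (\<lambda>i. vec d (\<lambda>j. cnj (T $$ (i, j)))) [0..<n]"
  have K: "length K = n" "set K \<subseteq> carrier_vec d" by (auto simp: K_def)
  have "analysis d K = T"
  proof (rule eq_matI)
    fix i j assume "i < dim_row T" "j < dim_col T"
    then have "i < n" "j < d" using T by auto
    then show "analysis d K $$ (i, j) = T $$ (i, j)"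
      using K by (simp add: analysis_index) (simp add: K_def)
  qed (use T K in \<open>auto simp: analysis_def\<close>)
  then show ?thesis using that K by blast
qed

lemma gram_cinner:
  fixes T :: "complex mat"
  assumes T: "T \<in> carrier_mat n d" and x: "x \<in> carrier_vec d" and y: "y \<in> carrier_vec d"
  shows "((mat_adjoint T * T) *\<^sub>v x) \<bullet>c y = (T *\<^sub>v x) \<bullet>c (T *\<^sub>v y)"
proof -
  have Tx: "T *\<^sub>v x \<in> carrier_vec n" using T x by auto
  have "((mat_adjoint T * T) *\<^sub>v x) \<bullet>c y = (mat_adjoint T *\<^sub>v (T *\<^sub>v x)) \<bullet>c y"
    using assoc_mult_mat_vec[OF mat_adjoint_carrier[OF T] T x] by simp
  also have "\<dots> = (T *\<^sub>v x) \<bullet>c (mat_adjoint (mat_adjoint T) *\<^sub>v y)"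
    by (rule cinner_adjoint[OF mat_adjoint_carrier[OF T] Tx y])
  finally show ?thesis by (simp only: mat_adjoint_adjoint)
qed

lemma gram_hermitian:
  assumes T: "T \<in> carrier_mat n d"
  shows "hermitian_mat d (mat_adjoint T * T)"
proof -
  let ?S = "mat_adjoint T * T"
  have S: "?S \<in> carrier_mat d d" using mult_carrier_mat[OF mat_adjoint_carrier[OF T] T] .
  have adj: "mat_adjoint ?S = ?S"
    using mat_adjoint_mult[OF mat_adjoint_carrier[OF T] T] by (simp add: mat_adjoint_adjoint)
  have H: "?S $$ (i, j) = cnj (?S $$ (j, i))" if "i < d" "j < d" for i j
    using mat_adjoint_index[of i ?S j] S that adj by (metis carrier_matD)
  show ?thesis unfolding hermitian_mat_def
  proof (intro conjI allI impI)
    show "?S \<in> carrier_mat d d" by (rule S)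
    show "\<And>i j. i < d \<Longrightarrow> j < d \<Longrightarrow> ?S $$ (i, j) = cnj (?S $$ (j, i))" by (rule H)
  qed
qed

lemma gram_eigenvalue:
  assumes T: "T \<in> carrier_mat n d" and S: "eigsys d (mat_adjoint T * T) v c" and k: "k < d" "l < d"
  shows "(T *\<^sub>v v ! k) \<bullet>c (T *\<^sub>v v ! l) = (if k = l then complex_of_real (c ! k) else 0)"
    and "(vnorm (T *\<^sub>v v ! k))\<^sup>2 = c ! k"
proof -
  have v: "orthonormal d v" "length v = d" using S by (auto simp: eigsys_def)
  have vc: "v ! j \<in> carrier_vec d" if "j < d" for j using that orthonormal_carrier[OF v(1)] v by simp
  have *: "(T *\<^sub>v v ! k) \<bullet>c (T *\<^sub>v v ! l) = (if k = l then complex_of_real (c ! k) else 0)" if "l < d" for l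
  proof -
    have "(T *\<^sub>v v ! k) \<bullet>c (T *\<^sub>v v ! l) = ((mat_adjoint T * T) *\<^sub>v v ! k) \<bullet>c v ! l"
      using gram_cinner[OF T vc[OF k(1)] vc[OF that]] by simp
    also have "\<dots> = complex_of_real (c ! l) * (v ! k \<bullet>c v ! l)"
      by (rule eigsys_cinner[OF S vc[OF k(1)] that])
    also have "\<dots> = (if k = l then complex_of_real (c ! k) else 0)"
      using v k that by (auto simp: orthonormal_def)
    finally show ?thesis .
  qed
  show "(T *\<^sub>v v ! k) \<bullet>c (T *\<^sub>v v ! l) = (if k = l then complex_of_real (c ! k) else 0)"
    using *[OF k(2)] .
  have "complex_of_real ((vnorm (T *\<^sub>v v ! k))\<^sup>2) = complex_of_real (c ! k)"
    using *[OF k(1)] cinner_self[OF mult_mat_vec_carrier[OF T vc[OF k(1)]]] by simp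
  then show "(vnorm (T *\<^sub>v v ! k))\<^sup>2 = c ! k" by (simp only: of_real_eq_iff)
qed

lemma gram_vnorm:
  assumes T: "T \<in> carrier_mat n d" and S: "eigsys d (mat_adjoint T * T) v c" and x: "x \<in> carrier_vec d"
  shows "(vnorm (T *\<^sub>v x))\<^sup>2 = (\<Sum>k<d. c ! k * (cmod (x \<bullet>c v ! k))\<^sup>2)"
proof -
  have "complex_of_real ((vnorm (T *\<^sub>v x))\<^sup>2) = complex_of_real (\<Sum>k<d. c ! k * (cmod (x \<bullet>c v ! k))\<^sup>2)"
    using gram_cinner[OF T x x] eigsys_quadratic[OF S x] cinner_self[OF mult_mat_vec_carrier[OF T x]] by simp
  then show ?thesis by (simp only: of_real_eq_iff)
qed

text \<open>
  In the eigenbasis of \<open>T\<^sup>* T\<close> the squared norm of \<open>T x\<close> is a sum of eigenvalues weighted by the squared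
  coordinates of \<open>x\<close>, so the squared operator norm is the largest eigenvalue.
\<close>

lemma spectral_norm_le_iff:
  assumes T: "T \<in> carrier_mat n d" and S: "eigsys d (mat_adjoint T * T) v c" and e: "0 \<le> e"
  shows "spectral_norm T \<le> e \<longleftrightarrow> (\<forall>k<d. c ! k \<le> e\<^sup>2)"
proof -
  have v: "orthonormal d v" "length v = d" using S by (auto simp: eigsys_def)
  have vc: "v ! j \<in> carrier_vec d" if "j < d" for j using that orthonormal_carrier[OF v(1)] v by simp
  let ?X = "{x \<in> carrier_vec (dim_col T). vnorm x \<le> 1}"
  have X: "?X = {x \<in> carrier_vec d. vnorm x \<le> 1}" using T by simp
  have bound: "vnorm (T *\<^sub>v x) \<le> b" if x: "x \<in> carrier_vec d" "vnorm x \<le> 1" and b: "0 \<le> b" "\<forall>k<d. c ! k \<le> b\<^sup>2" for x b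
  proof (rule power2_le_imp_le)
    have "complex_of_real ((vnorm x)\<^sup>2) = complex_of_real (\<Sum>k<d. (cmod (x \<bullet>c v ! k))\<^sup>2)"
      using cinner_self[OF x(1)] parseval[OF v x(1) x(1)] by (simp only: mult_cnj_cmod of_real_sum)
    then have nx: "(vnorm x)\<^sup>2 = (\<Sum>k<d. (cmod (x \<bullet>c v ! k))\<^sup>2)" by (simp only: of_real_eq_iff)
    have "(vnorm (T *\<^sub>v x))\<^sup>2 \<le> (\<Sum>k<d. b\<^sup>2 * (cmod (x \<bullet>c v ! k))\<^sup>2)"
      unfolding gram_vnorm[OF T S x(1)] using b by (intro sum_mono mult_right_mono) auto
    also have "\<dots> = b\<^sup>2 * (vnorm x)\<^sup>2" by (simp add: nx sum_distrib_left)
    also have "\<dots> \<le> b\<^sup>2 * 1" using x vnorm_nonneg by (intro mult_left_mono) (auto simp: power_le_one)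
    finally show "(vnorm (T *\<^sub>v x))\<^sup>2 \<le> b\<^sup>2" by simp
  qed (rule b)
  have zero: "0\<^sub>v d \<in> {x \<in> carrier_vec d. vnorm x \<le> 1}" by (simp add: vnorm_def L2_set_def)
  show ?thesis
  proof
    assume le: "spectral_norm T \<le> e"
    \<comment> \<open>A crude bound on the norm, which shows that the supremum is over a bounded set; adding 1 makes it at most its square.\<close>
    define b where "b = 1 + (\<Sum>k<d. \<bar>c ! k\<bar>)"
    have b1: "1 \<le> b" by (simp add: b_def sum_nonneg)
    have "c ! k \<le> b\<^sup>2" if "k < d" for k
    proof -
      have "c ! k \<le> \<bar>c ! k\<bar>" by simp
      also have "\<dots> \<le> (\<Sum>k<d. \<bar>c ! k\<bar>)" using that by (intro member_le_sum) auto
      also have "\<dots> \<le> b" by (simp add: b_def)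
      also have "\<dots> \<le> b\<^sup>2" using b1 by (simp add: power2_eq_square)
      finally show ?thesis .
    qed
    then have bdd: "bdd_above ((\<lambda>x. vnorm (T *\<^sub>v x)) ` {x \<in> carrier_vec d. vnorm x \<le> 1})"
      using bound[of _ b] b1 by (intro bdd_aboveI2[where M = b]) auto
    show "\<forall>k<d. c ! k \<le> e\<^sup>2"
    proof (intro allI impI)
      fix k assume k: "k < d"
      have "v ! k \<bullet>c v ! k = 1" using v k by (simp add: orthonormal_def)
      then have "(vnorm (v ! k))\<^sup>2 = 1" using cinner_self[OF vc[OF k]] by (metis of_real_eq_1_iff)
      then have "vnorm (v ! k) \<le> 1" using vnorm_nonneg[of "v ! k"] by (simp add: power2_eq_1_iff)
      then have "vnorm (T *\<^sub>v v ! k) \<le> spectral_norm T"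
        unfolding spectral_norm_def X using vc[OF k] bdd by (intro cSUP_upper) auto
      then have "vnorm (T *\<^sub>v v ! k) \<le> e" using le by simp
      then have "(vnorm (T *\<^sub>v v ! k))\<^sup>2 \<le> e\<^sup>2" using vnorm_nonneg by (intro power_mono) auto
      then show "c ! k \<le> e\<^sup>2" using gram_eigenvalue(2)[OF T S k k] by simp
    qed
  next
    assume "\<forall>k<d. c ! k \<le> e\<^sup>2"
    then show "spectral_norm T \<le> e"
      unfolding spectral_norm_def X
    proof (intro cSUP_least)
      show "{x \<in> carrier_vec d. vnorm x \<le> 1} \<noteq> {}" using zero by blast
    qed (use bound e in auto)
  qed
qed

lemma gram_orthonormal:
  assumes T: "T \<in> carrier_mat n d" and S: "eigsys d (mat_adjoint T * T) v c"
  shows "distinct js \<Longrightarrow> (\<And>j. j \<in> set js \<Longrightarrow> j < d \<and> c ! j \<noteq> 0) \<Longrightarrow>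
    orthonormal n (map (\<lambda>j. complex_of_real (1 / sqrt (c ! j)) \<cdot>\<^sub>v (T *\<^sub>v v ! j)) js)"
proof (induction js)
  case Nil
  then show ?case by (simp add: orthonormal_Nil)
next
  case (Cons j js)
  have v: "orthonormal d v" "length v = d" using S by (auto simp: eigsys_def)
  have Tv: "T *\<^sub>v v ! i \<in> carrier_vec n" if "i < d" for i
    using that orthonormal_carrier[OF v(1)] v mult_mat_vec_carrier[OF T] by simp
  let ?f = "\<lambda>j. complex_of_real (1 / sqrt (c ! j)) \<cdot>\<^sub>v (T *\<^sub>v v ! j)"
  have ip: "?f i \<bullet>c ?f l = complex_of_real (1 / sqrt (c ! i)) * (complex_of_real (1 / sqrt (c ! l)) *
      (if i = l then complex_of_real (c ! i) else 0))" if "i < d" "l < d" for i l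
    using Tv[OF that(1)] Tv[OF that(2)] gram_eigenvalue(1)[OF T S that]
    by (simp add: cinner_smult_left[of _ n] cinner_smult_right[of _ n])
  have j: "j < d" "c ! j \<noteq> 0" using Cons.prems(2) by auto
  have "0 < c ! j" using gram_eigenvalue(2)[OF T S j(1) j(1)] j(2) by (metis zero_le_power2 less_eq_real_def)
  then have "1 / sqrt (c ! j) * (1 / sqrt (c ! j) * c ! j) = 1" by (simp add: field_simps)
  then have "complex_of_real (1 / sqrt (c ! j) * (1 / sqrt (c ! j) * c ! j)) = 1" by (simp only: of_real_1)
  then have "?f j \<bullet>c ?f j = 1" using ip[OF j(1) j(1)] by (simp only: of_real_mult if_True simp_thms)
  moreover have "w \<bullet>c ?f j = 0" if w: "w \<in> set (map ?f js)" for w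
  proof -
    obtain i where i: "i \<in> set js" "w = ?f i" using w by auto
    then have "i < d" "i \<noteq> j" using Cons.prems by auto
    then show ?thesis using ip[of i j] i j by simp
  qed
  moreover have "orthonormal n (map ?f js)" using Cons by simp
  ultimately show ?case using Tv[OF j(1)] by (simp add: orthonormal_Cons)
qed

lemma analysis_sq_sum:
  assumes G: "set G \<subseteq> carrier_vec d"
  shows "mat_trace (frame_op d G) = complex_of_real (\<Sum>j<length G. (vnorm (G ! j))\<^sup>2)"
proof -
  let ?T = "analysis d G"
  have T: "?T \<in> carrier_mat (length G) d" by simp
  have "mat_trace (frame_op d G) = (\<Sum>i<d. (mat_adjoint ?T * ?T) $$ (i, i))"
    by (simp add: mat_trace_def frame_op_def del: index_mult_mat(1))
  also have "\<dots> = (\<Sum>i<d. \<Sum>j<length G. complex_of_real ((cmod (G ! j $ i))\<^sup>2))"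
  proof (intro sum.cong refl)
    fix i assume "i \<in> {..<d}"
    then have i: "i < d" by simp
    have "(mat_adjoint ?T * ?T) $$ (i, i) = (\<Sum>j<length G. mat_adjoint ?T $$ (i, j) * ?T $$ (j, i))"
      by (rule mult_mat_sum[OF mat_adjoint_carrier[OF T] T i i])
    also have "\<dots> = (\<Sum>j<length G. complex_of_real ((cmod (G ! j $ i))\<^sup>2))"
    proof (intro sum.cong refl)
      fix j assume "j \<in> {..<length G}"
      then have j: "j < length G" by simp
      have "mat_adjoint ?T $$ (i, j) = cnj (?T $$ (j, i))"
        using i j by (intro mat_adjoint_index) simp_all
      then show "mat_adjoint ?T $$ (i, j) * ?T $$ (j, i) = complex_of_real ((cmod (G ! j $ i))\<^sup>2)"
        using mult_cnj_cmod[of "G ! j $ i"] by (simp add: analysis_index[OF G j i] del: of_real_power)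
    qed
    finally show "(mat_adjoint ?T * ?T) $$ (i, i) = (\<Sum>j<length G. complex_of_real ((cmod (G ! j $ i))\<^sup>2))" .
  qed
  also have "\<dots> = (\<Sum>j<length G. \<Sum>i<d. complex_of_real ((cmod (G ! j $ i))\<^sup>2))" by (rule sum.swap)
  also have "\<dots> = complex_of_real (\<Sum>j<length G. (vnorm (G ! j))\<^sup>2)"
  proof -
    have "(vnorm (G ! j))\<^sup>2 = (\<Sum>i<d. (cmod (G ! j $ i))\<^sup>2)" if "j < length G" for j
      using that G by (intro vnorm_sq) auto
    then show ?thesis by simp
  qed
  finally show ?thesis .
qed


section \<open>Perturbations orthogonal to the range of a frame\<close>

text \<open>
  The images under \<open>\<Phi>\<close> of an eigenbasis of \<open>\<Phi>\<^sup>* \<Phi>\<close> and the images under \<open>T\<close> of those eigenvectors of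
  \<open>T\<^sup>* T\<close> with nonzero eigenvalue become, after normalization, a single
  orthonormal system in \<open>\<complex>\<^sup>n\<close>, whose length is at most \<open>n\<close>.
\<close>

lemma rank_bound:
  fixes \<Phi> T :: "complex mat"
  assumes \<Phi>: "\<Phi> \<in> carrier_mat n d" and T: "T \<in> carrier_mat n d"
    and orth: "mat_adjoint \<Phi> * T = 0\<^sub>m d d"
    and inj: "\<And>x. x \<in> carrier_vec d \<Longrightarrow> \<Phi> *\<^sub>v x = 0\<^sub>v n \<Longrightarrow> x = 0\<^sub>v d"
    and S: "eigsys d (mat_adjoint T * T) w \<kappa>"
  shows "d + card {j. j < d \<and> \<kappa> ! j \<noteq> 0} \<le> n"
proof -
  obtain u s where u: "eigsys d (mat_adjoint \<Phi> * \<Phi>) u s"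
    using spectral_theorem[OF gram_hermitian[OF \<Phi>]] by blast
  have uo: "orthonormal d u" "length u = d" and wo: "orthonormal d w" "length w = d"
    using u S by (auto simp: eigsys_def)
  have uc: "u ! j \<in> carrier_vec d" if "j < d" for j using that orthonormal_carrier[OF uo(1)] uo by simp
  have wc: "w ! j \<in> carrier_vec d" if "j < d" for j using that orthonormal_carrier[OF wo(1)] wo by simp
  have sj: "s ! j \<noteq> 0" if j: "j < d" for j
  proof
    assume "s ! j = 0"
    then have "(\<Phi> *\<^sub>v u ! j) \<bullet>c (\<Phi> *\<^sub>v u ! j) = 0" using gram_eigenvalue(1)[OF \<Phi> u j j] by simp
    then have "\<Phi> *\<^sub>v u ! j = 0\<^sub>v n"
      using conjugate_square_eq_0_vec[OF mult_mat_vec_carrier[OF \<Phi> uc[OF j]]] by simp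
    then have "u ! j = 0\<^sub>v d" using inj[OF uc[OF j]] by simp
    then have "u ! j \<bullet>c u ! j = 0" by simp
    then show False using uo j by (simp add: orthonormal_def)
  qed
  let ?f = "\<lambda>j. complex_of_real (1 / sqrt (s ! j)) \<cdot>\<^sub>v (\<Phi> *\<^sub>v u ! j)"
  let ?g = "\<lambda>j. complex_of_real (1 / sqrt (\<kappa> ! j)) \<cdot>\<^sub>v (T *\<^sub>v w ! j)"
  let ?js = "filter (\<lambda>j. \<kappa> ! j \<noteq> 0) [0..<d]"
  have f: "orthonormal n (map ?f [0..<d])"
    by (rule gram_orthonormal[OF \<Phi> u]) (use sj in auto)
  have g: "orthonormal n (map ?g ?js)"
    by (rule gram_orthonormal[OF T S]) auto
  have "orthonormal n (map ?f [0..<d] @ map ?g ?js)"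
  proof (rule orthonormal_append[OF g f])
    fix x y assume "x \<in> set (map ?f [0..<d])" "y \<in> set (map ?g ?js)"
    then obtain i j where x: "i < d" "x = ?f i" and y: "j < d" "y = ?g j" by auto
    have c: "\<Phi> *\<^sub>v u ! i \<in> carrier_vec n" "T *\<^sub>v w ! j \<in> carrier_vec n"
      using mult_mat_vec_carrier[OF \<Phi> uc[OF x(1)]] mult_mat_vec_carrier[OF T wc[OF y(1)]] by auto
    have "(\<Phi> *\<^sub>v u ! i) \<bullet>c (T *\<^sub>v w ! j) = u ! i \<bullet>c (mat_adjoint \<Phi> *\<^sub>v (T *\<^sub>v w ! j))"
      by (rule cinner_adjoint[OF \<Phi> uc[OF x(1)] c(2)])
    also have "mat_adjoint \<Phi> *\<^sub>v (T *\<^sub>v w ! j) = (mat_adjoint \<Phi> * T) *\<^sub>v w ! j"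
      by (rule assoc_mult_mat_vec[OF mat_adjoint_carrier[OF \<Phi>] T wc[OF y(1)], symmetric])
    also have "\<dots> = 0\<^sub>v d" using wc[OF y(1)] by (auto simp: orth intro!: eq_vecI)
    also have "u ! i \<bullet>c 0\<^sub>v d = 0" using uc[OF x(1)] by simp
    finally have "(T *\<^sub>v w ! j) \<bullet>c (\<Phi> *\<^sub>v u ! i) = 0" using cinner_commute[OF c(2,1)] by simp
    then show "y \<bullet>c x = 0" using c x y by (simp add: cinner_smult_left[of _ n] cinner_smult_right[of _ n])
  qed
  from orthonormal_length_le[OF this] have "d + length ?js \<le> n" by simp
  moreover have "length ?js = card {j. j < d \<and> \<kappa> ! j \<noteq> 0}"
    by (auto simp: length_filter_conv_card intro!: arg_cong[where f = card])
  ultimately show ?thesis by simp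
qed

text \<open>
  The orthogonal complement of the range of \<open>\<Phi>\<close> has room for at least \<open>n - d\<close> orthonormal vectors. Let
  \<open>T\<close> send \<open>v\<^sub>j\<close>, for \<open>j \<ge> k\<close>, to the multiple \<open>\<surd>\<mu>\<^sub>j\<close> of one such vector and the other \<open>v\<^sub>j\<close> to zero.
\<close>

lemma gram_realize:
  fixes \<Phi> :: "complex mat"
  assumes \<Phi>: "\<Phi> \<in> carrier_mat n d" and v: "orthonormal d v" "length v = d"
    and \<mu>: "length \<mu> = d" "\<And>j. j < d \<Longrightarrow> 0 \<le> \<mu> ! j" "\<And>j. j < k \<Longrightarrow> \<mu> ! j = 0"
    and k: "k \<le> d" "d + (d - k) \<le> n"
  obtains T where "T \<in> carrier_mat n d" "mat_adjoint \<Phi> * T = 0\<^sub>m d d" "mat_adjoint T * T = outer_sum d \<mu> v"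
proof -
  have cols: "set (cols \<Phi>) \<subseteq> carrier_vec n" "length (cols \<Phi>) = d"
    using cols_dim[of \<Phi>] \<Phi> by auto
  obtain ws where ws: "orthonormal n ws" "length ws = d - k" "\<forall>w\<in>set ws. \<forall>f\<in>set (cols \<Phi>). w \<bullet>c f = 0"
    using orthonormal_in_complement[OF cols(1), of "d - k"] cols(2) k(2) by auto
  \<comment> \<open>The zero vectors fill the positions whose coefficient vanishes, so that T can be written as one sum over all j.\<close>
  define W where "W j = (if j < k then 0\<^sub>v n else ws ! (j - k))" for j
  have wsn: "ws ! (j - k) \<in> set ws" if "\<not> j < k" "j < d" for j
    using that ws(2) by (intro nth_mem) simp
  have Wc: "W j \<in> carrier_vec n" if "j < d" for j
    using wsn[of j] that ws(1) by (auto simp: W_def orthonormal_def)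
  have vc: "v ! j \<in> carrier_vec d" if "j < d" for j using that orthonormal_carrier[OF v(1)] v by simp
  define T where "T = mat n d (\<lambda>(a, b). \<Sum>j<d. complex_of_real (sqrt (\<mu> ! j)) * (W j $ a * cnj (v ! j $ b)))"
  have T: "T \<in> carrier_mat n d" by (simp add: T_def)
  have Tv: "T *\<^sub>v v ! l = complex_of_real (sqrt (\<mu> ! l)) \<cdot>\<^sub>v W l" if l: "l < d" for l
  proof (rule eq_vecI)
    fix a assume "a < dim_vec (complex_of_real (sqrt (\<mu> ! l)) \<cdot>\<^sub>v W l)"
    then have a: "a < n" using Wc[OF l] by simp
    have "(T *\<^sub>v v ! l) $ a = (\<Sum>b<d. \<Sum>j<d. complex_of_real (sqrt (\<mu> ! j)) * W j $ a * (v ! l $ b * cnj (v ! j $ b)))"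
      unfolding mult_mat_vec_sum[OF T vc[OF l] a]
    proof (intro sum.cong refl)
      fix b assume "b \<in> {..<d}"
      then have "T $$ (a, b) * v ! l $ b = (\<Sum>j<d. complex_of_real (sqrt (\<mu> ! j)) * (W j $ a * cnj (v ! j $ b)) * v ! l $ b)"
        by (simp add: T_def a sum_distrib_right)
      also have "\<dots> = (\<Sum>j<d. complex_of_real (sqrt (\<mu> ! j)) * W j $ a * (v ! l $ b * cnj (v ! j $ b)))"
        by (intro sum.cong refl) (simp add: mult_ac)
      finally show "T $$ (a, b) * v ! l $ b = (\<Sum>j<d. complex_of_real (sqrt (\<mu> ! j)) * W j $ a * (v ! l $ b * cnj (v ! j $ b)))" .
    qed
    also have "\<dots> = (\<Sum>j<d. \<Sum>b<d. complex_of_real (sqrt (\<mu> ! j)) * W j $ a * (v ! l $ b * cnj (v ! j $ b)))"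
      by (rule sum.swap)
    also have "\<dots> = (\<Sum>j<d. complex_of_real (sqrt (\<mu> ! j)) * W j $ a * (v ! l \<bullet>c v ! j))"
    proof (intro sum.cong refl)
      fix j assume "j \<in> {..<d}"
      then show "(\<Sum>b<d. complex_of_real (sqrt (\<mu> ! j)) * W j $ a * (v ! l $ b * cnj (v ! j $ b))) =
          complex_of_real (sqrt (\<mu> ! j)) * W j $ a * (v ! l \<bullet>c v ! j)"
        using cinner_sum[OF vc, of j "v ! l"] by (simp only: sum_distrib_left lessThan_iff)
    qed
    also have "\<dots> = (\<Sum>j<d. if j = l then complex_of_real (sqrt (\<mu> ! l)) * W l $ a else 0)"
      using v l by (intro sum.cong refl) (auto simp: orthonormal_def)
    also have "\<dots> = complex_of_real (sqrt (\<mu> ! l)) * W l $ a" using l by simp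
    finally show "(T *\<^sub>v v ! l) $ a = (complex_of_real (sqrt (\<mu> ! l)) \<cdot>\<^sub>v W l) $ a"
      using a Wc[OF l] by simp
  next
    show "dim_vec (T *\<^sub>v v ! l) = dim_vec (complex_of_real (sqrt (\<mu> ! l)) \<cdot>\<^sub>v W l)"
      using T Wc[OF l] by simp
  qed
  have \<Phi>W: "mat_adjoint \<Phi> *\<^sub>v W l = 0\<^sub>v d" if l: "l < d" for l
  proof (rule eq_vecI)
    fix i assume "i < dim_vec (0\<^sub>v d :: complex vec)"
    then have i: "i < d" by simp
    have ci: "col \<Phi> i \<in> set (cols \<Phi>)" using i \<Phi> by (simp add: cols_def)
    have "(mat_adjoint \<Phi> *\<^sub>v W l) $ i = (\<Sum>a<n. mat_adjoint \<Phi> $$ (i, a) * W l $ a)"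
      by (rule mult_mat_vec_sum[OF mat_adjoint_carrier[OF \<Phi>] Wc[OF l] i])
    also have "\<dots> = (\<Sum>a<n. W l $ a * cnj (col \<Phi> i $ a))"
      using i \<Phi> by (intro sum.cong refl) (simp add: mat_adjoint_index)
    also have "\<dots> = W l \<bullet>c col \<Phi> i" by (rule cinner_sum[symmetric]) (use cols ci in auto)
    also have "\<dots> = 0"
    proof (cases "l < k")
      case True then show ?thesis using cols(1) ci by (auto simp: W_def)
    next
      case False then show ?thesis using ws(3) wsn[OF False l] ci by (simp add: W_def)
    qed
    finally show "(mat_adjoint \<Phi> *\<^sub>v W l) $ i = 0\<^sub>v d $ i" using i by simp
  qed (use \<Phi> in simp)
  have TT: "mat_adjoint T * T \<in> carrier_mat d d" by (rule mult_carrier_mat[OF mat_adjoint_carrier[OF T] T])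
  have \<Phi>T: "mat_adjoint \<Phi> * T \<in> carrier_mat d d" by (rule mult_carrier_mat[OF mat_adjoint_carrier[OF \<Phi>] T])
  have "mat_adjoint \<Phi> * T = 0\<^sub>m d d"
  proof (rule mat_eq_on_orthonormal_basis[OF \<Phi>T zero_carrier_mat v])
    fix l assume l: "l < d"
    have "(mat_adjoint \<Phi> * T) *\<^sub>v v ! l = mat_adjoint \<Phi> *\<^sub>v (T *\<^sub>v v ! l)"
      by (rule assoc_mult_mat_vec[OF mat_adjoint_carrier[OF \<Phi>] T vc[OF l]])
    also have "\<dots> = complex_of_real (sqrt (\<mu> ! l)) \<cdot>\<^sub>v (mat_adjoint \<Phi> *\<^sub>v W l)"
      unfolding Tv[OF l] by (rule mult_mat_vec[OF mat_adjoint_carrier[OF \<Phi>] Wc[OF l]])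
    also have "\<dots> = 0\<^sub>v d" unfolding \<Phi>W[OF l] by auto
    also have "\<dots> = 0\<^sub>m d d *\<^sub>v v ! l" using vc[OF l] by (auto intro!: eq_vecI)
    finally show "(mat_adjoint \<Phi> * T) *\<^sub>v v ! l = 0\<^sub>m d d *\<^sub>v v ! l" .
  qed
  moreover have "eigsys d (mat_adjoint T * T) v \<mu>"
    unfolding eigsys_def
  proof (intro conjI allI impI)
    fix l assume l: "l < d"
    show "(mat_adjoint T * T) *\<^sub>v v ! l = complex_of_real (\<mu> ! l) \<cdot>\<^sub>v v ! l"
    proof (rule orthonormal_basis_eqI[OF v])
      fix q assume q: "q < d"
      have "((mat_adjoint T * T) *\<^sub>v v ! l) \<bullet>c v ! q = (T *\<^sub>v v ! l) \<bullet>c (T *\<^sub>v v ! q)"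
        by (rule gram_cinner[OF T vc[OF l] vc[OF q]])
      also have "\<dots> = complex_of_real (sqrt (\<mu> ! l)) * (complex_of_real (sqrt (\<mu> ! q)) * (W l \<bullet>c W q))"
        unfolding Tv[OF l] Tv[OF q] using Wc[OF l] Wc[OF q]
        by (simp add: cinner_smult_left[of _ n] cinner_smult_right[of _ n])
      also have "\<dots> = complex_of_real (\<mu> ! l) * (v ! l \<bullet>c v ! q)"
      proof (cases "l < k \<or> q < k")
        case True
        then have "\<mu> ! l = 0 \<or> \<mu> ! q = 0" using \<mu>(3) by auto
        then show ?thesis using v l q by (cases "l = q") (auto simp: orthonormal_def)
      next
        case False
        have "W l \<bullet>c W q = (if l = q then 1 else 0)"
          using False ws l q by (auto simp: W_def orthonormal_def)
        moreover have "complex_of_real (sqrt (\<mu> ! l)) * complex_of_real (sqrt (\<mu> ! l)) = complex_of_real (\<mu> ! l)"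
          using \<mu>(2)[OF l] by (simp only: of_real_mult[symmetric] real_sqrt_mult_self) simp
        ultimately show ?thesis using v l q by (auto simp: orthonormal_def)
      qed
      also have "\<dots> = (complex_of_real (\<mu> ! l) \<cdot>\<^sub>v v ! l) \<bullet>c v ! q"
        using cinner_smult_left[OF vc[OF l] vc[OF q]] by simp
      finally show "((mat_adjoint T * T) *\<^sub>v v ! l) \<bullet>c v ! q = (complex_of_real (\<mu> ! l) \<cdot>\<^sub>v v ! l) \<bullet>c v ! q" .
    qed (use TT vc[OF l] in auto)
  qed (use TT v \<mu> in auto)
  ultimately show ?thesis using that[OF T] eigsys_eq_outer_sum by blast
qed

section \<open>The canonical dual and its shifts\<close>

locale finite_frame =
  fixes d :: nat and F :: "complex vec list"
  assumes frame: "is_frame d F"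
begin

abbreviation "\<Phi> \<equiv> analysis d F"
abbreviation "S \<equiv> frame_op d F"
abbreviation "C \<equiv> canonical_dual d F"

definition "Q = the (mat_inverse S)"

lemma F_carrier: "set F \<subseteq> carrier_vec d" and F_spans: "spans d F"
  using frame by (auto simp: is_frame_def)

lemma \<Phi>_carrier: "\<Phi> \<in> carrier_mat (length F) d" by simp

lemma S_carrier: "S \<in> carrier_mat d d"
  unfolding frame_op_def by (rule mult_carrier_mat[OF mat_adjoint_carrier[OF \<Phi>_carrier] \<Phi>_carrier])

lemma \<Phi>_injective:
  assumes x: "x \<in> carrier_vec d" and z: "\<Phi> *\<^sub>v x = 0\<^sub>v (length F)"
  shows "x = 0\<^sub>v d"
proof (rule spans_orthogonal_zero[OF F_carrier F_spans x])
  fix f assume "f \<in> set F"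
  then obtain i where i: "i < length F" "f = F ! i" by (auto simp: in_set_conv_nth)
  have "x \<bullet>c F ! i = (\<Phi> *\<^sub>v x) $ i" unfolding analysis_apply[OF F_carrier x] using i(1) by simp
  also have "\<dots> = 0" unfolding z using i(1) by simp
  finally show "x \<bullet>c f = 0" using i(2) by simp
qed

lemma S_det: "det S \<noteq> 0"
proof
  assume "det S = 0"
  then obtain x where x: "x \<in> carrier_vec d" "x \<noteq> 0\<^sub>v d" "S *\<^sub>v x = 0\<^sub>v d"
    using det_0_iff_vec_prod_zero[OF S_carrier] by blast
  have "(\<Phi> *\<^sub>v x) \<bullet>c (\<Phi> *\<^sub>v x) = (S *\<^sub>v x) \<bullet>c x"
    unfolding frame_op_def by (rule gram_cinner[OF \<Phi>_carrier x(1) x(1), symmetric])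
  also have "\<dots> = 0" unfolding x(3) using x(1) by simp
  finally have "\<Phi> *\<^sub>v x = 0\<^sub>v (length F)"
    using conjugate_square_eq_0_vec[OF mult_mat_vec_carrier[OF \<Phi>_carrier x(1)]] by simp
  then show False using \<Phi>_injective x by blast
qed

lemma Q: "Q \<in> carrier_mat d d" "S * Q = 1\<^sub>m d" "Q * S = 1\<^sub>m d"
proof -
  have "S \<in> Units (ring_mat TYPE(complex) d ())" by (rule det_non_zero_imp_unit[OF S_carrier S_det])
  then have "mat_inverse S \<noteq> None" using mat_inverse(1)[OF S_carrier, where b = "()"] by blast
  then obtain R where "mat_inverse S = Some R" by blast
  then show "Q \<in> carrier_mat d d" "S * Q = 1\<^sub>m d" "Q * S = 1\<^sub>m d"
    using mat_inverse(2)[OF S_carrier] by (auto simp: Q_def)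
qed

lemma S_adjoint: "mat_adjoint S = S"
  unfolding frame_op_def mat_adjoint_mult[OF mat_adjoint_carrier[OF \<Phi>_carrier] \<Phi>_carrier] mat_adjoint_adjoint ..

lemma Q_adjoint: "mat_adjoint Q = Q"
proof -
  have Qa: "mat_adjoint Q \<in> carrier_mat d d" using Q(1) by simp
  have "mat_adjoint Q * S = 1\<^sub>m d"
    using mat_adjoint_mult[OF S_carrier Q(1)] Q(2) by (simp add: S_adjoint mat_adjoint_one)
  then have "(mat_adjoint Q * S) * Q = Q" using Q(1) by simp
  moreover have "(mat_adjoint Q * S) * Q = mat_adjoint Q * (S * Q)"
    by (rule assoc_mult_mat[OF Qa S_carrier Q(1)])
  ultimately show ?thesis using right_mult_one_mat[OF Qa] by (simp only: Q(2))
qed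

lemma length_C [simp]: "length C = length F"
  by (simp add: canonical_dual_def)

lemma C_carrier: "set C \<subseteq> carrier_vec d"
  using F_carrier Q(1) by (auto simp: canonical_dual_def Q_def[symmetric])

lemma analysis_C: "analysis d C = \<Phi> * Q"
proof (rule eq_matI)
  fix i j assume "i < dim_row (\<Phi> * Q)" "j < dim_col (\<Phi> * Q)"
  then have ij: "i < length F" "j < d" using Q(1) by auto
  have Fi: "F ! i \<in> carrier_vec d" using ij F_carrier by auto
  have Qjl: "Q $$ (l, j) = cnj (Q $$ (j, l))" if "l < d" for l
    using mat_adjoint_index[of l Q j] that ij Q(1) Q_adjoint by auto
  have "analysis d C $$ (i, j) = cnj ((Q *\<^sub>v F ! i) $ j)"
    using analysis_index[OF C_carrier, of i j] ij by (simp add: canonical_dual_def Q_def del: index_mult_mat_vec)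
  also have "\<dots> = (\<Sum>l<d. cnj (F ! i $ l) * cnj (Q $$ (j, l)))"
    unfolding mult_mat_vec_sum[OF Q(1) Fi ij(2)] by (simp add: mult.commute)
  also have "\<dots> = (\<Sum>l<d. \<Phi> $$ (i, l) * Q $$ (l, j))"
    using ij Qjl by (intro sum.cong refl) (simp add: analysis_index[OF F_carrier])
  also have "\<dots> = (\<Phi> * Q) $$ (i, j)" by (rule mult_mat_sum[symmetric, OF \<Phi>_carrier Q(1) ij])
  finally show "analysis d C $$ (i, j) = (\<Phi> * Q) $$ (i, j)" .
qed (use Q in auto)

lemma C_dual: "mat_adjoint \<Phi> * analysis d C = 1\<^sub>m d"
  unfolding analysis_C
  using assoc_mult_mat[OF mat_adjoint_carrier[OF \<Phi>_carrier] \<Phi>_carrier Q(1)] Q(2) by (simp add: frame_op_def)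

text \<open>
  The analysis operator of the canonical dual is \<open>\<Phi> S\<^sup>-\<^sup>1\<close>, so its range is that of \<open>\<Phi>\<close>.
\<close>

lemma C_orthogonal:
  assumes T: "T \<in> carrier_mat (length F) d" and z: "mat_adjoint \<Phi> * T = 0\<^sub>m d d"
  shows "mat_adjoint (analysis d C) * T = 0\<^sub>m d d"
proof -
  have "mat_adjoint (analysis d C) * T = (Q * mat_adjoint \<Phi>) * T"
    unfolding analysis_C mat_adjoint_mult[OF \<Phi>_carrier Q(1)] Q_adjoint ..
  also have "\<dots> = Q * (mat_adjoint \<Phi> * T)"
    by (rule assoc_mult_mat[OF Q(1) mat_adjoint_carrier[OF \<Phi>_carrier] T])
  also have "\<dots> = 0\<^sub>m d d" unfolding z using Q(1) by simp
  finally show ?thesis .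
qed

lemma frame_op_shift:
  assumes K: "length K = length F" "set K \<subseteq> carrier_vec d"
    and z: "mat_adjoint \<Phi> * analysis d K = 0\<^sub>m d d"
  shows "frame_op d (map2 (+) C K) = frame_op d C + frame_op d K"
proof -
  let ?c = "analysis d C" and ?k = "analysis d K"
  have c: "?c \<in> carrier_mat (length F) d" using analysis_carrier[of d C] by simp
  have k: "?k \<in> carrier_mat (length F) d" using analysis_carrier[of d K] K by simp
  note a = mat_adjoint_carrier[OF c] mat_adjoint_carrier[OF k]
  have ck: "mat_adjoint ?c * ?k = 0\<^sub>m d d" by (rule C_orthogonal[OF k z])
  have kc: "mat_adjoint ?k * ?c = 0\<^sub>m d d"
    using mat_adjoint_mult[OF a(1) k] ck by (simp add: mat_adjoint_zero mat_adjoint_adjoint)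
  have cc: "mat_adjoint ?c * ?c \<in> carrier_mat d d" and kk: "mat_adjoint ?k * ?k \<in> carrier_mat d d"
    using mult_carrier_mat[OF a(1) c] mult_carrier_mat[OF a(2) k] by auto
  have "mat_adjoint (?c + ?k) * (?c + ?k) = mat_adjoint ?c * (?c + ?k) + mat_adjoint ?k * (?c + ?k)"
    unfolding mat_adjoint_add[OF c k] by (rule add_mult_distrib_mat[OF a(1) a(2) add_carrier_mat[OF k]])
  also have "mat_adjoint ?c * (?c + ?k) = mat_adjoint ?c * ?c"
    unfolding mult_add_distrib_mat[OF a(1) c k] ck using cc by simp
  also have "mat_adjoint ?k * (?c + ?k) = mat_adjoint ?k * ?k"
    unfolding mult_add_distrib_mat[OF a(2) c k] kc using kk by simp
  finally show ?thesis
    using analysis_add[of K C d] K C_carrier by (simp add: frame_op_def)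
qed

lemma shift_dual:
  assumes K: "length K = length F" "set K \<subseteq> carrier_vec d"
    and z: "mat_adjoint \<Phi> * analysis d K = 0\<^sub>m d d"
  shows "map2 (+) C K \<in> dual_frames d F"
proof -
  have c: "analysis d C \<in> carrier_mat (length F) d" using analysis_carrier[of d C] by simp
  have k: "analysis d K \<in> carrier_mat (length F) d" using analysis_carrier[of d K] K by simp
  have "mat_adjoint \<Phi> * analysis d (map2 (+) C K) = mat_adjoint \<Phi> * analysis d C + mat_adjoint \<Phi> * analysis d K"
    using analysis_add[of K C d] K C_carrier mult_add_distrib_mat[OF mat_adjoint_carrier[OF \<Phi>_carrier] c k] by simp
  also have "\<dots> = 1\<^sub>m d" unfolding C_dual z by simp
  finally have "mat_adjoint \<Phi> * analysis d (map2 (+) C K) = 1\<^sub>m d" .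
  moreover have "set (map2 (+) C K) \<subseteq> carrier_vec d"
  proof
    fix w assume "w \<in> set (map2 (+) C K)"
    then obtain i where "i < length C" "w = C ! i + K ! i" using K(1) by (auto simp: in_set_conv_nth)
    then show "w \<in> carrier_vec d" using K C_carrier by (metis add_carrier_vec length_C nth_mem subsetD)
  qed
  ultimately show ?thesis using K by (simp add: dual_frames_def)
qed

lemma dual_shiftE:
  assumes G: "G \<in> dual_frames d F"
  obtains K where "length K = length F" "set K \<subseteq> carrier_vec d" "G = map2 (+) C K"
    "mat_adjoint \<Phi> * analysis d K = 0\<^sub>m d d"
proof -
  have lG: "length G = length F" and Gc: "set G \<subseteq> carrier_vec d"
    and Gd: "mat_adjoint \<Phi> * analysis d G = 1\<^sub>m d"
    using G by (auto simp: dual_frames_def)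
  define K where "K = map2 (-) G C"
  have Ki: "K ! i = G ! i - C ! i" if "i < length F" for i using that lG by (simp add: K_def)
  have Gi: "G ! i \<in> carrier_vec d" "C ! i \<in> carrier_vec d" if "i < length F" for i
    using that lG Gc C_carrier by (auto dest: nth_mem)
  have K: "length K = length F" using lG by (simp add: K_def)
  have Kc: "set K \<subseteq> carrier_vec d"
    using Ki Gi K by (auto simp: in_set_conv_nth)
  have GK: "G = map2 (+) C K"
  proof (rule nth_equalityI)
    fix i assume "i < length G"
    then have i: "i < length F" using lG by simp
    have "C ! i + (G ! i - C ! i) = G ! i" using Gi[OF i] by (intro eq_vecI) auto
    then show "G ! i = map2 (+) C K ! i" using i K Ki by simp
  qed (use lG K in simp)
  have c: "analysis d C \<in> carrier_mat (length F) d" using analysis_carrier[of d C] by simp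
  have k: "analysis d K \<in> carrier_mat (length F) d" using analysis_carrier[of d K] K by simp
  have M: "mat_adjoint \<Phi> * analysis d K \<in> carrier_mat d d"
    by (rule mult_carrier_mat[OF mat_adjoint_carrier[OF \<Phi>_carrier] k])
  have "1\<^sub>m d = mat_adjoint \<Phi> * analysis d C + mat_adjoint \<Phi> * analysis d K"
    using Gd analysis_add[of K C d] K Kc C_carrier
      mult_add_distrib_mat[OF mat_adjoint_carrier[OF \<Phi>_carrier] c k] GK by simp
  then have eq: "1\<^sub>m d = 1\<^sub>m d + mat_adjoint \<Phi> * analysis d K" unfolding C_dual .
  have "mat_adjoint \<Phi> * analysis d K = 0\<^sub>m d d"
  proof (rule eq_matI)
    fix i j assume "i < dim_row (0\<^sub>m d d :: complex mat)" "j < dim_col (0\<^sub>m d d :: complex mat)"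
    then have ij: "i < d" "j < d" by auto
    have "(1\<^sub>m d + mat_adjoint \<Phi> * analysis d K) $$ (i, j) = 1\<^sub>m d $$ (i, j) + (mat_adjoint \<Phi> * analysis d K) $$ (i, j)"
      by (rule index_add_mat(1)) (use M ij in auto)
    then show "(mat_adjoint \<Phi> * analysis d K) $$ (i, j) = 0\<^sub>m d d $$ (i, j)"
      using eq ij by (metis add_cancel_right_right index_zero_mat(1))
  qed (use M in auto)
  then show ?thesis using that K Kc GK by blast
qed

lemma shift_difference:
  assumes K: "length K = length F" "set K \<subseteq> carrier_vec d"
  shows "analysis d (map2 (+) C K) - analysis d C = analysis d K"
proof -
  have "analysis d (map2 (+) C K) = analysis d C + analysis d K"
    by (rule analysis_add) (use K C_carrier in auto)
  then show ?thesis using K by (intro eq_matI) auto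
qed

end


section \<open>Optimal duals\<close>

context finite_frame
begin

abbreviation "A \<equiv> frame_op d C"
abbreviation "lam \<equiv> eigenvalues_decr A"

lemma frame_op_hermitian: "hermitian_mat d (frame_op d G)"
  unfolding frame_op_def by (rule gram_hermitian[OF analysis_carrier])

end

locale restricted_dual_problem = finite_frame +
  fixes t \<epsilon> :: real
  assumes eps: "0 < \<epsilon>"
    and t_gt: "Re (mat_trace A) < t"
    and t_le: "t - Re (mat_trace A)
      \<le> real_of_int (min (int d - (2 * int d - int (length F))) (int d)) * \<epsilon>\<^sup>2"
begin

abbreviation "m \<equiv> 2 * int d - int (length F)"

lemma length_lam [simp]: "length lam = d"
  by (rule length_eigenvalues_decr[OF frame_op_hermitian])

lemma redundancy: "m < int d"
proof -
  have "0 < real_of_int (min (int d - m) (int d)) * \<epsilon>\<^sup>2" using t_gt t_le by linarith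
  then have "0 < real_of_int (min (int d - m) (int d))" using eps by (simp add: zero_less_mult_iff)
  then show ?thesis by simp
qed

sublocale W: water_filling lam t "\<epsilon>\<^sup>2" m
proof
  show "sorted_wrt (\<ge>) lam" by (rule sorted_eigenvalues_decr)
  show "m \<le> int (length lam)" using redundancy by simp
  show "sum_list lam \<le> t" "t - sum_list lam \<le> real_of_int (min (int (length lam) - m) (int (length lam))) * \<epsilon>\<^sup>2"
    using t_gt t_le by (simp_all add: sum_eigenvalues_decr[OF frame_op_hermitian])
qed (use eps in simp)

abbreviation "\<rho> \<equiv> rho_min t (\<epsilon>\<^sup>2) lam m"

lemma rho: "\<rho> = map2 (+) lam W.increment"
  using W.rho_min_eq W.optimum_def by simp

lemma rho_minus_lam: "map2 (-) \<rho> lam = W.increment"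
  unfolding rho by (rule map2_minus_add) simp

text \<open>
  This translates the conditions on \<open>G\<close> into conditions on the spectrum of the shift: the norm bound
  caps the eigenvalues, the energy bound becomes a bound on the trace, and the number of nonzero
  eigenvalues is limited by the redundancy of the frame.
\<close>

lemma restricted_dualE:
  assumes G: "G \<in> restricted_duals d t \<epsilon> F"
  obtains K w \<kappa> where "length K = length F" "set K \<subseteq> carrier_vec d" "G = map2 (+) C K"
    "mat_adjoint \<Phi> * analysis d K = 0\<^sub>m d d" "frame_op d G = A + frame_op d K"
    "eigsys d (frame_op d K) w \<kappa>" "sorted \<kappa>" "W.feasible \<kappa>"
proof -
  have Gd: "G \<in> dual_frames d F" and Gt: "t \<le> (\<Sum>j<length G. (vnorm (G ! j))\<^sup>2)"
    and Gn: "spectral_norm (analysis d G - analysis d C) \<le> \<epsilon>"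
    using G by (auto simp: restricted_duals_def)
  obtain K where K: "length K = length F" "set K \<subseteq> carrier_vec d" and GK: "G = map2 (+) C K"
    and z: "mat_adjoint \<Phi> * analysis d K = 0\<^sub>m d d"
    using dual_shiftE[OF Gd] .
  have k: "analysis d K \<in> carrier_mat (length F) d" using analysis_carrier[of d K] K by simp
  have SG: "frame_op d G = A + frame_op d K" unfolding GK by (rule frame_op_shift[OF K z])
  obtain w0 c0 where w0: "eigsys d (frame_op d K) w0 c0" using spectral_theorem[OF frame_op_hermitian] by blast
  define \<kappa> where "\<kappa> = sort c0"
  obtain w where w: "eigsys d (frame_op d K) w \<kappa>" using eigsys_permute[OF w0, of \<kappa>] by (auto simp: \<kappa>_def)
  have wg: "eigsys d (mat_adjoint (analysis d K) * analysis d K) w \<kappa>" using w by (simp add: frame_op_def)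
  have l\<kappa>: "length \<kappa> = d" using w by (simp add: eigsys_def)
  have "0 \<le> \<kappa> ! j" if "j < d" for j
    using gram_eigenvalue(2)[OF k wg that that] by (metis zero_le_power2)
  moreover have "spectral_norm (analysis d K) \<le> \<epsilon>" using Gn shift_difference[OF K] GK by simp
  then have "\<forall>j<d. \<kappa> ! j \<le> \<epsilon>\<^sup>2" using spectral_norm_le_iff[OF k wg] eps by simp
  ultimately have "\<forall>x\<in>set \<kappa>. 0 \<le> x \<and> x \<le> \<epsilon>\<^sup>2" using l\<kappa> by (auto simp: in_set_conv_nth)
  moreover have "t - sum_list lam \<le> sum_list \<kappa>"
  proof -
    have "set G \<subseteq> carrier_vec d" using Gd by (simp add: dual_frames_def)
    then have "t \<le> Re (mat_trace (frame_op d G))" using Gt by (simp add: analysis_sq_sum)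
    also have "\<dots> = Re (mat_trace A) + Re (mat_trace (frame_op d K))"
      unfolding SG using frame_op_hermitian[of C] frame_op_hermitian[of K]
      by (simp add: mat_trace_add[of _ d] hermitian_mat_def)
    also have "\<dots> = sum_list lam + sum_list \<kappa>"
      using eigsys_trace[OF w] by (simp add: sum_eigenvalues_decr[OF frame_op_hermitian])
    finally show ?thesis by simp
  qed
  moreover have "int (card {j. j < length \<kappa> \<and> \<kappa> ! j \<noteq> 0}) \<le> int (length lam) - m"
    using rank_bound[OF \<Phi>_carrier k z \<Phi>_injective wg] l\<kappa> by simp
  ultimately have "W.feasible \<kappa>" using l\<kappa> by (simp add: W.feasible_def)
  then show ?thesis using that[OF K GK z SG w _] by (simp add: \<kappa>_def)
qed

lemma rho_submajorized:
  assumes G: "G \<in> restricted_duals d t \<epsilon> F"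
  shows "\<rho> \<prec>\<^sub>w eigenvalues_decr (frame_op d G)"
proof -
  obtain K w \<kappa> where SG: "frame_op d G = A + frame_op d K"
    and w: "eigsys d (frame_op d K) w \<kappa>" "sorted \<kappa>" and f: "W.feasible \<kappa>"
    using restricted_dualE[OF G] .
  obtain u where u: "eigsys d A u lam" using eigsys_eigenvalues_decr[OF frame_op_hermitian] .
  obtain z where z: "eigsys d (A + frame_op d K) z (eigenvalues_decr (frame_op d G))"
    using eigsys_eigenvalues_decr[OF frame_op_hermitian[of G]] SG by auto
  show ?thesis
  proof (rule submajorizedI)
    show "length \<rho> = length (eigenvalues_decr (frame_op d G))"
      using length_eigenvalues_decr[OF frame_op_hermitian] by (simp add: rho)
    fix q
    have "excess q \<rho> \<le> excess q (map2 (+) lam \<kappa>)"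
      using W.excess_minimal[OF f] W.rho_min_eq by simp
    also have "\<dots> \<le> excess q (eigenvalues_decr (frame_op d G))"
      by (rule lidskii[OF u sorted_eigenvalues_decr w z])
    finally show "excess q \<rho> \<le> excess q (eigenvalues_decr (frame_op d G))" .
  qed
qed

lemma diagonal_shift_frame_op:
  assumes "diagonal_shift d F lam \<rho> G K"
  obtains v where "orthonormal d v" "length v = d" "frame_op d G = A + frame_op d K"
    "eigsys d A v lam" "eigsys d (frame_op d K) v W.increment" "eigsys d (frame_op d G) v \<rho>"
proof -
  obtain v where K: "length K = length F" "set K \<subseteq> carrier_vec d" and GK: "G = map2 (+) C K"
    and z: "mat_adjoint \<Phi> * analysis d K = 0\<^sub>m d d" and v: "orthonormal d v" "length v = d"
    and A: "A = outer_sum d lam v" and SK: "frame_op d K = outer_sum d W.increment v"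
    using assms unfolding diagonal_shift_def orthonormal_basis_iff rho_minus_lam by blast
  have SG: "frame_op d G = A + frame_op d K" unfolding GK by (rule frame_op_shift[OF K z])
  have "eigsys d (outer_sum d lam v) v lam" by (rule eigsys_outer_sum[OF v]) simp
  then have eA: "eigsys d A v lam" using A by simp
  have "eigsys d (outer_sum d W.increment v) v W.increment" by (rule eigsys_outer_sum[OF v]) simp
  then have eK: "eigsys d (frame_op d K) v W.increment" using SK by simp
  have "eigsys d (A + frame_op d K) v (map2 (+) lam W.increment)" by (rule eigsys_add[OF eA eK])
  then have eG: "eigsys d (frame_op d G) v \<rho>" using SG rho by simp
  show ?thesis by (rule that[OF v SG eA eK eG])
qed

text \<open>
  Place the water filling increments on an eigenbasis of \<open>A\<close>. At most \<open>n - d\<close> of them are nonzero, so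
  a shift with this frame operator exists.
\<close>

lemma optimal_dual_exists:
  "\<exists>G\<in>restricted_duals d t \<epsilon> F. eigenvalues_decr (frame_op d G) = decr \<rho>"
proof -
  obtain u where u: "eigsys d A u lam" using eigsys_eigenvalues_decr[OF frame_op_hermitian] .
  have uo: "orthonormal d u" "length u = d" using u by (auto simp: eigsys_def)
  have nu: "length W.increment = d" by simp
  have nu_bounds: "0 \<le> W.increment ! j \<and> W.increment ! j \<le> \<epsilon>\<^sup>2" if "j < d" for j
    using W.feasible_increment that nu by (auto simp: W.feasible_def)
  have "W.head_length \<le> d" using W.head_length_le by simp
  moreover have "d + (d - W.head_length) \<le> length F" using redundancy by (simp add: W.head_length_def)
  ultimately obtain T where T: "T \<in> carrier_mat (length F) d" "mat_adjoint \<Phi> * T = 0\<^sub>m d d"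
    "mat_adjoint T * T = outer_sum d W.increment u"
    using gram_realize[OF \<Phi>_carrier uo nu, of W.head_length] nu_bounds
      W.feasible_sorted_zero[OF W.feasible_increment W.sorted_increment] by blast
  obtain K where K: "length K = length F" "set K \<subseteq> carrier_vec d" and KT: "analysis d K = T"
    using analysis_surj[OF T(1)] .
  define G where "G = map2 (+) C K"
  have z: "mat_adjoint \<Phi> * analysis d K = 0\<^sub>m d d" using T(2) KT by simp
  have G_dual: "G \<in> dual_frames d F" unfolding G_def by (rule shift_dual[OF K z])
  have SG: "frame_op d G = A + frame_op d K" unfolding G_def by (rule frame_op_shift[OF K z])
  have "frame_op d K = outer_sum d W.increment u" using T(3) KT by (simp add: frame_op_def)
  then have eK: "eigsys d (frame_op d K) u W.increment" using eigsys_outer_sum[OF uo nu] by simp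
  have "eigsys d (A + frame_op d K) u (map2 (+) lam W.increment)" by (rule eigsys_add[OF u eK])
  then have eG: "eigsys d (frame_op d G) u \<rho>" using SG rho by simp
  have Gc: "set G \<subseteq> carrier_vec d" using G_dual by (simp add: dual_frames_def)
  have "(\<Sum>j<length G. (vnorm (G ! j))\<^sup>2) = Re (mat_trace (frame_op d G))"
    by (simp add: analysis_sq_sum[OF Gc])
  also have "\<dots> = t" using eigsys_trace[OF eG] W.sum_optimum W.rho_min_eq by simp
  finally have "t \<le> (\<Sum>j<length G. (vnorm (G ! j))\<^sup>2)" by simp
  moreover have "spectral_norm (analysis d G - analysis d C) \<le> \<epsilon>"
  proof -
    have "analysis d G - analysis d C = T" unfolding G_def using shift_difference[OF K] KT by simp
    moreover have "eigsys d (mat_adjoint T * T) u W.increment" using eK KT by (simp add: frame_op_def)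
    ultimately show ?thesis using spectral_norm_le_iff[OF T(1)] eps nu_bounds by simp
  qed
  ultimately have "G \<in> restricted_duals d t \<epsilon> F" using G_dual by (simp add: restricted_duals_def)
  then show ?thesis using eigsys_eigenvalues[OF eG] by blast
qed

text \<open>
  With the spectrum of \<open>S\<^sub>G\<close> equal to \<open>\<rho>\<close>, the inequality \<open>\<rho> \<prec>\<^sub>w \<lambda> + \<kappa>\<close> and Lidskii's inequality are
  both equalities: the first identifies \<open>\<kappa>\<close>, the second yields the common eigenbasis.
\<close>

lemma optimal_dual_diagonal:
  assumes G: "G \<in> restricted_duals d t \<epsilon> F" and eq: "eigenvalues_decr (frame_op d G) = decr \<rho>"
  shows "\<exists>K. diagonal_shift d F lam \<rho> G K"
proof -
  obtain K w \<kappa> where K: "length K = length F" "set K \<subseteq> carrier_vec d" and GK: "G = map2 (+) C K"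
    and z: "mat_adjoint \<Phi> * analysis d K = 0\<^sub>m d d"
    and SG: "frame_op d G = A + frame_op d K"
    and w: "eigsys d (frame_op d K) w \<kappa>" "sorted \<kappa>" and f: "W.feasible \<kappa>"
    using restricted_dualE[OF G] .
  have l\<kappa>: "length lam = length \<kappa>" using f by (simp add: W.feasible_def)
  obtain u where u: "eigsys d A u lam" using eigsys_eigenvalues_decr[OF frame_op_hermitian] .
  obtain y where y: "eigsys d (A + frame_op d K) y (eigenvalues_decr (frame_op d G))"
    using eigsys_eigenvalues_decr[OF frame_op_hermitian[of G]] SG by auto
  have le: "excess q (map2 (+) lam \<kappa>) \<le> excess q \<rho>" for q
    using lidskii[OF u sorted_eigenvalues_decr w y, of q] eq by simp
  have ge: "excess q \<rho> \<le> excess q (map2 (+) lam \<kappa>)" for q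
    using W.excess_minimal[OF f] W.rho_min_eq by simp
  have "complex_of_real (sum_list lam) + complex_of_real (sum_list \<kappa>) = complex_of_real (sum_list (decr \<rho>))"
    using eigsys_trace[OF y] eigsys_trace[OF u] eigsys_trace[OF w(1)] eq
      frame_op_hermitian[of C] frame_op_hermitian[of K]
    by (simp add: mat_trace_add[of _ d] hermitian_mat_def)
  then have "sum_list lam + sum_list \<kappa> = sum_list (decr \<rho>)"
    by (simp only: of_real_add[symmetric] of_real_eq_iff)
  also have "sum_list (decr \<rho>) = sum_list \<rho>" by (metis mset_decr sum_mset_sum_list)
  also have "\<dots> = t" using W.sum_optimum W.rho_min_eq by simp
  finally have "sum_list (map2 (+) lam \<kappa>) = t" using sum_list_map2_add[OF l\<kappa>] by simp
  then have lr: "map2 (+) lam \<kappa> = \<rho>"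
    using W.minimizer_unique[OF f w(2)] le[of W.level] ge[of W.level] W.rho_min_eq by simp
  then have \<kappa>: "\<kappa> = W.increment" using map2_minus_add[OF l\<kappa>] rho_minus_lam by simp
  obtain v where v: "eigsys d A v lam" "eigsys d (frame_op d K) v \<kappa>"
    using joint_eigenbasis[OF u sorted_eigenvalues_decr w y] eq lr by auto
  have "orthonormal_basis d v" using v(1) by (simp add: orthonormal_basis_iff eigsys_def)
  moreover have "A = outer_sum d lam v" using eigsys_eq_outer_sum[OF v(1)] .
  moreover have "frame_op d K = outer_sum d (map2 (-) \<rho> lam) v"
    using eigsys_eq_outer_sum[OF v(2)] \<kappa> rho_minus_lam by simp
  ultimately show ?thesis using K GK z unfolding diagonal_shift_def by blast
qed

end

theorem theorem4p9:
  fixes F :: "complex vec list" and d n :: nat and m :: int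
    and t \<epsilon> :: real and lam \<rho> :: "real list"
  assumes "is_frame d F"
    and "length F = n"
    and "m = 2 * int d - int n"
    and "\<epsilon> > 0"
    and "t > Re (mat_trace (frame_op d (canonical_dual d F)))"
    and "t - Re (mat_trace (frame_op d (canonical_dual d F)))
           \<le> real_of_int (min (int d - m) (int d)) * \<epsilon>\<^sup>2"
    and "lam = eigenvalues_decr (frame_op d (canonical_dual d F))"
    and "\<rho> = rho_min t (\<epsilon>\<^sup>2) lam m"
  shows
    "(\<exists>G0 \<in> restricted_duals d t \<epsilon> F. eigenvalues_decr (frame_op d G0) = decr \<rho>) \<and>
     (\<forall>G \<in> restricted_duals d t \<epsilon> F.
        (\<forall>G' \<in> restricted_duals d t \<epsilon> F.
           eigenvalues_decr (frame_op d G) \<prec>\<^sub>w eigenvalues_decr (frame_op d G'))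
        \<longleftrightarrow> eigenvalues_decr (frame_op d G) = decr \<rho>) \<and>
     (\<forall>G \<in> restricted_duals d t \<epsilon> F.
        (eigenvalues_decr (frame_op d G) = decr \<rho>
           \<longleftrightarrow> (\<exists>K. diagonal_shift d F lam \<rho> G K)) \<and>
        (\<forall>K. diagonal_shift d F lam \<rho> G K \<longrightarrow>
           frame_op d G = frame_op d (canonical_dual d F) + frame_op d K \<and>
           frame_op d (canonical_dual d F) * frame_op d G
             = frame_op d G * frame_op d (canonical_dual d F)))"
proof -
  interpret P: restricted_dual_problem d F t \<epsilon>
    using assms by unfold_locales auto
  have lam: "lam = eigenvalues_decr (frame_op d (canonical_dual d F))" by fact
  have rho: "\<rho> = rho_min t (\<epsilon>\<^sup>2) (eigenvalues_decr (frame_op d (canonical_dual d F))) (2 * int d - int (length F))"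
    using assms by simp
  let ?D = "restricted_duals d t \<epsilon> F"
  let ?ev = "\<lambda>G. eigenvalues_decr (frame_op d G)"
  have decr_ev: "decr (?ev G) = ?ev G" for G
    using eigsys_eigenvalues_decr[OF P.frame_op_hermitian[of G]] eigsys_eigenvalues by metis
  have le: "\<rho> \<prec>\<^sub>w ?ev G" if "G \<in> ?D" for G
    using P.rho_submajorized[OF that] rho by simp
  have ex: "\<exists>G0\<in>?D. ?ev G0 = decr \<rho>" using P.optimal_dual_exists rho by simp
  have opt: "(\<forall>G'\<in>?D. ?ev G \<prec>\<^sub>w ?ev G') \<longleftrightarrow> ?ev G = decr \<rho>" if G: "G \<in> ?D" for G
  proof
    assume min: "\<forall>G'\<in>?D. ?ev G \<prec>\<^sub>w ?ev G'"
    obtain G0 where "G0 \<in> ?D" "?ev G0 = decr \<rho>" using ex by blast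
    then have "?ev G \<prec>\<^sub>w decr \<rho>" using min by metis
    moreover have "decr \<rho> \<prec>\<^sub>w ?ev G"
      using le[OF G] submajorized_mset_left[of "decr \<rho>" \<rho>] by simp
    ultimately have "mset (?ev G) = mset \<rho>" using submajorized_antisym by fastforce
    then show "?ev G = decr \<rho>" using decr_cong_mset decr_ev by metis
  next
    assume "?ev G = decr \<rho>"
    then show "\<forall>G'\<in>?D. ?ev G \<prec>\<^sub>w ?ev G'"
      using le submajorized_mset_left[of "decr \<rho>" \<rho>] by simp
  qed
  have diag: "?ev G = decr \<rho> \<longleftrightarrow> (\<exists>K. diagonal_shift d F lam \<rho> G K)" if G: "G \<in> ?D" for G
  proof
    assume "?ev G = decr \<rho>"
    then show "\<exists>K. diagonal_shift d F lam \<rho> G K"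
      using P.optimal_dual_diagonal[OF G] rho lam by simp
  next
    assume "\<exists>K. diagonal_shift d F lam \<rho> G K"
    then obtain K where "diagonal_shift d F (?ev (canonical_dual d F)) \<rho> G K" using lam by blast
    then obtain v where "eigsys d (frame_op d G) v \<rho>"
      using P.diagonal_shift_frame_op[of G K] unfolding rho by blast
    then show "?ev G = decr \<rho>" by (rule eigsys_eigenvalues)
  qed
  have comm: "frame_op d G = frame_op d (canonical_dual d F) + frame_op d K \<and>
      frame_op d (canonical_dual d F) * frame_op d G = frame_op d G * frame_op d (canonical_dual d F)"
    if K: "diagonal_shift d F lam \<rho> G K" for G K
  proof -
    have "diagonal_shift d F (?ev (canonical_dual d F)) \<rho> G K" using K lam by simp
    then obtain v where "frame_op d G = frame_op d (canonical_dual d F) + frame_op d K"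
      "eigsys d (frame_op d (canonical_dual d F)) v (?ev (canonical_dual d F))" "eigsys d (frame_op d G) v \<rho>"
      using P.diagonal_shift_frame_op[of G K] unfolding rho by blast
    then show ?thesis using eigsys_commute by blast
  qed
  show ?thesis using ex opt diag comm by blast
qed

end
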